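(* Let $X$ be a compact connected orientable strongly pseudoconvex CR manifold of dimension $2n-1$, $n\ge2$, with a transversal CR locally free $S^1$-action. Let $x_0\in X_k$, $k>1$. Let $(z,\theta,\varphi)$ be canonical coordinates centered at $x_0$ and defined on a canonical patch $D_1=\{(z,\theta):|z|<\varepsilon_1,|\theta|<\delta_1\}$, and let $D=\{(z,\theta):|z|<\varepsilon,|\theta|<\delta\}\Subset D_1$ be a neighborhood of $x_0$ small enough that $$e^{i\theta}\circ(0,0)\ne(z,\hat\theta)\quad\forall\theta\in[0,2\pi),\ (z,\hat\theta)\in D,\ z\ne0.$$ Let $\Phi$ and $\hat b(z,w,m)$ be the phase function and symbol described in the context. For $k\nmid m$ we have $S_m(x,x_0)=0$ for all $x\in D$. For $k\mid m$ we have, with $x=(z,x_{2n-1})$, $$S_m(x,x_0)\equiv\frac{k}{2\pi}e^{im(x_{2n-1}+\Phi(z,0))}\,\hat b(z,0,m)\mod O(m^{-\infty})\quad\text{on }D.$$ In particular, for $k\mid m$ and $x=x_0$, $$S_m(x_0,x_0)=\frac{k}{2\pi}\hat b(0,0,m)+O(m^{-\infty}),\qquad \hat b(0,0,m)\sim\hat b_0(0,0)m^{n-1}+\hat b_1(0,0)m^{n-2}+\cdots$$ in the sense that for any $N\in\mathbb N_0$ there exists $C_N>0$ independent of $m$ such that $$\Big|\hat b(0,0,m)-\sum_{j=0}^N\hat b_j(0,0)m^{n-1-j}\Big|\le C_Nm^{n-2-N}\quad\text{for all }m\in\mathbb N.$$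
   Context: CR setting. A CR manifold $(X,T^{1,0}X)$ of dimension $2n-1$ is a smooth manifold with a complex subbundle $T^{1,0}X\subset\mathbb CTX$ of rank $n-1$, $T^{1,0}X\cap T^{0,1}X=\{0\}$ ($T^{0,1}X=\overline{T^{1,0}X}$), closed under Lie brackets of sections. $u$ is CR ($\overline\partial_bu=0$) if $\overline Zu=0$ for all $Z\in C^\infty(X,T^{1,0}X)$. For an $S^1$-action $e^{i\theta}\circ x$ let $(Tu)(x)=\frac{\partial}{\partial\theta}u(e^{i\theta}\circ x)|_{\theta=0}$; the action is CR if $[T,C^\infty(X,T^{1,0}X)]\subset C^\infty(X,T^{1,0}X)$, transversal if $\mathbb CT(x)\oplus T^{1,0}_xX\oplus T^{0,1}_xX=\mathbb CT_xX$ for all $x$. $\omega_0$ is the real one-form vanishing on $T^{1,0}X\oplus T^{0,1}X$ with $\langle\omega_0,T\rangle=-1$. The Levi form is $\mathcal L_x(U,\overline V)=\frac1{2i}\langle[\mathcal U,\overline{\mathcal V}](x),\omega_0(x)\rangle$ ($\mathcal U,\mathcal V\in C^\infty(X,T^{1,0}X)$ extending $U,V\in T^{1,0}_xX$); $X$ is strongly pseudoconvex if $\mathcal L_x$ is positive definite for all $x$. For $k\in\mathbb N=\{1,2,\dots\}$, $X_k=\{x\in X:e^{i\theta}\circ x\ne x\ \forall\theta\in(0,\frac{2\pi}k),\ e^{i2\pi/k}\circ x=x\}$; $X_{\rm reg}=X_1$ is assumed non-empty. Metric and kernels. Fix an $S^1$-invariant (rigid) Hermitian metric $\langle\cdot|\cdot\rangle$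 on $\mathbb CTX$ with $T^{1,0}X\perp T^{0,1}X$, $T\perp(T^{1,0}X\oplus T^{0,1}X)$, $\langle T|T\rangle=1$, and $\langle u|v\rangle$ real for real $u,v$. $\det\mathcal L_x$ is the product of the eigenvalues of $\mathcal L_x$ with respect to this metric, $dv_X$ the induced volume form, and $L^2(X)$ is taken with respect to $dv_X$. For $m\in\mathbb N$, $H^0_{b,m}(X)=\{u\in C^\infty(X):\overline\partial_bu=0,Tu=imu\}$ (finite-dimensional), $S_m:L^2(X)\to H^0_{b,m}(X)$ is the orthogonal projection and $S_m(x,y)=\sum_jf_j(x)\overline{f_j(y)}$ its kernel, $\{f_j\}$ an orthonormal basis of $H^0_{b,m}(X)$. Canonical coordinates centered at $x_0$: local coordinates $(x_1,\ldots,x_{2n-1})=(z,\theta)$, $z_j=x_{2j-1}+ix_{2j}$, $\theta=x_{2n-1}$, with $x_0=(0,0)$, on a patch $\{|z|<\varepsilon,|\theta|<\delta\}$ (a canonical local patch), on which $T=\frac{\partial}{\partial\theta}$ and $Z_j=\frac{\partial}{\partial z_j}+i\frac{\partial\varphi}{\partial z_j}(z)\frac{\partial}{\partial\theta}$, $j=1,\ldots,n-1$, form a basis of $T^{1,0}X$, with $\varphi(z)$ smooth, real, independent of $\theta$, $\varphi(z)=\sum_j\lambda_j|z_j|^2+O(|z|^3)$, $\lambda_j$ the eigenvalues of $\mathcal L_{x_0}$. Phase function. Let $S:L^2(X)\to\ker\overline\partial_b$ be the Szegő projection. On $D_1\times D_1$ its kernel is (Boutet de Monvel–Sjöstrand)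 an oscillatory integral $S(x,y)=\int_0^\infty e^{i\Psi(x,y)t}b(x,y,t)\,dt$, $x=(z,x_{2n-1})$, $y=(w,y_{2n-1})$, with $\Psi(x,y)=x_{2n-1}-y_{2n-1}+\Phi(z,w)$, $\Phi$ smooth, $\Phi(z,w)=-\overline{\Phi}(w,z)$, ${\rm Im}\,\Phi\ge c|z-w|^2$ for some $c>0$, $\Phi(z,w)=0\Leftrightarrow z=w$, $$\Phi(z,w)=i(\varphi(z)+\varphi(w))-2i\sum_{|\alpha|+|\beta|\le N}\frac{\partial^{|\alpha|+|\beta|}\varphi}{\partial z^\alpha\partial\overline z^\beta}(0)\frac{z^\alpha}{\alpha!}\frac{\overline w^\beta}{\beta!}+O(|(z,w)|^{N+1})\quad\forall N\in\mathbb N_0,$$ and $b\sim\sum_{k\ge0}b_k(x,y)t^{n-1-k}$ in $S^{n-1}_{\rm loc}(1;D_1\times D_1)$, $b_k\in C^\infty(D_1\times D_1)$, $b_0(x,x)=\frac12\pi^{-n}|\det\mathcal L_x|$. The symbol $\hat b$. Put $\tilde D=\{|z|<\varepsilon\}$, $\tilde D_1=\{|z|<\varepsilon_1\}$. Let $\chi_0\in C_0^\infty(-\delta,\delta)$, $\int\chi_0=1$; $\eta\in C_0^\infty(-\delta_1,\delta_1)$, $\int\eta=1$; $\tilde\chi_1\in C_0^\infty(\tilde D_1)$, $\tilde\chi_1=1$ near $\overline{\tilde D}$. Then $\hat b(z,w,m)$ is the symbol for which, on $D\times D$, $S_m(x,y)\equiv\frac1{2\pi}\int_{-\pi}^\pi\hat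 S_m(x,e^{i\theta}\circ y)e^{im\theta}d\theta\mod O(m^{-\infty})$ with $\hat S_m(x,y)=e^{im(x_{2n-1}-y_{2n-1}+\Phi(z,w))}\hat b(z,w,m)\tilde\chi_1(w)\eta(y_{2n-1})$ (extended by $0$ in $y$ outside $D_1$), $\hat b\sim\sum_jm^{n-1-j}\hat b_j(z,w)$ in $S^{n-1}_{\rm loc}(1;\tilde D\times\tilde D)$, $\hat b_j\in C^\infty(\tilde D\times\tilde D)$, $\hat b_0(z,w)=2\pi\int_{-\delta}^\delta\tilde b_0(z,x_{2n-1},w,x_{2n-1}+\Phi(z,w))\chi_0(x_{2n-1})dx_{2n-1}$ ($\tilde b_0$ an almost analytic extension of $b_0$), and $\hat b_0(z,z)=\pi^{-(n-1)}|\det\mathcal L_x|$, $x=(z,0)$, $z\in\tilde D$. Asymptotic notation. $\mathbb N_0=\mathbb N\cup\{0\}$. $a(\cdot,m)\in S^{p}_{\rm loc}(1;W)$ means that for every compact $K\subset W$ and multi-index $\alpha$, $\sup_K|\partial^\alpha a(\cdot,m)|\le C_{K,\alpha}m^{p}$ uniformly in $m$. $a\sim\sum_ja_jm^{p-j}$ in $S^p_{\rm loc}$ means $a-\sum_{j\le N}a_jm^{p-j}\in S^{p-N-1}_{\rm loc}$ for all $N$. $A_m\equiv B_m\mod O(m^{-\infty})$ means that all derivatives of $A_m-B_m$ are $O(m^{-N})$ for every $N$, locally uniformly on compact sets.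
   Formalization: The symbol b̂ is assumed to lie in S^{n-1}_loc on D̃×D̃₁ (where the formula for Ŝ_m evaluates it), not only on D̃×D̃; otherwise its values at returns of the orbit of x₀ to D₁∖D are unconstrained and the claim can fail. *)

theory Defs
  imports "HOL-Analysis.Analysis" "HOL-Library.Landau_Symbols"
begin

section \<open>Smooth maps between Euclidean spaces\<close>

text \<open>Iterated directional derivatives. Smoothness on an open set means that all iterated partial
  derivatives exist and are again (totally) differentiable.\<close>

primrec iter_deriv ::
  "'e::real_normed_vector list \<Rightarrow> ('e \<Rightarrow> 'b::real_normed_vector) \<Rightarrow> 'e \<Rightarrow> 'b" where
  "iter_deriv [] f = f"
| "iter_deriv (v # vs) f = (\<lambda>p. frechet_derivative (iter_deriv vs f) (at p) v)"

definition smooth_on :: "'e::euclidean_space set \<Rightarrow> ('e \<Rightarrow> 'b::real_normed_vector) \<Rightarrow> bool" where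
  "smooth_on W f \<longleftrightarrow> (\<forall>vs. set vs \<subseteq> Basis \<longrightarrow> iter_deriv vs f differentiable_on W)"

definition test_function :: "'e::euclidean_space set \<Rightarrow> ('e \<Rightarrow> complex) \<Rightarrow> bool" where
  "test_function W f \<longleftrightarrow>
     smooth_on UNIV f \<and> (\<exists>K. compact K \<and> K \<subseteq> W \<and> (\<forall>p. p \<notin> K \<longrightarrow> f p = 0))"

text \<open>Determinant of a matrix whose rows and columns are indexed by the standard basis.\<close>

definition basis_det :: "('e::euclidean_space \<Rightarrow> 'e \<Rightarrow> real) \<Rightarrow> real" where
  "basis_det G = (\<Sum>\<pi> | \<pi> permutes (Basis :: 'e set). of_int (sign \<pi>) * (\<Prod>b\<in>Basis. G b (\<pi> b)))"


section \<open>Asymptotic notation\<close>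

text \<open>The large parameter is \<open>\<mu> i\<close> for \<open>i \<in> I\<close>; it is used with \<open>\<mu> = real\<close> on
  \<open>{1..} :: nat set\<close> and with the identity on \<open>{1..} :: real set\<close>.\<close>

definition symbol_class ::
  "'i set \<Rightarrow> ('i \<Rightarrow> real) \<Rightarrow> int \<Rightarrow> 'e::euclidean_space set \<Rightarrow> ('i \<Rightarrow> 'e \<Rightarrow> complex) \<Rightarrow> bool" where
  "symbol_class I \<mu> p W a \<longleftrightarrow>
     (\<forall>i\<in>I. smooth_on W (a i)) \<and>
     (\<forall>K vs. compact K \<and> K \<subseteq> W \<and> set vs \<subseteq> Basis \<longrightarrow>
        (\<exists>C. \<forall>i\<in>I. \<forall>w\<in>K. norm (iter_deriv vs (a i) w) \<le> C * \<mu> i powi p))"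

definition symbol_expansion ::
  "'i set \<Rightarrow> ('i \<Rightarrow> real) \<Rightarrow> int \<Rightarrow> 'e::euclidean_space set \<Rightarrow> ('i \<Rightarrow> 'e \<Rightarrow> complex)
     \<Rightarrow> (nat \<Rightarrow> 'e \<Rightarrow> complex) \<Rightarrow> bool" where
  "symbol_expansion I \<mu> p W a as \<longleftrightarrow>
     symbol_class I \<mu> p W a \<and> (\<forall>j. smooth_on W (as j)) \<and>
     (\<forall>N. symbol_class I \<mu> (p - int N - 1) W
        (\<lambda>i w. a i w - (\<Sum>j\<le>N. as j w * of_real (\<mu> i powi (p - int j)))))"

text \<open>\<open>A m \<equiv> B m\<close> modulo \<open>O(m^(-\<infinity>))\<close> on \<open>W\<close>, where \<open>m\<close> ranges over \<open>I\<close>.\<close>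

definition equiv_mod_Oinf ::
  "nat set \<Rightarrow> 'e::euclidean_space set \<Rightarrow> (nat \<Rightarrow> 'e \<Rightarrow> complex) \<Rightarrow> (nat \<Rightarrow> 'e \<Rightarrow> complex) \<Rightarrow> bool" where
  "equiv_mod_Oinf I W A B \<longleftrightarrow>
     (\<forall>m\<in>I. smooth_on W (\<lambda>p. A m p - B m p)) \<and>
     (\<forall>K vs N. compact K \<and> K \<subseteq> W \<and> set vs \<subseteq> Basis \<longrightarrow>
        (\<exists>C. \<forall>m\<in>I. \<forall>p\<in>K.
           norm (iter_deriv vs (\<lambda>p. A m p - B m p) p) \<le> C * real m powi (- int N)))"


section \<open>Smooth manifolds\<close>

text \<open>A chart is a domain together with a coordinate map; the inverse coordinate map is
  \<^term>\<open>inv_into U \<kappa>\<close>.\<close>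

type_synonym ('x, 'e) chart = "'x set \<times> ('x \<Rightarrow> 'e)"

definition is_chart :: "('x::topological_space, 'e::euclidean_space) chart \<Rightarrow> bool" where
  "is_chart c \<longleftrightarrow> (case c of (U, \<kappa>) \<Rightarrow>
     open U \<and> open (\<kappa> ` U) \<and> homeomorphism U (\<kappa> ` U) \<kappa> (inv_into U \<kappa>))"

definition compatible ::
  "('x::topological_space, 'e::euclidean_space) chart \<Rightarrow> ('x, 'e) chart \<Rightarrow> bool" where
  "compatible c d \<longleftrightarrow> (case c of (U, \<kappa>) \<Rightarrow> case d of (V, \<mu>) \<Rightarrow>
     smooth_on (\<kappa> ` (U \<inter> V)) (\<lambda>p. \<mu> (inv_into U \<kappa> p)) \<and>
     smooth_on (\<mu> ` (U \<inter> V)) (\<lambda>p. \<kappa> (inv_into V \<mu> p)))"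

definition smooth_atlas :: "('x::topological_space, 'e::euclidean_space) chart set \<Rightarrow> bool" where
  "smooth_atlas A \<longleftrightarrow>
     (\<forall>c\<in>A. is_chart c) \<and> (\<Union>(U, \<kappa>)\<in>A. U) = UNIV \<and> (\<forall>c\<in>A. \<forall>d\<in>A. compatible c d)"

definition orientable :: "('x::topological_space, 'e::euclidean_space) chart set \<Rightarrow> bool" where
  "orientable A \<longleftrightarrow>
     (\<exists>A'. smooth_atlas A' \<and> (\<forall>c\<in>A'. \<forall>d\<in>A. compatible c d) \<and>
        (\<forall>(U, \<kappa>)\<in>A'. \<forall>(V, \<mu>)\<in>A'. \<forall>x\<in>U \<inter> V.
           0 < basis_det (\<lambda>a b. frechet_derivative (\<lambda>p. \<mu> (inv_into U \<kappa> p)) (at (\<kappa> x)) a \<bullet> b)))"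

definition smooth_fun_on ::
  "('x::topological_space, 'e::euclidean_space) chart set \<Rightarrow> 'x set \<Rightarrow> ('x \<Rightarrow> complex) \<Rightarrow> bool" where
  "smooth_fun_on A W f \<longleftrightarrow>
     (\<forall>(U, \<kappa>)\<in>A. smooth_on (\<kappa> ` (U \<inter> W)) (\<lambda>p. f (inv_into U \<kappa> p)))"

abbreviation smooth_fun ::
  "('x::topological_space, 'e::euclidean_space) chart set \<Rightarrow> ('x \<Rightarrow> complex) \<Rightarrow> bool" where
  "smooth_fun A f \<equiv> smooth_fun_on A UNIV f"


section \<open>Complexified tangent vectors\<close>

text \<open>Elements of \<open>\<complex>T\<^sub>xX\<close> are the complex derivations at \<open>x\<close> of the algebra of smooth complex
  functions, extended by \<open>0\<close> to all other functions so that equality of derivations is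
  equality of HOL functions. Vector fields assign a vector to every point.\<close>

type_synonym 'x cvec = "('x \<Rightarrow> complex) \<Rightarrow> complex"

definition ctangent ::
  "('x::topological_space, 'e::euclidean_space) chart set \<Rightarrow> 'x \<Rightarrow> 'x cvec set" where
  "ctangent A x = {V.
     (\<forall>f. \<not> smooth_fun A f \<longrightarrow> V f = 0) \<and>
     (\<forall>f g. smooth_fun A f \<and> smooth_fun A g \<longrightarrow> V (\<lambda>y. f y + g y) = V f + V g) \<and>
     (\<forall>c f. smooth_fun A f \<longrightarrow> V (\<lambda>y. c * f y) = c * V f) \<and>
     (\<forall>f g. smooth_fun A f \<and> smooth_fun A g \<longrightarrow> V (\<lambda>y. f y * g y) = V f * g x + f x * V g)}"

definition vconj :: "'x cvec \<Rightarrow> 'x cvec" where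
  "vconj V = (\<lambda>f. cnj (V (\<lambda>y. cnj (f y))))"

definition is_basis :: "('n::finite \<Rightarrow> 'x cvec) \<Rightarrow> 'x cvec set \<Rightarrow> bool" where
  "is_basis e S \<longleftrightarrow>
     S = range (\<lambda>c f. \<Sum>j\<in>UNIV. c j * e j f) \<and>
     (\<forall>c. (\<lambda>f. \<Sum>j\<in>UNIV. c j * e j f) = (\<lambda>f. 0) \<longrightarrow> c = (\<lambda>j. 0))"

text \<open>\<open>C\<^sup>\<infinity>(X, S)\<close> for a family \<open>S\<close> of subspaces of the complexified tangent spaces.\<close>

definition smooth_sections ::
  "('x::topological_space, 'e::euclidean_space) chart set \<Rightarrow> ('x \<Rightarrow> 'x cvec set)
     \<Rightarrow> ('x \<Rightarrow> 'x cvec) set" where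
  "smooth_sections A S = {V. (\<forall>x. V x \<in> ctangent A x \<and> V x \<in> S x) \<and>
     (\<forall>f. smooth_fun A f \<longrightarrow> smooth_fun A (\<lambda>x. V x f))}"

definition bracket ::
  "('x::topological_space, 'e::euclidean_space) chart set \<Rightarrow> ('x \<Rightarrow> 'x cvec) \<Rightarrow> ('x \<Rightarrow> 'x cvec)
     \<Rightarrow> 'x \<Rightarrow> 'x cvec" where
  "bracket A V W x =
     (\<lambda>f. if smooth_fun A f then V x (\<lambda>y. W y f) - W x (\<lambda>y. V y f) else 0)"

definition coord_vec ::
  "('x::topological_space, 'e::euclidean_space) chart set \<Rightarrow> ('x, 'e) chart \<Rightarrow> 'e \<Rightarrow> 'x \<Rightarrow> 'x cvec" where
  "coord_vec A c b x = (case c of (U, \<kappa>) \<Rightarrow>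
     (\<lambda>f. if smooth_fun A f
          then frechet_derivative (\<lambda>p. f (inv_into U \<kappa> p)) (at (\<kappa> x)) b else 0))"


section \<open>CR manifolds with circle action\<close>

text \<open>The model space of a CR manifold of dimension \<open>2n - 1\<close> is \<open>\<complex>^(n-1) \<times> \<real>\<close>, so
  the index type \<open>'n\<close> has \<open>n - 1\<close> elements.\<close>

type_synonym 'n model = "(complex ^ 'n) \<times> real"

definition cr_structure ::
  "('x::topological_space, 'n::finite model) chart set \<Rightarrow> ('x \<Rightarrow> 'x cvec set) \<Rightarrow> bool" where
  "cr_structure A T10 \<longleftrightarrow>
     (\<forall>x. T10 x \<subseteq> ctangent A x) \<and>
     (\<forall>x. \<exists>W. open W \<and> x \<in> W \<and> (\<exists>Z :: 'n \<Rightarrow> 'x \<Rightarrow> 'x cvec.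
        (\<forall>j f. smooth_fun A f \<longrightarrow> smooth_fun_on A W (\<lambda>y. Z j y f)) \<and>
        (\<forall>y\<in>W. is_basis (\<lambda>j. Z j y) (T10 y)))) \<and>
     (\<forall>x. T10 x \<inter> vconj ` T10 x = {\<lambda>f. 0}) \<and>
     (\<forall>V\<in>smooth_sections A T10. \<forall>W\<in>smooth_sections A T10. bracket A V W \<in> smooth_sections A T10)"

definition cr_function ::
  "('x::topological_space, 'e::euclidean_space) chart set \<Rightarrow> ('x \<Rightarrow> 'x cvec set)
     \<Rightarrow> ('x \<Rightarrow> complex) \<Rightarrow> bool" where
  "cr_function A T10 u \<longleftrightarrow> (\<forall>Z\<in>smooth_sections A T10. \<forall>x. vconj (Z x) u = 0)"

text \<open>A smooth action \<open>act\<close> of the unit circle; only \<open>act z\<close> with \<open>|z| = 1\<close> matters.\<close>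

definition circle_action ::
  "('x::topological_space, 'e::euclidean_space) chart set \<Rightarrow> (complex \<Rightarrow> 'x \<Rightarrow> 'x) \<Rightarrow> bool" where
  "circle_action A act \<longleftrightarrow>
     (\<forall>x. act 1 x = x) \<and>
     (\<forall>a b x. norm a = 1 \<and> norm b = 1 \<longrightarrow> act (a * b) x = act a (act b x)) \<and>
     continuous_on (sphere 0 1 \<times> UNIV) (\<lambda>(a, x). act a x) \<and>
     (\<forall>(U, \<kappa>)\<in>A. \<forall>(V, \<mu>)\<in>A.
        smooth_on {(t::real, p). p \<in> \<kappa> ` U \<and> act (cis t) (inv_into U \<kappa> p) \<in> V}
          (\<lambda>(t, p). \<mu> (act (cis t) (inv_into U \<kappa> p))))"

definition locally_free :: "(complex \<Rightarrow> 'x \<Rightarrow> 'x) \<Rightarrow> bool" where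
  "locally_free act \<longleftrightarrow> (\<forall>x. \<exists>r>0. \<forall>\<theta>::real. 0 < \<bar>\<theta>\<bar> \<and> \<bar>\<theta>\<bar> < r \<longrightarrow> act (cis \<theta>) x \<noteq> x)"

definition stratum :: "(complex \<Rightarrow> 'x \<Rightarrow> 'x) \<Rightarrow> nat \<Rightarrow> 'x set" where
  "stratum act k = {x. (\<forall>\<theta>::real. 0 < \<theta> \<and> \<theta> < 2 * pi / real k \<longrightarrow> act (cis \<theta>) x \<noteq> x) \<and>
     act (cis (2 * pi / real k)) x = x}"

definition T_field ::
  "('x::topological_space, 'e::euclidean_space) chart set \<Rightarrow> (complex \<Rightarrow> 'x \<Rightarrow> 'x) \<Rightarrow> 'x \<Rightarrow> 'x cvec" where
  "T_field A act x =
     (\<lambda>u. if smooth_fun A u then vector_derivative (\<lambda>\<theta>. u (act (cis \<theta>) x)) (at 0) else 0)"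

definition cr_action ::
  "('x::topological_space, 'e::euclidean_space) chart set \<Rightarrow> (complex \<Rightarrow> 'x \<Rightarrow> 'x)
     \<Rightarrow> ('x \<Rightarrow> 'x cvec set) \<Rightarrow> bool" where
  "cr_action A act T10 \<longleftrightarrow>
     (\<forall>V\<in>smooth_sections A T10. bracket A (T_field A act) V \<in> smooth_sections A T10)"

definition transversal ::
  "('x::topological_space, 'e::euclidean_space) chart set \<Rightarrow> (complex \<Rightarrow> 'x \<Rightarrow> 'x)
     \<Rightarrow> ('x \<Rightarrow> 'x cvec set) \<Rightarrow> bool" where
  "transversal A act T10 \<longleftrightarrow>
     (\<forall>x. T_field A act x \<noteq> (\<lambda>f. 0) \<and>
        (\<forall>V\<in>ctangent A x. \<exists>!(c, U, W). U \<in> T10 x \<and> W \<in> vconj ` T10 x \<and>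
           V = (\<lambda>f. c * T_field A act x f + U f + W f)))"

text \<open>The real one-form \<open>\<omega>\<^sub>0\<close>, as a complex linear form on each complexified tangent space.\<close>

definition characteristic_form ::
  "('x::topological_space, 'e::euclidean_space) chart set \<Rightarrow> (complex \<Rightarrow> 'x \<Rightarrow> 'x)
     \<Rightarrow> ('x \<Rightarrow> 'x cvec set) \<Rightarrow> ('x \<Rightarrow> 'x cvec \<Rightarrow> complex) \<Rightarrow> bool" where
  "characteristic_form A act T10 \<omega>\<^sub>0 \<longleftrightarrow>
     (\<forall>x. \<forall>V\<in>ctangent A x. \<forall>W\<in>ctangent A x. \<forall>c.
        \<omega>\<^sub>0 x (\<lambda>f. c * V f + W f) = c * \<omega>\<^sub>0 x V + \<omega>\<^sub>0 x W) \<and>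
     (\<forall>x. \<forall>V\<in>ctangent A x. vconj V = V \<longrightarrow> \<omega>\<^sub>0 x V \<in> \<real>) \<and>
     (\<forall>V\<in>smooth_sections A (ctangent A). smooth_fun A (\<lambda>x. \<omega>\<^sub>0 x (V x))) \<and>
     (\<forall>x. \<forall>V\<in>T10 x. \<omega>\<^sub>0 x V = 0 \<and> \<omega>\<^sub>0 x (vconj V) = 0) \<and>
     (\<forall>x. \<omega>\<^sub>0 x (T_field A act x) = -1)"

text \<open>\<open>levi A T10 \<omega>\<^sub>0 x U V\<close> is \<open>\<L>\<^sub>x(U, V\<^sup>*)\<close> with \<open>V\<^sup>*\<close> the conjugate of \<open>V\<close>. The value does not
  depend on the extensions of \<open>U\<close> and \<open>V\<close> to global sections, so some extensions are chosen.\<close>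

definition section_through ::
  "('x::topological_space, 'e::euclidean_space) chart set \<Rightarrow> ('x \<Rightarrow> 'x cvec set) \<Rightarrow> 'x \<Rightarrow> 'x cvec
     \<Rightarrow> 'x \<Rightarrow> 'x cvec" where
  "section_through A T10 x U = (SOME V. V \<in> smooth_sections A T10 \<and> V x = U)"

definition levi ::
  "('x::topological_space, 'e::euclidean_space) chart set \<Rightarrow> ('x \<Rightarrow> 'x cvec set)
     \<Rightarrow> ('x \<Rightarrow> 'x cvec \<Rightarrow> complex) \<Rightarrow> 'x \<Rightarrow> 'x cvec \<Rightarrow> 'x cvec \<Rightarrow> complex" where
  "levi A T10 \<omega>\<^sub>0 x U V =
     1 / (2 * \<i>) * \<omega>\<^sub>0 x (bracket A (section_through A T10 x U)
                               (\<lambda>y. vconj (section_through A T10 x V y)) x)"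

definition strongly_pseudoconvex ::
  "('x::topological_space, 'e::euclidean_space) chart set \<Rightarrow> ('x \<Rightarrow> 'x cvec set)
     \<Rightarrow> ('x \<Rightarrow> 'x cvec \<Rightarrow> complex) \<Rightarrow> bool" where
  "strongly_pseudoconvex A T10 \<omega>\<^sub>0 \<longleftrightarrow>
     (\<forall>x. \<forall>U\<in>T10 x. U \<noteq> (\<lambda>f. 0) \<longrightarrow>
        levi A T10 \<omega>\<^sub>0 x U U \<in> \<real> \<and> 0 < Re (levi A T10 \<omega>\<^sub>0 x U U))"


section \<open>Rigid metric, volume and kernels\<close>

definition rigid_metric ::
  "('x::topological_space, 'e::euclidean_space) chart set \<Rightarrow> (complex \<Rightarrow> 'x \<Rightarrow> 'x)
     \<Rightarrow> ('x \<Rightarrow> 'x cvec set) \<Rightarrow> ('x \<Rightarrow> 'x cvec \<Rightarrow> 'x cvec \<Rightarrow> complex) \<Rightarrow> bool" where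
  "rigid_metric A act T10 g \<longleftrightarrow>
     (\<forall>x. \<forall>U\<in>ctangent A x. \<forall>V\<in>ctangent A x. \<forall>W\<in>ctangent A x. \<forall>c.
        g x (\<lambda>f. c * U f + V f) W = c * g x U W + g x V W) \<and>
     (\<forall>x. \<forall>U\<in>ctangent A x. \<forall>V\<in>ctangent A x. g x V U = cnj (g x U V)) \<and>
     (\<forall>x. \<forall>V\<in>ctangent A x. V \<noteq> (\<lambda>f. 0) \<longrightarrow> 0 < Re (g x V V)) \<and>
     (\<forall>V\<in>smooth_sections A (ctangent A). \<forall>W\<in>smooth_sections A (ctangent A).
        smooth_fun A (\<lambda>x. g x (V x) (W x))) \<and>
     (\<forall>(\<theta>::real) x. \<forall>U\<in>ctangent A x. \<forall>V\<in>ctangent A x.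
        g (act (cis \<theta>) x) (\<lambda>f. U (\<lambda>y. f (act (cis \<theta>) y))) (\<lambda>f. V (\<lambda>y. f (act (cis \<theta>) y)))
          = g x U V) \<and>
     (\<forall>x. \<forall>U\<in>T10 x. \<forall>V\<in>T10 x. g x U (vconj V) = 0) \<and>
     (\<forall>x. \<forall>U\<in>T10 x. g x (T_field A act x) U = 0 \<and> g x (T_field A act x) (vconj U) = 0) \<and>
     (\<forall>x. g x (T_field A act x) (T_field A act x) = 1) \<and>
     (\<forall>x. \<forall>U\<in>ctangent A x. \<forall>V\<in>ctangent A x. vconj U = U \<and> vconj V = V \<longrightarrow> g x U V \<in> \<real>)"

text \<open>The eigenvalues of the Levi form with respect to the metric, with multiplicities.\<close>

definition levi_eigenvalues ::
  "('x::topological_space, 'n::finite model) chart set \<Rightarrow> ('x \<Rightarrow> 'x cvec set)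
     \<Rightarrow> ('x \<Rightarrow> 'x cvec \<Rightarrow> complex) \<Rightarrow> ('x \<Rightarrow> 'x cvec \<Rightarrow> 'x cvec \<Rightarrow> complex)
     \<Rightarrow> 'x \<Rightarrow> ('n \<Rightarrow> real) \<Rightarrow> bool" where
  "levi_eigenvalues A T10 \<omega>\<^sub>0 g x ev \<longleftrightarrow>
     (\<exists>e :: 'n \<Rightarrow> 'x cvec. is_basis e (T10 x) \<and>
        (\<forall>i j. g x (e i) (e j) = (if i = j then 1 else 0)) \<and>
        (\<forall>i. \<forall>V\<in>T10 x. levi A T10 \<omega>\<^sub>0 x (e i) V = of_real (ev i) * g x (e i) V))"

definition levi_det ::
  "('x::topological_space, 'n::finite model) chart set \<Rightarrow> ('x \<Rightarrow> 'x cvec set)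
     \<Rightarrow> ('x \<Rightarrow> 'x cvec \<Rightarrow> complex) \<Rightarrow> ('x \<Rightarrow> 'x cvec \<Rightarrow> 'x cvec \<Rightarrow> complex) \<Rightarrow> 'x \<Rightarrow> real" where
  "levi_det A T10 \<omega>\<^sub>0 g x = (\<Prod>j\<in>UNIV. (SOME ev. levi_eigenvalues A T10 \<omega>\<^sub>0 g x ev) j)"

text \<open>The measure of \<open>dv\<^sub>X\<close>: in each chart its density is the square root of the Gram determinant of
  the coordinate vector fields.\<close>

definition volume_measure ::
  "('x::topological_space, 'e::euclidean_space) chart set
     \<Rightarrow> ('x \<Rightarrow> 'x cvec \<Rightarrow> 'x cvec \<Rightarrow> complex) \<Rightarrow> 'x measure \<Rightarrow> bool" where
  "volume_measure A g M \<longleftrightarrow>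
     sets M = sets borel \<and>
     (\<forall>(U, \<kappa>)\<in>A. \<forall>E\<in>sets borel. E \<subseteq> U \<longrightarrow>
        emeasure M E = (\<integral>\<^sup>+ p. indicator (\<kappa> ` E) p *
          ennreal (sqrt (basis_det (\<lambda>a b.
            Re (g (inv_into U \<kappa> p) (coord_vec A (U, \<kappa>) a (inv_into U \<kappa> p))
                                     (coord_vec A (U, \<kappa>) b (inv_into U \<kappa> p)))))) \<partial>lborel))"

definition L2_fun :: "'x measure \<Rightarrow> ('x \<Rightarrow> complex) set" where
  "L2_fun M = {u \<in> borel_measurable M. integrable M (\<lambda>x. (norm (u x))\<^sup>2)}"

definition L2_inner :: "'x measure \<Rightarrow> ('x \<Rightarrow> complex) \<Rightarrow> ('x \<Rightarrow> complex) \<Rightarrow> complex" where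
  "L2_inner M u v = (\<integral>x. u x * cnj (v x) \<partial>M)"

definition H0b ::
  "('x::topological_space, 'e::euclidean_space) chart set \<Rightarrow> (complex \<Rightarrow> 'x \<Rightarrow> 'x)
     \<Rightarrow> ('x \<Rightarrow> 'x cvec set) \<Rightarrow> nat \<Rightarrow> ('x \<Rightarrow> complex) set" where
  "H0b A act T10 m = {u. smooth_fun A u \<and> cr_function A T10 u \<and>
     (\<forall>x. T_field A act x u = \<i> * of_nat m * u x)}"

definition orthonormal_basis :: "'x measure \<Rightarrow> ('x \<Rightarrow> complex) set \<Rightarrow> ('x \<Rightarrow> complex) set \<Rightarrow> bool" where
  "orthonormal_basis M B H \<longleftrightarrow>
     finite B \<and> B \<subseteq> H \<and>
     (\<forall>f\<in>B. \<forall>h\<in>B. L2_inner M f h = (if f = h then 1 else 0)) \<and>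
     (\<forall>u\<in>H. \<exists>c. u = (\<lambda>x. \<Sum>f\<in>B. c f * f x))"

text \<open>The kernel of the orthogonal projection onto the span of a finite orthonormal set \<open>B\<close>.\<close>

definition projection_kernel :: "('x \<Rightarrow> complex) set \<Rightarrow> 'x \<Rightarrow> 'x \<Rightarrow> complex" where
  "projection_kernel B x y = (\<Sum>f\<in>B. f x * cnj (f y))"

text \<open>The \<open>L\<^sup>2\<close> kernel of \<open>\<partial>\<^sub>b\<close>-bar in the sense of distributions. The function \<open>h\<close> is
  \<open>Z\<^sup>* g\<close>, where \<open>Z\<^sup>*\<close> is the formal adjoint of the conjugate of \<open>Z\<close>.\<close>

definition ker_dbar_b ::
  "('x::topological_space, 'e::euclidean_space) chart set \<Rightarrow> ('x \<Rightarrow> 'x cvec set) \<Rightarrow> 'x measure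
     \<Rightarrow> ('x \<Rightarrow> complex) set" where
  "ker_dbar_b A T10 M = {u \<in> L2_fun M.
     \<forall>Z\<in>smooth_sections A T10. \<forall>g h. smooth_fun A g \<and> smooth_fun A h \<and>
       (\<forall>f. smooth_fun A f \<longrightarrow> L2_inner M (\<lambda>x. vconj (Z x) f) g = L2_inner M f h) \<longrightarrow>
       L2_inner M u h = 0}"

definition szego_projection ::
  "('x::topological_space, 'e::euclidean_space) chart set \<Rightarrow> ('x \<Rightarrow> 'x cvec set) \<Rightarrow> 'x measure
     \<Rightarrow> (('x \<Rightarrow> complex) \<Rightarrow> ('x \<Rightarrow> complex)) \<Rightarrow> bool" where
  "szego_projection A T10 M S \<longleftrightarrow>
     (\<forall>u\<in>L2_fun M. S u \<in> ker_dbar_b A T10 M \<and>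
        (\<forall>v\<in>ker_dbar_b A T10 M. L2_inner M (\<lambda>x. u x - S u x) v = 0))"


section \<open>Canonical coordinates\<close>

definition patch :: "real \<Rightarrow> real \<Rightarrow> 'n::finite model set" where
  "patch \<epsilon> \<delta> = {(z, \<theta>). norm z < \<epsilon> \<and> \<bar>\<theta>\<bar> < \<delta>}"

definition d_z :: "'n::finite \<Rightarrow> (complex ^ 'n \<Rightarrow> complex) \<Rightarrow> complex ^ 'n \<Rightarrow> complex" where
  "d_z j F z = (frechet_derivative F (at z) (axis j 1) - \<i> * frechet_derivative F (at z) (axis j \<i>)) / 2"

definition d_zbar :: "'n::finite \<Rightarrow> (complex ^ 'n \<Rightarrow> complex) \<Rightarrow> complex ^ 'n \<Rightarrow> complex" where
  "d_zbar j F z = (frechet_derivative F (at z) (axis j 1) + \<i> * frechet_derivative F (at z) (axis j \<i>)) / 2"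

text \<open>\<open>\<partial>^(|\<alpha>|+|\<beta>|) F / \<partial>z^\<alpha> \<partial>z\<^sup>*^\<beta>\<close>; the order in which the coordinates are
  processed is irrelevant for smooth \<open>F\<close>.\<close>

definition index_list :: "'n::finite list" where
  "index_list = (SOME xs. distinct xs \<and> set xs = UNIV)"

definition mixed_deriv ::
  "('n::finite \<Rightarrow> nat) \<Rightarrow> ('n \<Rightarrow> nat) \<Rightarrow> (complex ^ 'n \<Rightarrow> complex) \<Rightarrow> complex ^ 'n \<Rightarrow> complex" where
  "mixed_deriv \<alpha> \<beta> F = foldr (\<lambda>j G. (d_z j ^^ \<alpha> j) ((d_zbar j ^^ \<beta> j) G)) index_list F"

text \<open>The vector field \<open>Z\<^sub>j = \<partial>/\<partial>z\<^sub>j + \<i> (\<partial>\<phi>/\<partial>z\<^sub>j) \<partial>/\<partial>\<theta>\<close>.\<close>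

definition Z_field ::
  "('x::topological_space, 'n::finite model) chart set \<Rightarrow> ('x, 'n model) chart
     \<Rightarrow> (complex ^ 'n \<Rightarrow> real) \<Rightarrow> 'n \<Rightarrow> 'x \<Rightarrow> 'x cvec" where
  "Z_field A c \<phi> j x =
     (\<lambda>f. (coord_vec A c (axis j 1, 0) x f - \<i> * coord_vec A c (axis j \<i>, 0) x f) / 2 +
          \<i> * d_z j (\<lambda>z. of_real (\<phi> z)) (fst (snd c x)) * coord_vec A c (0, 1) x f)"

definition canonical_coordinates ::
  "('x::topological_space, 'n::finite model) chart set \<Rightarrow> (complex \<Rightarrow> 'x \<Rightarrow> 'x)
     \<Rightarrow> ('x \<Rightarrow> 'x cvec set) \<Rightarrow> ('x \<Rightarrow> 'x cvec \<Rightarrow> complex)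
     \<Rightarrow> ('x \<Rightarrow> 'x cvec \<Rightarrow> 'x cvec \<Rightarrow> complex)
     \<Rightarrow> 'x \<Rightarrow> 'x set \<Rightarrow> ('x \<Rightarrow> 'n model) \<Rightarrow> (complex ^ 'n \<Rightarrow> real) \<Rightarrow> real \<Rightarrow> real \<Rightarrow> bool" where
  "canonical_coordinates A act T10 \<omega>\<^sub>0 g x\<^sub>0 U \<kappa> \<phi> \<epsilon> \<delta> \<longleftrightarrow>
     0 < \<epsilon> \<and> 0 < \<delta> \<and>
     is_chart (U, \<kappa>) \<and> (\<forall>c\<in>A. compatible (U, \<kappa>) c) \<and>
     \<kappa> ` U = patch \<epsilon> \<delta> \<and> x\<^sub>0 \<in> U \<and> \<kappa> x\<^sub>0 = (0, 0) \<and>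
     (\<forall>x\<in>U. T_field A act x = coord_vec A (U, \<kappa>) (0, 1) x) \<and>
     (\<forall>x\<in>U. is_basis (\<lambda>j. Z_field A (U, \<kappa>) \<phi> j x) (T10 x)) \<and>
     smooth_on (ball 0 \<epsilon>) \<phi> \<and>
     (\<exists>ev. levi_eigenvalues A T10 \<omega>\<^sub>0 g x\<^sub>0 ev \<and>
        (\<lambda>z. \<phi> z - (\<Sum>j\<in>UNIV. ev j * (norm (z $ j))\<^sup>2)) \<in> O[nhds 0](\<lambda>z. norm z ^ 3))"


section \<open>Phase function and symbols\<close>

definition phase_function ::
  "(complex ^ 'n::finite \<Rightarrow> real) \<Rightarrow> real \<Rightarrow> (complex ^ 'n \<Rightarrow> complex ^ 'n \<Rightarrow> complex) \<Rightarrow> bool" where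
  "phase_function \<phi> \<epsilon> \<Phi> \<longleftrightarrow>
     smooth_on (ball 0 \<epsilon> \<times> ball 0 \<epsilon>) (\<lambda>(z, w). \<Phi> z w) \<and>
     (\<forall>z\<in>ball 0 \<epsilon>. \<forall>w\<in>ball 0 \<epsilon>. \<Phi> z w = - cnj (\<Phi> w z)) \<and>
     (\<exists>c>0. \<forall>z\<in>ball 0 \<epsilon>. \<forall>w\<in>ball 0 \<epsilon>. c * (norm (z - w))\<^sup>2 \<le> Im (\<Phi> z w)) \<and>
     (\<forall>z\<in>ball 0 \<epsilon>. \<forall>w\<in>ball 0 \<epsilon>. \<Phi> z w = 0 \<longleftrightarrow> z = w) \<and>
     (\<forall>N::nat.
        (\<lambda>(z, w). \<Phi> z w - (\<i> * of_real (\<phi> z + \<phi> w) -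
           2 * \<i> * (\<Sum>(\<alpha>, \<beta>) | sum \<alpha> UNIV + sum \<beta> UNIV \<le> N.
              mixed_deriv \<alpha> \<beta> (\<lambda>z. of_real (\<phi> z)) 0 *
              (\<Prod>j\<in>UNIV. (z $ j) ^ \<alpha> j / fact (\<alpha> j)) *
              (\<Prod>j\<in>UNIV. cnj (w $ j) ^ \<beta> j / fact (\<beta> j)))))
        \<in> O[nhds (0, 0)](\<lambda>p. of_real (norm p ^ (N + 1))))"

definition Psi :: "(complex ^ 'n::finite \<Rightarrow> complex ^ 'n \<Rightarrow> complex) \<Rightarrow> 'n model \<Rightarrow> 'n model \<Rightarrow> complex" where
  "Psi \<Phi> p q = of_real (snd p - snd q) + \<Phi> (fst p) (fst q)"

text \<open>The kernel, with respect to \<open>M\<close>, of \<open>S\<close> on \<open>U \<times> U\<close> is the oscillatory integral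
  \<open>\<integral>\<^sub>0\<^sup>\<infinity> e\<^sup>i\<^sup>\<Psi>\<^sup>t b(x,y,t) dt\<close>: paired with test functions in \<open>x\<close> and \<open>y\<close>, the amplitude is
  rapidly decreasing in \<open>t\<close>, so the \<open>t\<close>-integral taken last converges.\<close>

definition oscillatory_kernel ::
  "('x::topological_space, 'n::finite model) chart set \<Rightarrow> 'x measure
     \<Rightarrow> (('x \<Rightarrow> complex) \<Rightarrow> ('x \<Rightarrow> complex)) \<Rightarrow> 'x set \<Rightarrow> ('x \<Rightarrow> 'n model)
     \<Rightarrow> (complex ^ 'n \<Rightarrow> complex ^ 'n \<Rightarrow> complex)
     \<Rightarrow> (real \<Rightarrow> 'n model \<times> 'n model \<Rightarrow> complex) \<Rightarrow> bool" where
  "oscillatory_kernel A M S U \<kappa> \<Phi> b \<longleftrightarrow>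
     (\<forall>f h. smooth_fun A f \<and> smooth_fun A h \<and>
        (\<exists>K. compact K \<and> K \<subseteq> U \<and> (\<forall>x. x \<notin> K \<longrightarrow> f x = 0 \<and> h x = 0)) \<longrightarrow>
        has_bochner_integral lborel
          (\<lambda>t. indicator {0<..} t *\<^sub>R
             (\<integral>x. \<integral>y. exp (\<i> * Psi \<Phi> (\<kappa> x) (\<kappa> y) * of_real t) * b t (\<kappa> x, \<kappa> y) * f y * h x \<partial>M \<partial>M))
          (\<integral>x. S f x * h x \<partial>M))"

text \<open>Almost analytic extensions. A point \<open>p + \<i> q\<close> of the complexification of \<open>'e\<close> is represented
  by the pair \<open>(p, q)\<close>.\<close>

definition almost_analytic_extension ::
  "'e::euclidean_space set \<Rightarrow> ('e \<Rightarrow> complex) \<Rightarrow> ('e \<times> 'e) set \<Rightarrow> ('e \<times> 'e \<Rightarrow> complex) \<Rightarrow> bool" where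
  "almost_analytic_extension W f \<Omega> F \<longleftrightarrow>
     open \<Omega> \<and> smooth_on \<Omega> F \<and> (\<forall>p\<in>W. (p, 0) \<in> \<Omega> \<and> F (p, 0) = f p) \<and>
     (\<forall>K N. compact K \<and> K \<subseteq> \<Omega> \<longrightarrow>
        (\<forall>v\<in>Basis. \<exists>C. \<forall>(p, q)\<in>K.
           norm ((frechet_derivative F (at (p, q)) (v, 0) +
                  \<i> * frechet_derivative F (at (p, q)) (0, v)) / 2) \<le> C * norm q ^ N))"

text \<open>The point \<open>(z, s, w, s + \<Phi>(z, w))\<close> of the complexification.\<close>

definition phase_point ::
  "(complex ^ 'n::finite \<Rightarrow> complex ^ 'n \<Rightarrow> complex) \<Rightarrow> complex ^ 'n \<Rightarrow> complex ^ 'n \<Rightarrow> real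
     \<Rightarrow> ('n model \<times> 'n model) \<times> ('n model \<times> 'n model)" where
  "phase_point \<Phi> z w s =
     (((z, s), (w, s + Re (\<Phi> z w))), ((0, 0), (0, Im (\<Phi> z w))))"

text \<open>The function \<open>S\<^sub>m\<close>-hat \<open>(x, y)\<close>, with \<open>x\<close> given by its coordinates \<open>p\<close>, and \<open>y\<close> a point of
  the manifold.\<close>

definition S_hat ::
  "'x set \<Rightarrow> ('x \<Rightarrow> 'n::finite model) \<Rightarrow> (complex ^ 'n \<Rightarrow> complex ^ 'n \<Rightarrow> complex)
     \<Rightarrow> (nat \<Rightarrow> (complex ^ 'n) \<times> (complex ^ 'n) \<Rightarrow> complex)
     \<Rightarrow> (complex ^ 'n \<Rightarrow> complex) \<Rightarrow> (real \<Rightarrow> complex) \<Rightarrow> nat \<Rightarrow> 'n model \<Rightarrow> 'x \<Rightarrow> complex" where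
  "S_hat U \<kappa> \<Phi> bh \<chi>\<^sub>1 \<eta> m p y =
     (if y \<in> U
      then exp (\<i> * of_nat m * Psi \<Phi> p (\<kappa> y)) * bh m (fst p, fst (\<kappa> y)) *
           \<chi>\<^sub>1 (fst (\<kappa> y)) * \<eta> (snd (\<kappa> y))
      else 0)"

end

theory Submission
  imports Defs
begin

text \<open>The kernel relation on \<open>D \<times> D\<close> is restricted to \<open>y = x\<^sub>0\<close>, so that only values of the
  integrand along the orbit of \<open>x\<^sub>0\<close> matter. In canonical coordinates \<open>T = \<partial>/\<partial>\<theta>\<close>, hence
  the orbit meets the large patch in finitely many full vertical segments \<open>{w} \<times> (-\<delta>\<^sub>1, \<delta>\<^sub>1)\<close>, and
  since \<open>\<integral>\<eta> = 1\<close> each of them contributes exactly one term \<open>e\<^sup>i\<^sup>m\<^sup>\<tau> e\<^sup>i\<^sup>m\<^sup>\<Psi> b(z, w, m)\<close>, \<open>\<tau>\<close> being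
  the time at which the midpoint is reached. The segments with \<open>w = 0\<close> correspond to the \<open>k\<close> elements of
  the stabilizer, and their characters add up to \<open>k\<close> if \<open>k\<close> divides \<open>m\<close>. All other segments satisfy
  \<open>|w| \<ge> \<epsilon>\<close> by the choice of \<open>D\<close>, so that \<open>Im \<Phi>(z, w) \<ge> c|z - w|\<^sup>2\<close> makes their terms exponentially
  small together with all derivatives. If \<open>k\<close> does not divide \<open>m\<close>, equivariance under the stabilizer
  forces every element of \<open>H\<^sup>0\<^sub>b\<^sub>,\<^sub>m\<close> to vanish at \<open>x\<^sub>0\<close>.\<close>

section \<open>Calculus of smooth maps\<close>

text \<open>The identity T = \<partial>/\<partial>\<theta> in a chart is an equality of derivations
  on globally smooth functions, and coordinate functions are not among these. So the velocity of an
  orbit in coordinates is read off by testing with compactly supported functions, obtained by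
  rescaling the cutoffs \<open>\<chi>\<^sub>1\<close> and \<open>\<eta>\<close> that come with the
  symbol. Velocity alone does not keep an orbit from leaving the patch below its top; a
  connectedness argument in a Hausdorff space does. Distinct midpoint times are at least
  \<open>2 * \<delta>\<^sub>1\<close> apart and 0 and 2\<pi> are both midpoint times, so the period
  from \<open>-\<delta>\<^sub>1\<close> to \<open>2 * pi - \<delta>\<^sub>1\<close> cuts no segment,
  while [-\<pi>, \<pi>] may cut one. On the analytic side the amplitudes are only tracked up to
  polynomial growth in m, a property stable under products and derivatives that exponential decay
  turns into O(m^-\<infinity>). Midpoints with |w| = \<epsilon> can occur; the damping is then
  uniform only on compact subsets of D, which is all that the relation modulo O(m^-\<infinity>) asks
  for.\<close>

abbreviation dderiv :: "('e::real_normed_vector \<Rightarrow> 'b::real_normed_vector) \<Rightarrow> 'e \<Rightarrow> 'e \<Rightarrow> 'b" where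
  "dderiv f v \<equiv> (\<lambda>p. frechet_derivative f (at p) v)"

lemma iter_deriv_append: "iter_deriv (us @ vs) f = iter_deriv us (iter_deriv vs f)"
  by (induction us) auto

text \<open>\<open>frechet_derivative\<close> is a choice operator, so it suffices that both
  functions have the same derivatives at \<open>p\<close>. Differentiability does not enter, which
  lets iterated derivatives be rewritten on open sets without side conditions.\<close>

lemma frechet_derivative_cong_open:
  assumes "open W" "p \<in> W" "\<And>q. q \<in> W \<Longrightarrow> f q = g q"
  shows "frechet_derivative f (at p) = frechet_derivative g (at p)"
proof -
  have "(f has_derivative D) (at p) \<longleftrightarrow> (g has_derivative D) (at p)" for D
    using assms by (metis has_derivative_transform_within_open)
  then show ?thesis by (simp add: frechet_derivative_def)
qed

lemma dderiv_eq:
  assumes "(f has_derivative D) (at p)"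
  shows "dderiv f v p = D v"
  using frechet_derivative_at[OF assms] by simp

lemma differentiable_on_openI:
  "open W \<Longrightarrow> (\<And>p. p \<in> W \<Longrightarrow> (f has_derivative D p) (at p)) \<Longrightarrow> f differentiable_on W"
  by (auto simp: differentiable_on_eq_differentiable_at differentiable_def)

lemma iter_deriv_cong_open:
  assumes "open W" "\<And>q. q \<in> W \<Longrightarrow> f q = g q" "p \<in> W"
  shows "iter_deriv vs f p = iter_deriv vs g p"
  using assms(3)
proof (induction vs arbitrary: p)
  case (Cons v vs)
  then show ?case
    using frechet_derivative_cong_open[OF assms(1) Cons.prems, of "iter_deriv vs f" "iter_deriv vs g"]
    by simp
qed (use assms in auto)

lemma differentiable_on_cong_open:
  assumes "open W" "\<And>q. q \<in> W \<Longrightarrow> f q = g q" "f differentiable_on W"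
  shows "g differentiable_on W"
  using assms by (metis differentiable_on_def differentiable_transform_within zero_less_one)

lemma smooth_on_cong:
  assumes "open W" "\<And>q. q \<in> W \<Longrightarrow> f q = g q" "smooth_on W f"
  shows "smooth_on W g"
  unfolding smooth_on_def
proof (intro allI impI)
  fix vs :: "'a list" assume "set vs \<subseteq> Basis"
  then have "iter_deriv vs f differentiable_on W" using assms(3) by (auto simp: smooth_on_def)
  then show "iter_deriv vs g differentiable_on W"
    by (rule differentiable_on_cong_open[OF assms(1), rotated]) (rule iter_deriv_cong_open[OF assms(1,2)])
qed

lemma iter_deriv_const: "iter_deriv vs (\<lambda>p. c) = (\<lambda>p. if vs = [] then c else 0)"
  by (induction vs) auto

text \<open>Finite differentiability order, so that closure properties can be proved by induction.\<close>

primrec ck_on ::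
  "nat \<Rightarrow> 'e::euclidean_space set \<Rightarrow> ('e \<Rightarrow> 'b::real_normed_vector) \<Rightarrow> bool" where
  "ck_on 0 W f \<longleftrightarrow> f differentiable_on W"
| "ck_on (Suc l) W f \<longleftrightarrow> f differentiable_on W \<and> (\<forall>b\<in>Basis. ck_on l W (dderiv f b))"

text \<open>\<open>ck_on\<close> strips the derivative taken first, whereas
  \<open>iter_deriv\<close> recurses on the one taken last; hence the lists of directions are split
  at their end.\<close>

lemma ck_on_iff:
  "ck_on l W f \<longleftrightarrow> (\<forall>vs. set vs \<subseteq> Basis \<and> length vs \<le> l \<longrightarrow> iter_deriv vs f differentiable_on W)"
proof (induction l arbitrary: f)
  case (Suc l)
  have "(\<forall>vs. set vs \<subseteq> Basis \<and> length vs \<le> Suc l \<longrightarrow> iter_deriv vs f differentiable_on W) \<longleftrightarrow>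
    f differentiable_on W \<and> (\<forall>b\<in>Basis. \<forall>vs. set vs \<subseteq> Basis \<and> length vs \<le> l \<longrightarrow>
       iter_deriv (vs @ [b]) f differentiable_on W)" (is "?L \<longleftrightarrow> ?R")
  proof
    assume L: ?L
    show ?R using L[rule_format, of "[]"] L by auto
  next
    assume R: ?R
    show ?L
    proof (intro allI impI)
      fix vs :: "'a list" assume vs: "set vs \<subseteq> Basis \<and> length vs \<le> Suc l"
      show "iter_deriv vs f differentiable_on W"
      proof (cases vs rule: rev_cases)
        case (snoc us b) then show ?thesis using R vs by auto
      qed (use R in simp)
    qed
  qed
  then show ?case using Suc by (simp add: iter_deriv_append)
qed auto

lemma smooth_on_iff_ck_on: "smooth_on W f \<longleftrightarrow> (\<forall>l. ck_on l W f)"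
  by (auto simp: smooth_on_def ck_on_iff)

lemma ck_on_differentiable: "ck_on l W f \<Longrightarrow> f differentiable_on W"
  by (cases l) auto

lemma ck_on_SucD: "ck_on (Suc l) W f \<Longrightarrow> ck_on l W f"
  by (simp add: ck_on_iff del: ck_on.simps)

lemma ck_on_cong:
  assumes "open W" "\<And>q. q \<in> W \<Longrightarrow> f q = g q" "ck_on l W f"
  shows "ck_on l W g"
  unfolding ck_on_iff
proof (intro allI impI)
  fix vs :: "'a list" assume "set vs \<subseteq> Basis \<and> length vs \<le> l"
  then have "iter_deriv vs f differentiable_on W" using assms(3) by (auto simp: ck_on_iff)
  then show "iter_deriv vs g differentiable_on W"
    by (rule differentiable_on_cong_open[OF assms(1), rotated]) (rule iter_deriv_cong_open[OF assms(1,2)])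
qed

lemma ck_on_linear_image:
  assumes "open W" "bounded_linear h" "ck_on l W f"
  shows "ck_on l W (\<lambda>p. h (f p))"
  using assms(3)
proof (induction l arbitrary: f)
  case 0
  then show ?case
    using bounded_linear_imp_differentiable[OF assms(2)]
    by (auto simp: differentiable_on_def intro!: differentiable_compose[of h f])
next
  case (Suc l)
  have d: "f differentiable at p" if "p \<in> W" for p
    using Suc.prems that assms(1) by (auto simp: differentiable_on_eq_differentiable_at)
  have "ck_on l W (dderiv (\<lambda>p. h (f p)) b)" if "b \<in> Basis" for b
  proof (rule ck_on_cong[OF assms(1) _ Suc.IH])
    show "ck_on l W (dderiv f b)" using Suc.prems that by auto
    fix q assume "q \<in> W"
    then have "(f has_derivative frechet_derivative f (at q)) (at q)"
      using d frechet_derivative_works by metis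
    then have "((\<lambda>p. h (f p)) has_derivative (\<lambda>v. h (frechet_derivative f (at q) v))) (at q)"
      by (rule bounded_linear.has_derivative[OF assms(2)])
    then show "h (dderiv f b q) = dderiv (\<lambda>p. h (f p)) b q"
      by (simp only: dderiv_eq)
  qed
  moreover have "(\<lambda>p. h (f p)) differentiable_on W"
    using d bounded_linear_imp_differentiable[OF assms(2)]
    by (intro differentiable_at_imp_differentiable_on differentiable_compose[of h f])
  ultimately show ?case by auto
qed

lemma ck_on_add:
  assumes "open W" "ck_on l W f" "ck_on l W g"
  shows "ck_on l W (\<lambda>p. f p + g p)"
  using assms(2,3)
proof (induction l arbitrary: f g)
  case (Suc l)
  have d: "f differentiable at p" "g differentiable at p" if "p \<in> W" for p
    using Suc.prems that assms(1) by (auto simp: differentiable_on_eq_differentiable_at)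
  have "ck_on l W (dderiv (\<lambda>p. f p + g p) b)" if "b \<in> Basis" for b
  proof (rule ck_on_cong[OF assms(1) _ Suc.IH])
    show "ck_on l W (dderiv f b)" "ck_on l W (dderiv g b)" using Suc.prems that by auto
    fix q assume "q \<in> W"
    then have "((\<lambda>p. f p + g p) has_derivative
        (\<lambda>v. frechet_derivative f (at q) v + frechet_derivative g (at q) v)) (at q)"
      by (intro has_derivative_add iffD1[OF frechet_derivative_works] d)
    then show "dderiv f b q + dderiv g b q = dderiv (\<lambda>p. f p + g p) b q"
      by (simp only: dderiv_eq)
  qed
  then show ?case using Suc.prems by (auto intro: differentiable_on_add)
qed (auto intro: differentiable_on_add)

lemma ck_on_const: "ck_on l W (\<lambda>p. c)"
  by (auto simp: ck_on_iff iter_deriv_const)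

lemma ck_on_sum:
  assumes "open W" "finite I" "\<And>i. i \<in> I \<Longrightarrow> ck_on l W (f i)"
  shows "ck_on l W (\<lambda>p. \<Sum>i\<in>I. f i p)"
  using assms(2,3) by (induction I) (auto intro: ck_on_add[OF assms(1)] ck_on_const)

lemma ck_on_bounded_linear:
  assumes "bounded_linear h"
  shows "ck_on l W h"
proof -
  have "frechet_derivative h (at p) = h" for p
    using frechet_derivative_at[OF bounded_linear_imp_has_derivative[OF assms]] by simp
  then show ?thesis
    using bounded_linear_imp_differentiable_on[OF assms] by (cases l) (auto simp: ck_on_const)
qed

text \<open>One statement covers scaling and multiplication. Each term of the product rule
  differentiates one factor only, so the induction hypothesis meets the other factor with its order
  lowered by \<open>ck_on_SucD\<close>.\<close>

lemma ck_on_bilinear: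
  assumes "open W" "bounded_bilinear B" "ck_on l W f" "ck_on l W g"
  shows "ck_on l W (\<lambda>p. B (f p) (g p))"
  using assms(3,4)
proof (induction l arbitrary: f g)
  case 0
  then have "f differentiable at p" "g differentiable at p" if "p \<in> W" for p
    using that assms(1) by (auto simp: differentiable_on_eq_differentiable_at)
  then have "((\<lambda>p. B (f p) (g p)) has_derivative
        (\<lambda>v. B (f q) (frechet_derivative g (at q) v) + B (frechet_derivative f (at q) v) (g q))) (at q)"
    if "q \<in> W" for q
    using that by (intro bounded_bilinear.FDERIV[OF assms(2)] iffD1[OF frechet_derivative_works]) auto
  from differentiable_on_openI[OF assms(1) this] show ?case by simp
next
  case (Suc l)
  have d: "f differentiable at p" "g differentiable at p" if "p \<in> W" for p
    using Suc.prems that assms(1) by (auto simp: differentiable_on_eq_differentiable_at)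
  have D: "((\<lambda>p. B (f p) (g p)) has_derivative
        (\<lambda>v. B (f q) (frechet_derivative g (at q) v) + B (frechet_derivative f (at q) v) (g q))) (at q)"
    if "q \<in> W" for q
    by (intro bounded_bilinear.FDERIV[OF assms(2)] iffD1[OF frechet_derivative_works] d that)
  have "ck_on l W (dderiv (\<lambda>p. B (f p) (g p)) b)" if "b \<in> Basis" for b
  proof (rule ck_on_cong[OF assms(1) _ ck_on_add[OF assms(1)]])
    show "ck_on l W (\<lambda>p. B (f p) (dderiv g b p))" "ck_on l W (\<lambda>p. B (dderiv f b p) (g p))"
      using Suc.prems Suc.prems[THEN ck_on_SucD] that by (auto intro!: Suc.IH)
    fix q assume "q \<in> W"
    then show "B (f q) (dderiv g b q) + B (dderiv f b q) (g q) = dderiv (\<lambda>p. B (f p) (g p)) b q"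
      by (simp only: dderiv_eq[OF D])
  qed
  moreover have "(\<lambda>p. B (f p) (g p)) differentiable_on W"
    by (rule differentiable_on_openI[OF assms(1) D])
  ultimately show ?case by simp
qed

text \<open>The chain rule differentiates \<open>F\<close> along \<open>dderiv f b p\<close>, which
  need not be a basis vector. Expanding it in the basis gives a sum of products of components of
  \<open>dderiv f b\<close> with \<open>dderiv F c\<close> after \<open>f\<close>, so the induction
  varies \<open>F\<close> and keeps \<open>f\<close>.\<close>

lemma ck_on_compose:
  fixes f :: "'e::euclidean_space \<Rightarrow> 'f::euclidean_space"
  assumes "open W" "open V" "f ` W \<subseteq> V" "ck_on l V F" "ck_on l W f"
  shows "ck_on l W (\<lambda>p. F (f p))"
  using assms(4,5)
proof (induction l arbitrary: F)
  case 0
  then have d: "f differentiable at p" "F differentiable at (f p)" if "p \<in> W" for p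
    using that assms(1-3) by (auto simp: differentiable_on_eq_differentiable_at image_subset_iff)
  have "(\<lambda>p. F (f p)) differentiable_on W"
    by (intro differentiable_at_imp_differentiable_on differentiable_compose[of F f] d)
  then show ?case by simp
next
  case (Suc l)
  have d: "f differentiable at p" "F differentiable at (f p)" if "p \<in> W" for p
    using Suc.prems that assms(1-3) by (auto simp: differentiable_on_eq_differentiable_at image_subset_iff)
  have D: "((\<lambda>p. F (f p)) has_derivative
        (\<lambda>v. frechet_derivative F (at (f q)) (frechet_derivative f (at q) v))) (at q)"
    if "q \<in> W" for q
    by (intro has_derivative_compose[of f _ q UNIV F] iffD1[OF frechet_derivative_works] d that)
  have "ck_on l W (dderiv (\<lambda>p. F (f p)) b)" if "b \<in> Basis" for b
  proof (rule ck_on_cong[OF assms(1) _ ck_on_sum[OF assms(1) finite_Basis]])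
    fix c :: 'f assume c: "c \<in> Basis"
    show "ck_on l W (\<lambda>p. (dderiv f b p \<bullet> c) *\<^sub>R dderiv F c (f p))"
    proof (rule ck_on_bilinear[OF assms(1) bounded_bilinear_scaleR])
      show "ck_on l W (\<lambda>p. dderiv f b p \<bullet> c)"
        using Suc.prems(2) that by (intro ck_on_linear_image[OF assms(1) bounded_linear_inner_left]) simp
      have "ck_on l V (dderiv F c)" using Suc.prems(1) c by simp
      then show "ck_on l W (\<lambda>p. dderiv F c (f p))"
        using ck_on_SucD[OF Suc.prems(2)] by (rule Suc.IH)
    qed
  next
    fix q assume q: "q \<in> W"
    have lin: "linear (frechet_derivative F (at (f q)))"
      using d(2)[OF q] linear_frechet_derivative by blast
    have "dderiv (\<lambda>p. F (f p)) b q = frechet_derivative F (at (f q)) (dderiv f b q)"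
      by (simp only: dderiv_eq[OF D[OF q]])
    also have "\<dots> = frechet_derivative F (at (f q)) (\<Sum>c\<in>Basis. (dderiv f b q \<bullet> c) *\<^sub>R c)"
      by (simp add: euclidean_representation)
    also have "\<dots> = (\<Sum>c\<in>Basis. (dderiv f b q \<bullet> c) *\<^sub>R dderiv F c (f q))"
      by (simp add: linear_sum[OF lin] linear_scale[OF lin])
    finally show "(\<Sum>c\<in>Basis. (dderiv f b q \<bullet> c) *\<^sub>R dderiv F c (f q)) = dderiv (\<lambda>p. F (f p)) b q" ..
  qed
  moreover have "(\<lambda>p. F (f p)) differentiable_on W"
    by (rule differentiable_on_openI[OF assms(1) D])
  ultimately show ?case by simp
qed

lemma smooth_on_const: "smooth_on W (\<lambda>p. c)"
  by (simp add: smooth_on_iff_ck_on ck_on_const)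

lemma smooth_on_bounded_linear: "bounded_linear h \<Longrightarrow> smooth_on W h"
  by (simp add: smooth_on_iff_ck_on ck_on_bounded_linear)

lemma smooth_on_add: "open W \<Longrightarrow> smooth_on W f \<Longrightarrow> smooth_on W g \<Longrightarrow> smooth_on W (\<lambda>p. f p + g p)"
  unfolding smooth_on_iff_ck_on by (blast intro: ck_on_add[of W _ f g])

lemma smooth_on_sum:
  "open W \<Longrightarrow> finite I \<Longrightarrow> (\<And>i. i \<in> I \<Longrightarrow> smooth_on W (f i)) \<Longrightarrow> smooth_on W (\<lambda>p. \<Sum>i\<in>I. f i p)"
  unfolding smooth_on_iff_ck_on by (blast intro: ck_on_sum[of W I _ f])

lemma smooth_on_mult:
  fixes f g :: "'e::euclidean_space \<Rightarrow> 'b::real_normed_algebra"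
  shows "open W \<Longrightarrow> smooth_on W f \<Longrightarrow> smooth_on W g \<Longrightarrow> smooth_on W (\<lambda>p. f p * g p)"
  unfolding smooth_on_iff_ck_on by (blast intro: ck_on_bilinear[OF _ bounded_bilinear_mult, of W _ f g])

lemma smooth_on_linear_image:
  "open W \<Longrightarrow> bounded_linear h \<Longrightarrow> smooth_on W f \<Longrightarrow> smooth_on W (\<lambda>p. h (f p))"
  unfolding smooth_on_iff_ck_on by (blast intro: ck_on_linear_image[of W h _ f])

lemma smooth_on_compose:
  fixes f :: "'e::euclidean_space \<Rightarrow> 'f::euclidean_space"
  shows "open W \<Longrightarrow> open V \<Longrightarrow> f ` W \<subseteq> V \<Longrightarrow> smooth_on V F \<Longrightarrow> smooth_on W f \<Longrightarrow> smooth_on W (\<lambda>p. F (f p))"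
  unfolding smooth_on_iff_ck_on by (blast intro: ck_on_compose[of W V f _ F])

lemma smooth_on_differentiable: "smooth_on W f \<Longrightarrow> open W \<Longrightarrow> p \<in> W \<Longrightarrow> f differentiable at p"
  unfolding smooth_on_iff_ck_on
  using ck_on_differentiable[of 0 W f] differentiable_on_eq_differentiable_at[of W f] by blast

text \<open>An affine substitution does not preserve basis directions, hence the need for derivatives in
  arbitrary directions.\<close>

lemma smooth_on_dderiv:
  assumes W: "open W" and f: "smooth_on W f"
  shows "smooth_on W (dderiv f v)"
proof (rule smooth_on_cong[OF W _ smooth_on_sum[OF W finite_Basis]])
  fix b :: 'a assume "b \<in> Basis"
  then have "smooth_on W (dderiv f b)"
    using f unfolding smooth_on_iff_ck_on by (metis ck_on.simps(2))
  then show "smooth_on W (\<lambda>p. (v \<bullet> b) *\<^sub>R dderiv f b p)"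
    by (rule smooth_on_linear_image[OF W bounded_linear_scaleR_right])
next
  fix q assume "q \<in> W"
  then have lin: "linear (frechet_derivative f (at q))"
    using smooth_on_differentiable[OF f W] linear_frechet_derivative by blast
  have "dderiv f v q = frechet_derivative f (at q) (\<Sum>b\<in>Basis. (v \<bullet> b) *\<^sub>R b)"
    by (simp add: euclidean_representation)
  then show "(\<Sum>b\<in>Basis. (v \<bullet> b) *\<^sub>R dderiv f b q) = dderiv f v q"
    by (simp add: linear_sum[OF lin] linear_scale[OF lin])
qed

section \<open>Iterated derivatives and affine substitutions\<close>

lemma smooth_on_iter_deriv:
  assumes "open W" "smooth_on W f"
  shows "smooth_on W (iter_deriv vs f)"
  using assms by (induction vs) (auto intro: smooth_on_dderiv)

text \<open>Serves linear substitutions that kill a coordinate direction, such as the projection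
  that forgets \<theta>: a derivative along such a direction must contribute 0.\<close>

lemma iter_deriv_zero_direction:
  assumes "open W" "smooth_on W f" "0 \<in> set vs" "p \<in> W"
  shows "iter_deriv vs f p = 0"
  using assms(3,4)
proof (induction vs arbitrary: p)
  case (Cons v vs)
  show ?case
  proof (cases "v = 0")
    case True
    have "linear (frechet_derivative (iter_deriv vs f) (at p))"
      using smooth_on_differentiable[OF smooth_on_iter_deriv] assms(1,2) Cons.prems
        linear_frechet_derivative by blast
    then show ?thesis using True linear_0 by auto
  next
    case False
    then have "frechet_derivative (iter_deriv vs f) (at p) = frechet_derivative (\<lambda>p. 0) (at p)"
      using Cons by (intro frechet_derivative_cong_open[OF assms(1)]) auto
    then show ?thesis by simp
  qed
qed auto

text \<open>The derivative of an affine map is constant, so the chain rule produces no further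
  terms: only the list of directions changes, and it may leave the basis.\<close>

lemma iter_deriv_affine:
  fixes L :: "'e::euclidean_space \<Rightarrow> 'f::euclidean_space"
  assumes V: "open V" "smooth_on V f" and W: "open W" "\<And>p. p \<in> W \<Longrightarrow> L p + a \<in> V"
    and L: "bounded_linear L" and p: "p \<in> W"
  shows "iter_deriv vs (\<lambda>p. f (L p + a)) p = iter_deriv (map L vs) f (L p + a)"
  using p
proof (induction vs arbitrary: p)
  case (Cons v vs)
  let ?F = "iter_deriv (map L vs) f"
  have "?F differentiable at (L p + a)"
    using smooth_on_differentiable[OF smooth_on_iter_deriv[OF V] V(1)] W(2)[OF Cons.prems] .
  then have F: "(?F has_derivative frechet_derivative ?F (at (L p + a))) (at (L p + a))"
    using frechet_derivative_works by blast
  have "((\<lambda>p. L p + a) has_derivative L) (at p)"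
    using bounded_linear_imp_has_derivative[OF L] by (auto intro!: derivative_eq_intros)
  from has_derivative_compose[OF this F]
  have "frechet_derivative (\<lambda>p. ?F (L p + a)) (at p) = (\<lambda>v. frechet_derivative ?F (at (L p + a)) (L v))"
    by (rule frechet_derivative_at[symmetric])
  moreover have "frechet_derivative (iter_deriv vs (\<lambda>p. f (L p + a))) (at p) =
      frechet_derivative (\<lambda>p. ?F (L p + a)) (at p)"
    using Cons by (intro frechet_derivative_cong_open[OF W(1)]) auto
  ultimately show ?case by simp
qed simp

lemma smooth_on_affine:
  fixes L :: "'e::euclidean_space \<Rightarrow> 'f::euclidean_space"
  assumes "open V" "smooth_on V f" "open W" "\<And>p. p \<in> W \<Longrightarrow> L p + a \<in> V" "bounded_linear L"
  shows "smooth_on W (\<lambda>p. f (L p + a))"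
  using assms
proof -
  have "smooth_on W (\<lambda>p. L p + a)"
    by (rule smooth_on_add[OF assms(3) smooth_on_bounded_linear[OF assms(5)] smooth_on_const])
  then show ?thesis
    using assms(4) by (intro smooth_on_compose[OF assms(3,1) _ assms(2)]) auto
qed

section \<open>Moderate and negligible families\<close>

definition poly_bounded :: "'e set \<Rightarrow> (nat \<Rightarrow> 'e \<Rightarrow> complex) \<Rightarrow> bool" where
  "poly_bounded K f \<longleftrightarrow> (\<exists>C r. \<forall>m\<ge>1. \<forall>p\<in>K. norm (f m p) \<le> C * real m ^ r)"

text \<open>The exponent of m may depend on \<open>K\<close> and \<open>vs\<close>: every derivative
  of an oscillating exponential costs a factor m, and any fixed power is later beaten by exponential
  decay.\<close>

definition moderate :: "'e::euclidean_space set \<Rightarrow> (nat \<Rightarrow> 'e \<Rightarrow> complex) \<Rightarrow> bool" where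
  "moderate W a \<longleftrightarrow> (\<forall>m\<ge>1. smooth_on W (a m)) \<and>
     (\<forall>K vs. compact K \<and> K \<subseteq> W \<and> set vs \<subseteq> Basis \<longrightarrow> poly_bounded K (\<lambda>m. iter_deriv vs (a m)))"

text \<open>The form of \<open>equiv_mod_Oinf\<close> for a single family, namely a difference, so
  that error terms can be added up.\<close>

definition negligible_on :: "nat set \<Rightarrow> 'e::euclidean_space set \<Rightarrow> (nat \<Rightarrow> 'e \<Rightarrow> complex) \<Rightarrow> bool" where
  "negligible_on I W R \<longleftrightarrow> (\<forall>m\<in>I. smooth_on W (R m)) \<and>
     (\<forall>K vs N. compact K \<and> K \<subseteq> W \<and> set vs \<subseteq> Basis \<longrightarrow>
        (\<exists>C. \<forall>m\<in>I. \<forall>p\<in>K. norm (iter_deriv vs (R m) p) \<le> C * real m powi (- int N)))"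

lemma equiv_mod_Oinf_iff_negligible:
  "equiv_mod_Oinf I W F G \<longleftrightarrow> negligible_on I W (\<lambda>m p. F m p - G m p)"
  by (simp add: equiv_mod_Oinf_def negligible_on_def)

lemma iter_deriv_add:
  assumes "open W" "smooth_on W f" "smooth_on W g" "p \<in> W"
  shows "iter_deriv vs (\<lambda>p. f p + g p) p = iter_deriv vs f p + iter_deriv vs g p"
  using assms(4)
proof (induction vs arbitrary: p)
  case (Cons v vs)
  have "iter_deriv vs f differentiable at p" "iter_deriv vs g differentiable at p"
    using Cons.prems smooth_on_differentiable[OF smooth_on_iter_deriv[OF assms(1)] assms(1)] assms(2,3) by auto
  then have "((\<lambda>p. iter_deriv vs f p + iter_deriv vs g p) has_derivative
      (\<lambda>v. dderiv (iter_deriv vs f) v p + dderiv (iter_deriv vs g) v p)) (at p)"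
    by (intro has_derivative_add iffD1[OF frechet_derivative_works])
  then show ?case
    using frechet_derivative_cong_open[OF assms(1) Cons.prems Cons.IH] dderiv_eq by fastforce
qed simp

lemma poly_bounded_add:
  assumes "poly_bounded K f" "poly_bounded K g"
  shows "poly_bounded K (\<lambda>m p. f m p + g m p)"
proof -
  obtain C r C' r' where b: "\<forall>m\<ge>1. \<forall>p\<in>K. norm (f m p) \<le> C * real m ^ r"
    "\<forall>m\<ge>1. \<forall>p\<in>K. norm (g m p) \<le> C' * real m ^ r'"
    using assms by (auto simp: poly_bounded_def)
  have "norm (f m p + g m p) \<le> (\<bar>C\<bar> + \<bar>C'\<bar>) * real m ^ (r + r')" if "m \<ge> 1" "p \<in> K" for m p
  proof -
    have "real m ^ r \<le> real m ^ (r + r')" "real m ^ r' \<le> real m ^ (r + r')"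
      using that by (auto intro: power_increasing)
    then have "\<bar>C\<bar> * real m ^ r + \<bar>C'\<bar> * real m ^ r' \<le> (\<bar>C\<bar> + \<bar>C'\<bar>) * real m ^ (r + r')"
      by (auto simp: distrib_right intro!: add_mono mult_left_mono)
    moreover have "C * real m ^ r \<le> \<bar>C\<bar> * real m ^ r" "C' * real m ^ r' \<le> \<bar>C'\<bar> * real m ^ r'"
      by (auto intro: mult_right_mono)
    moreover have "norm (f m p) \<le> C * real m ^ r" "norm (g m p) \<le> C' * real m ^ r'"
      using b that by auto
    ultimately show ?thesis
      using norm_triangle_ineq[of "f m p" "g m p"] by linarith
  qed
  then show ?thesis by (auto simp: poly_bounded_def)
qed

lemma poly_bounded_mult:
  assumes "poly_bounded K f" "poly_bounded K g"
  shows "poly_bounded K (\<lambda>m p. f m p * g m p)"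
proof -
  obtain C r C' r' where b: "\<forall>m\<ge>1. \<forall>p\<in>K. norm (f m p) \<le> C * real m ^ r"
    "\<forall>m\<ge>1. \<forall>p\<in>K. norm (g m p) \<le> C' * real m ^ r'"
    using assms by (auto simp: poly_bounded_def)
  have "norm (f m p * g m p) \<le> (C * C') * real m ^ (r + r')" if "m \<ge> 1" "p \<in> K" for m p
  proof -
    have "norm (f m p) * norm (g m p) \<le> (C * real m ^ r) * (C' * real m ^ r')"
      using b that by (intro mult_mono) (auto intro: order_trans[OF norm_ge_zero])
    then show ?thesis by (simp add: norm_mult power_add mult_ac)
  qed
  then show ?thesis by (auto simp: poly_bounded_def)
qed

lemma poly_bounded_cong:
  assumes "\<And>m p. m \<ge> 1 \<Longrightarrow> p \<in> K \<Longrightarrow> f m p = g m p" "poly_bounded K f"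
  shows "poly_bounded K g"
  using assms unfolding poly_bounded_def by simp

lemma moderateD:
  "moderate W a \<Longrightarrow> m \<ge> 1 \<Longrightarrow> smooth_on W (a m)"
  "moderate W a \<Longrightarrow> compact K \<Longrightarrow> K \<subseteq> W \<Longrightarrow> set vs \<subseteq> Basis \<Longrightarrow> poly_bounded K (\<lambda>m. iter_deriv vs (a m))"
  by (auto simp: moderate_def)

lemma moderate_add:
  assumes "open W" "moderate W a" "moderate W b"
  shows "moderate W (\<lambda>m p. a m p + b m p)"
  unfolding moderate_def
proof (intro conjI allI impI)
  fix m :: nat assume "m \<ge> 1"
  then show "smooth_on W (\<lambda>p. a m p + b m p)"
    by (intro smooth_on_add[OF assms(1)] moderateD(1)[OF assms(2)] moderateD(1)[OF assms(3)])
next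
  fix K vs assume K: "compact K \<and> K \<subseteq> W \<and> set vs \<subseteq> (Basis :: 'a set)"
  have "poly_bounded K (\<lambda>m p. iter_deriv vs (a m) p + iter_deriv vs (b m) p)"
    using K assms moderateD(2) by (intro poly_bounded_add) blast+
  then show "poly_bounded K (\<lambda>m. iter_deriv vs (\<lambda>p. a m p + b m p))"
  proof (rule poly_bounded_cong[rotated])
    fix m :: nat and p assume "m \<ge> 1" "p \<in> K"
    then show "iter_deriv vs (a m) p + iter_deriv vs (b m) p = iter_deriv vs (\<lambda>p. a m p + b m p) p"
      using iter_deriv_add[OF assms(1) moderateD(1)[OF assms(2)] moderateD(1)[OF assms(3)], of m m p vs] K
      by auto
  qed
qed

lemma moderate_dderiv:
  assumes "open W" "moderate W a" "v \<in> Basis"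
  shows "moderate W (\<lambda>m. dderiv (a m) v)"
  unfolding moderate_def
proof (intro conjI allI impI)
  fix m :: nat assume "m \<ge> 1"
  then show "smooth_on W (dderiv (a m) v)"
    by (intro smooth_on_dderiv[OF assms(1)] moderateD(1)[OF assms(2)])
next
  fix K vs assume "compact K \<and> K \<subseteq> W \<and> set vs \<subseteq> (Basis :: 'a set)"
  then have "poly_bounded K (\<lambda>m. iter_deriv (vs @ [v]) (a m))"
    using assms by (intro moderateD(2)) auto
  then show "poly_bounded K (\<lambda>m. iter_deriv vs (dderiv (a m) v))"
    by (simp add: iter_deriv_append)
qed

text \<open>The Leibniz rule for the derivative taken first yields two products of moderate families
  with a shorter list of directions. Hence the list is decomposed at its end and the families vary
  in the induction.\<close>

lemma moderate_mult:
  assumes W: "open W" and ab: "moderate W a" "moderate W b"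
  shows "moderate W (\<lambda>m p. a m p * b m p)"
  unfolding moderate_def
proof (intro conjI allI impI)
  fix m :: nat assume "m \<ge> 1"
  then show "smooth_on W (\<lambda>p. a m p * b m p)"
    by (intro smooth_on_mult[OF W] moderateD(1)[OF ab(1)] moderateD(1)[OF ab(2)])
next
  fix K vs assume K: "compact K \<and> K \<subseteq> W \<and> set vs \<subseteq> (Basis :: 'a set)"
  then have "set vs \<subseteq> Basis" by simp
  then show "poly_bounded K (\<lambda>m. iter_deriv vs (\<lambda>p. a m p * b m p))"
    using ab
  proof (induction vs arbitrary: a b rule: rev_induct)
    case Nil
    then show ?case
      using K moderateD(2)[OF Nil(2), of K "[]"] moderateD(2)[OF Nil(3), of K "[]"]
      by (auto intro: poly_bounded_mult)
  next
    case (snoc v vs)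
    have v: "v \<in> Basis" using snoc.prems by simp
    have m: "moderate W (\<lambda>m. dderiv (a m) v)" "moderate W (\<lambda>m. dderiv (b m) v)"
      using moderate_dderiv[OF W _ v] snoc.prems by auto
    have "poly_bounded K (\<lambda>m p. iter_deriv vs (\<lambda>p. a m p * dderiv (b m) v p) p
        + iter_deriv vs (\<lambda>p. dderiv (a m) v p * b m p) p)"
      by (intro poly_bounded_add snoc.IH m) (use snoc.prems in auto)
    then show ?case
    proof (rule poly_bounded_cong[rotated])
      fix m :: nat and p assume m1: "m \<ge> 1" and p: "p \<in> K"
      have s: "smooth_on W (a m)" "smooth_on W (b m)" "smooth_on W (dderiv (a m) v)" "smooth_on W (dderiv (b m) v)"
        by (intro moderateD(1)[OF _ m1] m snoc.prems)+
      have D: "a m q * dderiv (b m) v q + dderiv (a m) v q * b m q = dderiv (\<lambda>p. a m p * b m p) v q"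
        if "q \<in> W" for q
      proof -
        have "((\<lambda>p. a m p * b m p) has_derivative
            (\<lambda>v. a m q * dderiv (b m) v q + dderiv (a m) v q * b m q)) (at q)"
          by (intro has_derivative_mult iffD1[OF frechet_derivative_works]
              smooth_on_differentiable[OF _ W that] s)
        then show ?thesis by (simp only: dderiv_eq)
      qed
      have "iter_deriv vs (\<lambda>p. a m p * dderiv (b m) v p) p + iter_deriv vs (\<lambda>p. dderiv (a m) v p * b m p) p
        = iter_deriv vs (\<lambda>p. a m p * dderiv (b m) v p + dderiv (a m) v p * b m p) p"
        using s p K by (intro iter_deriv_add[OF W, symmetric] smooth_on_mult[OF W]) auto
      also have "\<dots> = iter_deriv vs (dderiv (\<lambda>p. a m p * b m p) v) p"
        using p K by (intro iter_deriv_cong_open[OF W D]) auto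
      finally show "iter_deriv vs (\<lambda>p. a m p * dderiv (b m) v p) p + iter_deriv vs (\<lambda>p. dderiv (a m) v p * b m p) p
        = iter_deriv (vs @ [v]) (\<lambda>p. a m p * b m p) p"
        by (simp add: iter_deriv_append)
    qed
  qed
qed

lemma moderate_smooth:
  assumes "open W" "smooth_on W f"
  shows "moderate W (\<lambda>m. f)"
  unfolding moderate_def
proof (intro conjI allI impI)
  fix K vs assume K: "compact K \<and> K \<subseteq> W \<and> set vs \<subseteq> (Basis :: 'a set)"
  have "iter_deriv vs f differentiable_on K"
    using K assms(2) by (auto simp: smooth_on_def intro: differentiable_on_subset)
  then have "compact (iter_deriv vs f ` K)"
    using K by (intro compact_continuous_image differentiable_imp_continuous_on) auto
  then obtain C where "\<forall>y\<in>iter_deriv vs f ` K. norm y \<le> C"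
    using compact_imp_bounded bounded_iff by metis
  then show "poly_bounded K (\<lambda>m. iter_deriv vs f)"
    unfolding poly_bounded_def by (intro exI[of _ C] exI[of _ 0]) auto
qed (rule assms)

lemma moderate_scalar:
  assumes "\<And>m. m \<ge> 1 \<Longrightarrow> norm (c m) \<le> C * real m ^ r"
  shows "moderate W (\<lambda>m p. c m)"
  unfolding moderate_def
proof (intro conjI allI impI)
  fix K :: "'a set" and vs
  have "0 \<le> C * real m ^ r" if "m \<ge> 1" for m using assms[OF that] norm_ge_zero order_trans by blast
  then show "poly_bounded K (\<lambda>m. iter_deriv vs (\<lambda>p. c m))"
    using assms unfolding poly_bounded_def iter_deriv_const by (intro exI[of _ C] exI[of _ r]) auto
qed (rule smooth_on_const)

text \<open>\<open>poly_bounded\<close> uses natural exponents, so a nonnegative order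
  \<open>d\<close> becomes the exponent \<open>nat d\<close>.\<close>

lemma symbol_class_moderate:
  assumes "symbol_class {1..} real d W a" "0 \<le> d"
  shows "moderate W a"
  unfolding moderate_def
proof (intro conjI allI impI)
  fix K vs assume "compact K \<and> K \<subseteq> W \<and> set vs \<subseteq> (Basis :: 'a set)"
  then obtain C where "\<forall>m\<in>{1..}. \<forall>p\<in>K. norm (iter_deriv vs (a m) p) \<le> C * real m powi d"
    using assms(1) unfolding symbol_class_def by metis
  then show "poly_bounded K (\<lambda>m. iter_deriv vs (a m))"
    using assms(2) unfolding poly_bounded_def
    by (intro exI[of _ C] exI[of _ "nat d"]) (auto simp: power_int_def)
qed (use assms(1) in \<open>auto simp: symbol_class_def\<close>)

text \<open>Moderateness controls basis directions only. As \<open>L\<close> maps each basis vector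
  to a basis vector or to 0, a derivative of the composition is either controlled on the compact
  image of \<open>K\<close> or zero.\<close>

lemma moderate_affine:
  fixes L :: "'e::euclidean_space \<Rightarrow> 'f::euclidean_space"
  assumes V: "open V" "moderate V a" and W: "open W" "\<And>p. p \<in> W \<Longrightarrow> L p + c \<in> V"
    and L: "bounded_linear L" "\<And>b. b \<in> Basis \<Longrightarrow> L b \<in> insert 0 Basis"
  shows "moderate W (\<lambda>m p. a m (L p + c))"
  unfolding moderate_def
proof (intro conjI allI impI)
  fix m :: nat assume "m \<ge> 1"
  then show "smooth_on W (\<lambda>p. a m (L p + c))"
    by (rule smooth_on_affine[OF V(1) moderateD(1)[OF V(2)] W L(1)])
next
  fix K vs assume K: "compact K \<and> K \<subseteq> W \<and> set vs \<subseteq> (Basis :: 'e set)"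
  have eq: "iter_deriv vs (\<lambda>p. a m (L p + c)) p = iter_deriv (map L vs) (a m) (L p + c)"
    if "m \<ge> 1" "p \<in> K" for m p
    using that K by (intro iter_deriv_affine[OF V(1) moderateD(1)[OF V(2)] W L(1)]) auto
  show "poly_bounded K (\<lambda>m. iter_deriv vs (\<lambda>p. a m (L p + c)))"
  proof (cases "0 \<in> set (map L vs)")
    case True
    have "iter_deriv vs (\<lambda>p. a m (L p + c)) p = 0" if "m \<ge> 1" "p \<in> K" for m p
      using eq[OF that] iter_deriv_zero_direction[OF V(1) moderateD(1)[OF V(2) that(1)] True] W(2) that K
      by auto
    then show ?thesis unfolding poly_bounded_def by (intro exI[of _ 0]) auto
  next
    case False
    then have "set (map L vs) \<subseteq> Basis" using K L(2) by fastforce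
    moreover have "compact ((\<lambda>p. L p + c) ` K)"
      using K L(1) by (intro compact_continuous_image continuous_on_add continuous_on_const
          linear_continuous_on) auto
    moreover have "(\<lambda>p. L p + c) ` K \<subseteq> V" using K W(2) by auto
    ultimately have "poly_bounded ((\<lambda>p. L p + c) ` K) (\<lambda>m. iter_deriv (map L vs) (a m))"
      by (intro moderateD(2)[OF V(2)]) auto
    then show ?thesis using eq by (auto simp: poly_bounded_def)
  qed
qed

lemma negligible_on_cong:
  assumes "open W" "\<And>m p. m \<in> I \<Longrightarrow> p \<in> W \<Longrightarrow> F m p = G m p" "negligible_on I W F"
  shows "negligible_on I W G"
  unfolding negligible_on_def
proof (intro conjI ballI allI impI)
  fix m assume "m \<in> I"
  then show "smooth_on W (G m)"
    using assms smooth_on_cong[of W "F m" "G m"] by (auto simp: negligible_on_def)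
next
  fix K vs N assume K: "compact K \<and> K \<subseteq> W \<and> set vs \<subseteq> (Basis :: 'a set)"
  then obtain C where C: "\<forall>m\<in>I. \<forall>p\<in>K. norm (iter_deriv vs (F m) p) \<le> C * real m powi (- int N)"
    using assms(3) unfolding negligible_on_def by blast
  have "iter_deriv vs (F m) p = iter_deriv vs (G m) p" if "m \<in> I" "p \<in> K" for m p
    using that K assms by (intro iter_deriv_cong_open[OF assms(1)]) auto
  then show "\<exists>C. \<forall>m\<in>I. \<forall>p\<in>K. norm (iter_deriv vs (G m) p) \<le> C * real m powi (- int N)"
    using C by auto
qed

lemma negligible_on_add:
  assumes "open W" "negligible_on I W F" "negligible_on I W G"
  shows "negligible_on I W (\<lambda>m p. F m p + G m p)"
  unfolding negligible_on_def
proof (intro conjI ballI allI impI)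
  fix m assume "m \<in> I"
  then show "smooth_on W (\<lambda>p. F m p + G m p)"
    using assms by (auto simp: negligible_on_def intro: smooth_on_add)
next
  fix K vs N assume K: "compact K \<and> K \<subseteq> W \<and> set vs \<subseteq> (Basis :: 'a set)"
  obtain C where C: "\<forall>m\<in>I. \<forall>p\<in>K. norm (iter_deriv vs (F m) p) \<le> C * real m powi (- int N)"
    using K assms(2) unfolding negligible_on_def by blast
  obtain C' where C': "\<forall>m\<in>I. \<forall>p\<in>K. norm (iter_deriv vs (G m) p) \<le> C' * real m powi (- int N)"
    using K assms(3) unfolding negligible_on_def by blast
  have "iter_deriv vs (\<lambda>p. F m p + G m p) p = iter_deriv vs (F m) p + iter_deriv vs (G m) p"
    if "m \<in> I" "p \<in> K" for m p
    using that K assms by (intro iter_deriv_add[OF assms(1)]) (auto simp: negligible_on_def)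
  then have "norm (iter_deriv vs (\<lambda>p. F m p + G m p) p) \<le> (C + C') * real m powi (- int N)"
    if "m \<in> I" "p \<in> K" for m p
    using that C C' norm_triangle_ineq[of "iter_deriv vs (F m) p" "iter_deriv vs (G m) p"]
    by (fastforce simp: distrib_right)
  then show "\<exists>C. \<forall>m\<in>I. \<forall>p\<in>K. norm (iter_deriv vs (\<lambda>p. F m p + G m p) p) \<le> C * real m powi (- int N)"
    by blast
qed

lemma negligible_on_sum:
  assumes "open W" "finite Q" "\<And>q. q \<in> Q \<Longrightarrow> negligible_on I W (F q)"
  shows "negligible_on I W (\<lambda>m p. \<Sum>q\<in>Q. F q m p)"
  using assms(2,3)
proof (induction Q)
  case empty
  then show ?case by (auto simp: negligible_on_def smooth_on_const iter_deriv_const intro!: exI[of _ 0])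
next
  case (insert q Q)
  then show ?case by (simp add: negligible_on_add[OF assms(1)])
qed

lemma negligible_on_subset: "negligible_on I W F \<Longrightarrow> J \<subseteq> I \<Longrightarrow> negligible_on J W F"
  unfolding negligible_on_def by (meson subsetD)

text \<open>Derivatives along the slice are derivatives of the full family in directions
  \<open>(b, 0)\<close>, again basis vectors, and \<open>K \<times> {c}\<close> is compact. This
  carries the kernel relation on \<open>D \<times> D\<close> to a fixed second point.\<close>

lemma negligible_on_section:
  fixes F :: "nat \<Rightarrow> 'e::euclidean_space \<times> 'f::euclidean_space \<Rightarrow> complex"
  assumes W: "open W" "open V" "c \<in> V" and F: "negligible_on I (W \<times> V) F"
  shows "negligible_on I W (\<lambda>m p. F m (p, c))"
  unfolding negligible_on_def
proof (intro conjI ballI allI impI)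
  let ?L = "\<lambda>p::'e. (p, 0::'f)"
  have L: "bounded_linear ?L" by (intro bounded_linear_Pair bounded_linear_ident bounded_linear_zero)
  have op: "open (W \<times> V)" using W by (simp add: open_Times)
  have s: "smooth_on (W \<times> V) (F m)" if "m \<in> I" for m using F that by (auto simp: negligible_on_def)
  have inV: "?L p + (0, c) \<in> W \<times> V" if "p \<in> W" for p using that W by auto
  {
    fix m assume "m \<in> I"
    then show "smooth_on W (\<lambda>p. F m (p, c))"
      using smooth_on_affine[OF op s W(1) inV L] by simp
  }
  fix K vs N assume K: "compact K \<and> K \<subseteq> W \<and> set vs \<subseteq> (Basis :: 'e set)"
  have "compact (K \<times> {c}) \<and> K \<times> {c} \<subseteq> W \<times> V \<and> set (map ?L vs) \<subseteq> Basis"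
    using K W(3) by (auto simp: compact_Times Basis_prod_def)
  then obtain C where C: "\<forall>m\<in>I. \<forall>q\<in>K \<times> {c}. norm (iter_deriv (map ?L vs) (F m) q) \<le> C * real m powi (- int N)"
    using F unfolding negligible_on_def by (metis (no_types, lifting))
  have "iter_deriv vs (\<lambda>p. F m (p, c)) p = iter_deriv (map ?L vs) (F m) (p, c)" if "m \<in> I" "p \<in> K" for m p
    using iter_deriv_affine[OF op s W(1) inV L, of m p vs] that K by auto
  then show "\<exists>C. \<forall>m\<in>I. \<forall>p\<in>K. norm (iter_deriv vs (\<lambda>p. F m (p, c)) p) \<le> C * real m powi (- int N)"
    using C by auto
qed

section \<open>Oscillating exponentials and their decay\<close>

lemma has_derivative_complex_exp:
  fixes f :: "'e::real_normed_vector \<Rightarrow> complex"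
  assumes "(f has_derivative f') (at q)"
  shows "((\<lambda>p. exp (f p)) has_derivative (\<lambda>v. exp (f q) * f' v)) (at q)"
  using has_derivative_compose[OF assms has_field_derivative_imp_has_derivative[OF DERIV_exp]] by simp

text \<open>One derivative replaces the amplitude a by i m (\<partial>\<psi>) a + \<partial>a, which
  is again moderate, and leaves the exponential in front. The order of quantifiers matters: a single
  family \<open>a'\<close> serves all \<open>m\<close>, so its growth is uniform.\<close>

lemma iter_deriv_oscillation:
  fixes \<psi> :: "'e::euclidean_space \<Rightarrow> complex"
  assumes W: "open W" and psi: "smooth_on W \<psi>" and a: "moderate W a" and vs: "set vs \<subseteq> Basis"
  shows "\<exists>a'. moderate W a' \<and> (\<forall>m\<ge>1. \<forall>p\<in>W.
    iter_deriv vs (\<lambda>p. exp (\<i> * of_nat m * \<psi> p) * a m p) p = exp (\<i> * of_nat m * \<psi> p) * a' m p)"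
  using vs a
proof (induction vs arbitrary: a rule: rev_induct)
  case (snoc v vs)
  have v: "v \<in> Basis" using snoc.prems by simp
  let ?a = "\<lambda>m p. (\<i> * of_nat m) * (dderiv \<psi> v p * a m p) + dderiv (a m) v p"
  have sc: "moderate W (\<lambda>m p. \<i> * of_nat m)"
    by (rule moderate_scalar[where C = 1 and r = 1]) (simp add: norm_mult)
  have "moderate W ?a"
    by (intro moderate_add[OF W] moderate_mult[OF W] sc moderate_smooth[OF W] smooth_on_dderiv[OF W psi]
        moderate_dderiv[OF W _ v] snoc.prems)
  from snoc.IH[OF _ this] obtain a' where a': "moderate W a'"
    "\<And>m p. m \<ge> 1 \<Longrightarrow> p \<in> W \<Longrightarrow> iter_deriv vs (\<lambda>p. exp (\<i> * of_nat m * \<psi> p) * ?a m p) p = exp (\<i> * of_nat m * \<psi> p) * a' m p"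
    using snoc.prems by auto
  have "iter_deriv (vs @ [v]) (\<lambda>p. exp (\<i> * of_nat m * \<psi> p) * a m p) p = exp (\<i> * of_nat m * \<psi> p) * a' m p"
    if m: "m \<ge> 1" and p: "p \<in> W" for m p
  proof -
    have D: "dderiv (\<lambda>p. exp (\<i> * of_nat m * \<psi> p) * a m p) v q = exp (\<i> * of_nat m * \<psi> q) * ?a m q"
      if q: "q \<in> W" for q
    proof -
      have d: "(\<psi> has_derivative frechet_derivative \<psi> (at q)) (at q)"
        "(a m has_derivative frechet_derivative (a m) (at q)) (at q)"
        using smooth_on_differentiable[OF psi W q] smooth_on_differentiable[OF moderateD(1)[OF snoc.prems(2) m] W q]
        by (simp_all add: frechet_derivative_works)
      have "((\<lambda>p. exp (\<i> * of_nat m * \<psi> p) * a m p) has_derivative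
          (\<lambda>v. exp (\<i> * of_nat m * \<psi> q) * ((\<i> * of_nat m) * (dderiv \<psi> v q * a m q) + dderiv (a m) v q))) (at q)"
        by (rule derivative_eq_intros has_derivative_complex_exp d refl ext | simp add: algebra_simps)+
      then show ?thesis by (simp only: dderiv_eq)
    qed
    show ?thesis
      using iter_deriv_cong_open[where vs = vs, OF W D p] a'(2)[OF m p] by (simp add: iter_deriv_append)
  qed
  then show ?case using a'(1) by blast
qed auto

text \<open>The quotient x^(r + N) / exp x tends to 0. At x = c m, r of the powers absorb the given
  growth and the other N remain as decay.\<close>

lemma exp_decay_bound:
  fixes c :: real
  assumes "c > 0"
  shows "\<exists>C. \<forall>m\<ge>1. exp (- (c * real m)) * real m ^ r \<le> C * real m powi (- int N)"
proof -
  have "((\<lambda>x. x ^ (r + N) / exp x) \<longlongrightarrow> 0) (at_top :: real filter)"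
    by (rule tendsto_power_div_exp_0)
  moreover have "filterlim (\<lambda>m. c * real m) at_top sequentially"
    using assms by (intro filterlim_tendsto_pos_mult_at_top[OF tendsto_const] filterlim_real_sequentially)
  ultimately have "(\<lambda>m. (c * real m) ^ (r + N) / exp (c * real m)) \<longlonglongrightarrow> 0"
    by (rule filterlim_compose)
  then have "Bseq (\<lambda>m. (c * real m) ^ (r + N) / exp (c * real m))"
    by (intro convergent_imp_Bseq) (auto simp: convergent_def)
  then obtain C where C: "\<And>m. norm ((c * real m) ^ (r + N) / exp (c * real m)) \<le> C"
    by (auto simp: Bseq_def)
  have "exp (- (c * real m)) * real m ^ r \<le> C / c ^ (r + N) * real m powi (- int N)" if "m \<ge> 1" for m
  proof -
    have "(c * real m) ^ (r + N) / exp (c * real m) \<le> C"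
      using C[of m] by (simp only: real_norm_def abs_le_iff)
    then have "real m ^ (r + N) * exp (- (c * real m)) \<le> C / c ^ (r + N)"
      using assms by (simp add: field_simps exp_minus power_mult_distrib)
    then have "real m ^ r * exp (- (c * real m)) * real m ^ N \<le> C / c ^ (r + N)"
      by (simp add: power_add mult_ac)
    then have "real m ^ r * exp (- (c * real m)) \<le> C / c ^ (r + N) / real m ^ N"
      using that by (subst pos_le_divide_eq) auto
    then show ?thesis by (simp add: power_int_minus field_simps)
  qed
  then show ?thesis by blast
qed

text \<open>The modulus of the exponential is exp(- m Im \<psi>). On a compact set Im \<psi> has a
  positive lower bound, which beats the polynomial growth of the amplitude of every
  derivative.\<close>

lemma negligible_on_oscillation:
  fixes \<psi> :: "'e::euclidean_space \<Rightarrow> complex"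
  assumes W: "open W" and psi: "smooth_on W \<psi>" and a: "moderate W a"
    and pos: "\<And>K. compact K \<Longrightarrow> K \<subseteq> W \<Longrightarrow> \<exists>c>0. \<forall>p\<in>K. c \<le> Im (\<psi> p)"
  shows "negligible_on {1..} W (\<lambda>m p. exp (\<i> * of_nat m * \<psi> p) * a m p)"
  unfolding negligible_on_def
proof (intro conjI ballI allI impI)
  fix m :: nat assume m: "m \<in> {1..}"
  show "smooth_on W (\<lambda>p. exp (\<i> * of_nat m * \<psi> p) * a m p)"
    unfolding smooth_on_def
  proof (intro allI impI)
    fix vs :: "'e list" assume vs: "set vs \<subseteq> Basis"
    from iter_deriv_oscillation[OF W psi a vs] obtain a' where a': "moderate W a'"
      "\<And>p. p \<in> W \<Longrightarrow> iter_deriv vs (\<lambda>p. exp (\<i> * of_nat m * \<psi> p) * a m p) p = exp (\<i> * of_nat m * \<psi> p) * a' m p"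
      using m by auto
    have "((\<lambda>p. exp (\<i> * of_nat m * \<psi> p) * a' m p) has_derivative
        (\<lambda>v. exp (\<i> * of_nat m * \<psi> q) * dderiv (a' m) v q +
          (exp (\<i> * of_nat m * \<psi> q) * (\<i> * of_nat m * dderiv \<psi> v q)) * a' m q)) (at q)" if q: "q \<in> W" for q
    proof -
      have d: "(\<psi> has_derivative frechet_derivative \<psi> (at q)) (at q)"
        "(a' m has_derivative frechet_derivative (a' m) (at q)) (at q)"
        using smooth_on_differentiable[OF psi W q] smooth_on_differentiable[OF moderateD(1)[OF a'(1)] W q] m
        by (simp_all add: frechet_derivative_works)
      show ?thesis
        by (rule derivative_eq_intros has_derivative_complex_exp d refl ext | simp add: algebra_simps)+
    qed
    from differentiable_on_openI[OF W this]
    have "(\<lambda>p. exp (\<i> * of_nat m * \<psi> p) * a' m p) differentiable_on W" .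
    then show "iter_deriv vs (\<lambda>p. exp (\<i> * of_nat m * \<psi> p) * a m p) differentiable_on W"
      by (rule differentiable_on_cong_open[OF W, rotated]) (simp add: a'(2))
  qed
next
  fix K vs N assume K: "compact K \<and> K \<subseteq> W \<and> set vs \<subseteq> (Basis :: 'e set)"
  then obtain a' where a': "moderate W a'"
    "\<And>m p. m \<ge> 1 \<Longrightarrow> p \<in> W \<Longrightarrow> iter_deriv vs (\<lambda>p. exp (\<i> * of_nat m * \<psi> p) * a m p) p = exp (\<i> * of_nat m * \<psi> p) * a' m p"
    using iter_deriv_oscillation[OF W psi a] by blast
  obtain C r where C: "\<And>m p. m \<ge> 1 \<Longrightarrow> p \<in> K \<Longrightarrow> norm (a' m p) \<le> C * real m ^ r"
    using moderateD(2)[OF a'(1), of K "[]"] K by (auto simp: poly_bounded_def)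
  obtain c where c: "c > 0" "\<And>p. p \<in> K \<Longrightarrow> c \<le> Im (\<psi> p)" using pos[of K] K by auto
  obtain C' where C': "\<And>m::nat. m \<ge> 1 \<Longrightarrow> exp (- (c * real m)) * real m ^ r \<le> C' * real m powi (- int N)"
    using exp_decay_bound[OF c(1)] by blast
  have "norm (iter_deriv vs (\<lambda>p. exp (\<i> * of_nat m * \<psi> p) * a m p) p) \<le> \<bar>C\<bar> * C' * real m powi (- int N)"
    if m: "m \<ge> 1" and p: "p \<in> K" for m p
  proof -
    have "norm (exp (\<i> * of_nat m * \<psi> p)) \<le> exp (- (c * real m))"
      using mult_right_mono[OF c(2)[OF p], of "real m"] by (simp add: norm_exp_eq_Re mult_ac)
    moreover have "norm (a' m p) \<le> \<bar>C\<bar> * real m ^ r"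
      by (rule order_trans[OF C[OF m p]]) (simp add: mult_right_mono)
    ultimately have "norm (exp (\<i> * of_nat m * \<psi> p)) * norm (a' m p) \<le> exp (- (c * real m)) * (\<bar>C\<bar> * real m ^ r)"
      by (intro mult_mono) auto
    also have "\<dots> = \<bar>C\<bar> * (exp (- (c * real m)) * real m ^ r)" by simp
    also have "\<dots> \<le> \<bar>C\<bar> * (C' * real m powi (- int N))" by (intro mult_left_mono C' m) simp
    finally show ?thesis using a'(2)[OF m] p K by (auto simp: norm_mult mult_ac)
  qed
  then show "\<exists>C. \<forall>m\<in>{1..}. \<forall>p\<in>K. norm (iter_deriv vs (\<lambda>p. exp (\<i> * of_nat m * \<psi> p) * a m p) p) \<le> C * real m powi (- int N)"
    by (intro exI[of _ "\<bar>C\<bar> * C'"]) simp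
qed

section \<open>Circle orbits in charts\<close>

lemma chart_inv_into:
  assumes "is_chart (U, \<kappa>)"
  shows "x \<in> U \<Longrightarrow> inv_into U \<kappa> (\<kappa> x) = x" "p \<in> \<kappa> ` U \<Longrightarrow> \<kappa> (inv_into U \<kappa> p) = p"
    "p \<in> \<kappa> ` U \<Longrightarrow> inv_into U \<kappa> p \<in> U"
  using assms by (auto simp: is_chart_def homeomorphism_def inv_into_into f_inv_into_f)

lemma atlas_chart_at:
  assumes "smooth_atlas A"
  obtains V \<mu> where "(V, \<mu>) \<in> A" "x \<in> V"
proof -
  have "x \<in> (\<Union>(V, \<mu>)\<in>A. V)" using assms by (simp add: smooth_atlas_def)
  then show ?thesis using that by auto
qed

lemma chart_open_image:
  assumes "is_chart (U, \<kappa>)" "open V"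
  shows "open (\<kappa> ` (U \<inter> V))"
proof -
  have "continuous_on (\<kappa> ` U) (inv_into U \<kappa>)" "open (\<kappa> ` U)"
    using assms by (auto simp: is_chart_def homeomorphism_def)
  then have "open (\<kappa> ` U \<inter> inv_into U \<kappa> -` V)"
    using assms(2) continuous_open_preimage by blast
  moreover have "\<kappa> ` (U \<inter> V) = \<kappa> ` U \<inter> inv_into U \<kappa> -` V"
    using chart_inv_into[OF assms(1)] by (auto intro!: image_eqI)
  ultimately show ?thesis by simp
qed

lemma smooth_on_Un:
  assumes "open V" "open W" "smooth_on V f" "smooth_on W f"
  shows "smooth_on (V \<union> W) f"
  using assms unfolding smooth_on_def
  by (auto simp: differentiable_on_eq_differentiable_at open_Un)

text \<open>The manifold is the union of \<open>U\<close> and the complement of the preimage of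
  \<open>K\<close>. The preimage is compact, hence closed in a Hausdorff space, so both pieces are
  open; on the second one the function is 0.\<close>

lemma smooth_fun_extend_zero:
  fixes A :: "('x::t2_space, 'e::euclidean_space) chart set"
  assumes A: "smooth_atlas A" and c: "is_chart (U, \<kappa>)" "\<forall>c\<in>A. compatible (U, \<kappa>) c"
    and F: "smooth_on UNIV F" and K: "compact K" "K \<subseteq> \<kappa> ` U" "\<And>p. p \<notin> K \<Longrightarrow> F p = 0"
  shows "smooth_fun A (\<lambda>x. if x \<in> U then F (\<kappa> x) else 0)" (is "smooth_fun A ?f")
  unfolding smooth_fun_on_def
proof safe
  fix V :: "'x set" and \<mu> :: "'x \<Rightarrow> 'e" assume V: "(V, \<mu>) \<in> A"
  have cV: "is_chart (V, \<mu>)" using A V by (auto simp: smooth_atlas_def)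
  have "compatible (U, \<kappa>) (V, \<mu>)" using c V by auto
  then have tr: "smooth_on (\<mu> ` (V \<inter> U)) (\<lambda>p. \<kappa> (inv_into V \<mu> p))"
    by (simp add: compatible_def Int_commute)
  have oU: "open U" using c by (simp add: is_chart_def)
  let ?K = "inv_into U \<kappa> ` K"
  have "continuous_on K (inv_into U \<kappa>)"
    using c K by (auto simp: is_chart_def homeomorphism_def intro: continuous_on_subset)
  then have "closed ?K" using K by (intro compact_imp_closed compact_continuous_image)
  then have oK: "open (- ?K)" by auto
  have o: "open (\<mu> ` (V \<inter> U))" "open (\<mu> ` (V \<inter> - ?K))"
    using chart_open_image[OF cV] oU oK by auto
  have "smooth_on (\<mu> ` (V \<inter> U)) (\<lambda>p. F (\<kappa> (inv_into V \<mu> p)))"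
    by (rule smooth_on_compose[OF o(1) open_UNIV _ F tr]) auto
  then have 1: "smooth_on (\<mu> ` (V \<inter> U)) (\<lambda>p. ?f (inv_into V \<mu> p))"
    by (rule smooth_on_cong[OF o(1), rotated]) (auto simp: chart_inv_into[OF cV])
  have "?f (inv_into V \<mu> p) = 0" if "p \<in> \<mu> ` (V \<inter> - ?K)" for p
  proof -
    obtain y where y: "y \<in> V" "y \<notin> ?K" "p = \<mu> y" using \<open>p \<in> _\<close> by auto
    have "F (\<kappa> y) = 0" if "y \<in> U"
      using K(3)[of "\<kappa> y"] y(2) chart_inv_into(1)[OF c(1) that] by (metis image_eqI)
    then show ?thesis using y chart_inv_into[OF cV] by simp
  qed
  then have 2: "smooth_on (\<mu> ` (V \<inter> - ?K)) (\<lambda>p. ?f (inv_into V \<mu> p))"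
    by (intro smooth_on_cong[OF o(2) _ smooth_on_const[of _ 0]]) simp
  have "\<mu> ` (V \<inter> UNIV) = \<mu> ` (V \<inter> U) \<union> \<mu> ` (V \<inter> - ?K)"
  proof -
    have "V = (V \<inter> U) \<union> (V \<inter> - ?K)" using K(2) chart_inv_into(3)[OF c(1)] by blast
    then show ?thesis by (metis Int_UNIV_right image_Un)
  qed
  then show "smooth_on (\<mu> ` (V \<inter> UNIV)) (\<lambda>p. ?f (inv_into V \<mu> p))"
    using smooth_on_Un[OF o 1 2] by simp
qed

text \<open>Rescaling two given test functions produces a bump at any point of the product space.\<close>

lemma exists_bump:
  fixes \<rho> :: "'e::euclidean_space \<Rightarrow> complex" and \<eta> :: "'f::euclidean_space \<Rightarrow> complex"
  assumes "test_function W \<rho>" "\<rho> a \<noteq> 0" "test_function W' \<eta>" "\<eta> b \<noteq> 0" "open V"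
    and p\<^sub>0: "(p\<^sub>0 :: 'e \<times> 'f) \<in> V"
  shows "\<exists>F K. smooth_on UNIV F \<and> compact K \<and> K \<subseteq> V \<and> (\<forall>p. p \<notin> K \<longrightarrow> F p = 0) \<and> F p\<^sub>0 \<noteq> (0::complex)"
proof -
  obtain K1 K2 where K: "compact K1" "\<And>z. z \<notin> K1 \<Longrightarrow> \<rho> z = 0" "compact K2" "\<And>s. s \<notin> K2 \<Longrightarrow> \<eta> s = 0"
    using assms(1,3) unfolding test_function_def by metis
  have sm: "smooth_on UNIV \<rho>" "smooth_on UNIV \<eta>" using assms by (auto simp: test_function_def)
  obtain R1 R2 where R: "\<And>z. z \<in> K1 \<Longrightarrow> norm z \<le> R1" "\<And>s. s \<in> K2 \<Longrightarrow> norm s \<le> R2"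
    using K compact_imp_bounded bounded_iff by metis
  obtain r where r: "r > 0" "cball p\<^sub>0 r \<subseteq> V" using assms(5) p\<^sub>0 open_contains_cball by blast
  \<comment> \<open>The supports shrink by the factor \<open>l\<close>. A point of the first support
    is within \<open>\<bar>R1\<bar> + norm a\<close> of \<open>a\<close>, and likewise for the
    second, so after scaling both lie within \<open>r / 2\<close> of the base point; the summand 1
    makes \<open>l\<close> positive.\<close>
  define l where "l = 2 * (\<bar>R1\<bar> + \<bar>R2\<bar> + norm a + norm b + 1) / r"
  have l: "l > 0" using r by (simp add: l_def add_nonneg_pos)
  have lr: "\<bar>R1\<bar> + norm a \<le> l * (r / 2)" "\<bar>R2\<bar> + norm b \<le> l * (r / 2)"
    using r by (simp_all add: l_def)
  \<comment> \<open>The shifts send \<open>p\<^sub>0\<close> to \<open>(a, b)\<close>, where both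
    profiles are nonzero.\<close>
  define F where "F p = \<rho> (l *\<^sub>R fst p + (a - l *\<^sub>R fst p\<^sub>0)) * \<eta> (l *\<^sub>R snd p + (b - l *\<^sub>R snd p\<^sub>0))" for p
  have bl: "bounded_linear (\<lambda>p::'e \<times> 'f. l *\<^sub>R fst p)" "bounded_linear (\<lambda>p::'e \<times> 'f. l *\<^sub>R snd p)"
    by (intro bounded_linear_scaleR_right[THEN bounded_linear_compose] bounded_linear_fst bounded_linear_snd)+
  have "smooth_on UNIV F"
    unfolding F_def
    by (intro smooth_on_mult open_UNIV smooth_on_affine[OF open_UNIV sm(1)] smooth_on_affine[OF open_UNIV sm(2)] bl UNIV_I)
  moreover have "F p = 0" if "p \<notin> cball p\<^sub>0 r" for p
  proof (rule ccontr)
    assume "F p \<noteq> 0"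
    then have k: "l *\<^sub>R fst p + (a - l *\<^sub>R fst p\<^sub>0) \<in> K1" "l *\<^sub>R snd p + (b - l *\<^sub>R snd p\<^sub>0) \<in> K2"
      using K by (auto simp: F_def)
    have "norm (l *\<^sub>R (fst p - fst p\<^sub>0)) \<le> \<bar>R1\<bar> + norm a"
      using R(1)[OF k(1)] norm_triangle_ineq4[of "l *\<^sub>R fst p + (a - l *\<^sub>R fst p\<^sub>0)" a]
      by (simp add: algebra_simps)
    then have "l * norm (fst p - fst p\<^sub>0) \<le> l * (r / 2)"
      using l by (intro order_trans[OF _ lr(1)]) simp
    then have 1: "norm (fst p - fst p\<^sub>0) \<le> r / 2" using mult_left_le_imp_le l by blast
    have "norm (l *\<^sub>R (snd p - snd p\<^sub>0)) \<le> \<bar>R2\<bar> + norm b"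
      using R(2)[OF k(2)] norm_triangle_ineq4[of "l *\<^sub>R snd p + (b - l *\<^sub>R snd p\<^sub>0)" b]
      by (simp add: algebra_simps)
    then have "l * norm (snd p - snd p\<^sub>0) \<le> l * (r / 2)"
      using l by (intro order_trans[OF _ lr(2)]) simp
    then have 2: "norm (snd p - snd p\<^sub>0) \<le> r / 2" using mult_left_le_imp_le l by blast
    have "norm (p - p\<^sub>0) \<le> norm (fst (p - p\<^sub>0)) + norm (snd (p - p\<^sub>0))"
      unfolding norm_prod_def by (rule sqrt_sum_squares_le_sum) auto
    then have "dist p\<^sub>0 p \<le> r" using 1 2 by (simp add: dist_norm norm_minus_commute)
    then show False using that by simp
  qed
  moreover have "F p\<^sub>0 \<noteq> 0" using assms(2,4) by (simp add: F_def)
  ultimately show ?thesis using r(2) compact_cball by blast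
qed

section \<open>Orbits as curves in charts\<close>

lemma act_cis_add:
  "circle_action A act \<Longrightarrow> act (cis (s + t)) x = act (cis s) (act (cis t) x)"
  unfolding circle_action_def cis_mult[symmetric] by (metis norm_cis)

lemma continuous_on_orbit:
  fixes A :: "('x::topological_space, 'e::euclidean_space) chart set"
  assumes "circle_action A act"
  shows "continuous_on UNIV (\<lambda>t. act (cis t) x)"
proof -
  have "continuous_on (sphere 0 1 \<times> UNIV) (\<lambda>(a, x). act a x)"
    using assms by (simp add: circle_action_def)
  moreover have "continuous_on UNIV (\<lambda>t. (cis t, x))"
    by (intro continuous_on_Pair continuous_on_const continuous_on_cis continuous_on_id)
  ultimately have "continuous_on UNIV (\<lambda>t. (\<lambda>(a, x). act a x) (cis t, x))"
    by (rule continuous_on_compose2) auto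
  then show ?thesis by simp
qed

lemma open_orbit_times:
  fixes A :: "('x::topological_space, 'e::euclidean_space) chart set"
  assumes "circle_action A act" "open V"
  shows "open {t. act (cis t) x \<in> V}"
proof -
  have "open ((\<lambda>t. act (cis t) x) -` V)"
    by (rule open_vimage[OF assms(2) continuous_on_orbit[OF assms(1)]])
  then show ?thesis by (simp add: vimage_def)
qed

text \<open>Differentiability of the action within the set of admissible pairs (t, p) restricts to
  the line p = \<open>\<mu>0 x\<close>. Along that line the admissible times form an open set, so
  the derivative within it is a full derivative.\<close>

lemma orbit_differentiable:
  fixes A :: "('x::topological_space, 'e::euclidean_space) chart set"
  assumes A: "smooth_atlas A" and act: "circle_action A act" and V: "(V, \<mu>) \<in> A" "act (cis \<theta>) x \<in> V"
    and F: "(\<lambda>p. F (inv_into V \<mu> p)) differentiable (at (\<mu> (act (cis \<theta>) x)))"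
  shows "(\<lambda>t. F (act (cis t) x)) differentiable (at \<theta>)"
proof -
  obtain V0 \<mu>0 where V0: "(V0, \<mu>0) \<in> A" "x \<in> V0" by (rule atlas_chart_at[OF A])
  have cV: "is_chart (V, \<mu>)" and cV0: "is_chart (V0, \<mu>0)" using A V V0 by (auto simp: smooth_atlas_def)
  have oV: "open V" using cV by (simp add: is_chart_def)
  let ?O = "{t. act (cis t) x \<in> V}" and ?S = "{(t::real, p). p \<in> \<mu>0 ` V0 \<and> act (cis t) (inv_into V0 \<mu>0 p) \<in> V}"
  let ?G = "\<lambda>(t, p). \<mu> (act (cis t) (inv_into V0 \<mu>0 p))" and ?l = "\<lambda>t. (t, \<mu>0 x)"
  have inv: "inv_into V0 \<mu>0 (\<mu>0 x) = x" using chart_inv_into(1)[OF cV0 V0(2)] .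
  have oO: "open ?O" by (rule open_orbit_times[OF act oV])
  have "smooth_on ?S ?G" using act V(1) V0(1) unfolding circle_action_def by blast
  then have "?G differentiable_on ?S" 
    unfolding smooth_on_def by (elim allE[of _ "[]"]) simp
  then have "?G differentiable_on (?l ` ?O)"
    by (rule differentiable_on_subset) (use V0(2) inv in auto)
  then have "?G differentiable (at (?l \<theta>) within ?l ` ?O)"
    using V(2) unfolding differentiable_on_def by simp
  moreover have "?l differentiable (at \<theta> within ?O)"
    by (intro differentiable_Pair differentiable_ident differentiable_const)
  ultimately have "(?G \<circ> ?l) differentiable (at \<theta> within ?O)"
    by (rule differentiable_chain_within[rotated])
  then have mu: "(\<lambda>t. \<mu> (act (cis t) x)) differentiable (at \<theta>)"
    using at_within_open[OF _ oO, of \<theta>] V(2) inv by (simp add: o_def)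
  have "(\<lambda>t. F (inv_into V \<mu> (\<mu> (act (cis t) x)))) differentiable (at \<theta>)"
    by (rule differentiable_compose[OF F mu])
  then obtain D where D: "((\<lambda>t. F (inv_into V \<mu> (\<mu> (act (cis t) x)))) has_derivative D) (at \<theta>)"
    by (auto simp: differentiable_def)
  have "((\<lambda>t. F (act (cis t) x)) has_derivative D) (at \<theta>)"
    by (rule has_derivative_transform_within_open[OF D oO]) (use V(2) chart_inv_into(1)[OF cV] in auto)
  then show ?thesis by (auto simp: differentiable_def)
qed

lemma orbit_smooth_fun_differentiable:
  fixes A :: "('x::topological_space, 'e::euclidean_space) chart set"
  assumes A: "smooth_atlas A" and act: "circle_action A act" and u: "smooth_fun A u"
  shows "(\<lambda>t. u (act (cis t) x)) differentiable (at \<theta>)"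
proof -
  obtain V \<mu> where V: "(V, \<mu>) \<in> A" "act (cis \<theta>) x \<in> V" by (rule atlas_chart_at[OF A])
  have "open (\<mu> ` V)" "smooth_on (\<mu> ` V) (\<lambda>p. u (inv_into V \<mu> p))"
    using A V u by (auto simp: smooth_atlas_def is_chart_def smooth_fun_on_def)
  then show ?thesis
    using V by (intro orbit_differentiable[OF A act V] smooth_on_differentiable) auto
qed

lemma orbit_chart_differentiable:
  fixes A :: "('x::topological_space, 'e::euclidean_space) chart set"
  assumes A: "smooth_atlas A" and act: "circle_action A act"
    and c: "is_chart (U, \<kappa>)" "\<forall>c\<in>A. compatible (U, \<kappa>) c" and U: "act (cis \<theta>) x \<in> U"
  shows "(\<lambda>t. \<kappa> (act (cis t) x)) differentiable (at \<theta>)"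
proof -
  obtain V \<mu> where V: "(V, \<mu>) \<in> A" "act (cis \<theta>) x \<in> V" by (rule atlas_chart_at[OF A])
  have "open (\<mu> ` (V \<inter> U))"
    using chart_open_image[of V \<mu> U] A V c by (auto simp: smooth_atlas_def is_chart_def)
  moreover have "compatible (U, \<kappa>) (V, \<mu>)" using c V by blast
  then have "smooth_on (\<mu> ` (V \<inter> U)) (\<lambda>p. \<kappa> (inv_into V \<mu> p))"
    by (simp add: compatible_def Int_commute)
  ultimately show ?thesis
    using V U by (intro orbit_differentiable[OF A act V] smooth_on_differentiable) auto
qed

text \<open>\<open>T_field\<close> differentiates at time 0 only; by the group law the derivative at
  time \<theta> is the one at time 0 for the orbit of \<open>act (cis \<theta>) x\<close>.\<close>

lemma T_field_orbit:
  fixes A :: "('x::topological_space, 'e::euclidean_space) chart set"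
  assumes A: "smooth_atlas A" and act: "circle_action A act" and u: "smooth_fun A u"
  shows "((\<lambda>t. u (act (cis t) x)) has_vector_derivative T_field A act (act (cis \<theta>) x) u) (at \<theta>)"
proof -
  let ?h = "\<lambda>t. u (act (cis t) x)"
  obtain D where D: "(?h has_vector_derivative D) (at \<theta>)"
    using orbit_smooth_fun_differentiable[OF A act u] vector_derivative_works by blast
  have "((\<lambda>s. s + \<theta>) has_vector_derivative 1) (at 0)"
    by (auto intro!: derivative_eq_intros)
  moreover have "(?h has_vector_derivative D) (at (0 + \<theta>))" using D by simp
  ultimately have "(?h \<circ> (\<lambda>s. s + \<theta>) has_vector_derivative 1 *\<^sub>R D) (at 0)"
    by (rule vector_diff_chain_at)
  then have "((\<lambda>s. u (act (cis s) (act (cis \<theta>) x))) has_vector_derivative D) (at 0)"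
    by (simp add: o_def act_cis_add[OF act])
  then have "T_field A act (act (cis \<theta>) x) u = D"
    using u by (simp add: T_field_def vector_derivative_at)
  then show ?thesis using D by simp
qed

text \<open>\<open>T_field\<close> and \<open>coord_vec\<close> agree as derivations on global
  functions, so the velocity \<open>v\<close> and the vector \<open>e\<close> can be compared only
  through functions supported in the chart. The bumps separate them.\<close>

lemma orbit_chart_velocity:
  fixes A :: "('x::t2_space, 'e::euclidean_space) chart set"
  assumes A: "smooth_atlas A" and act: "circle_action A act"
    and c: "is_chart (U, \<kappa>)" "\<forall>c\<in>A. compatible (U, \<kappa>) c"
    and T: "\<forall>x\<in>U. T_field A act x = coord_vec A (U, \<kappa>) e x"
    and bump: "\<And>p. p \<in> \<kappa> ` U \<Longrightarrow> \<exists>F K. smooth_on UNIV F \<and> compact K \<and> K \<subseteq> \<kappa> ` U \<and>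
        (\<forall>p. p \<notin> K \<longrightarrow> F p = 0) \<and> F p \<noteq> (0::complex)"
    and U: "act (cis \<theta>) x \<in> U"
  shows "((\<lambda>t. \<kappa> (act (cis t) x)) has_vector_derivative e) (at \<theta>)"
proof -
  let ?y = "act (cis \<theta>) x"
  let ?p = "\<kappa> ?y"
  have oU: "open U" and oK: "open (\<kappa> ` U)" using c by (auto simp: is_chart_def)
  obtain v where v: "((\<lambda>t. \<kappa> (act (cis t) x)) has_vector_derivative v) (at \<theta>)"
    using orbit_chart_differentiable[OF A act c U] vector_derivative_works by blast
  have eq: "frechet_derivative F (at ?p) v = frechet_derivative F (at ?p) e"
    if F: "smooth_on UNIV F" and K: "compact K" "K \<subseteq> \<kappa> ` U" "\<And>p. p \<notin> K \<Longrightarrow> F p = 0" for F :: "'e \<Rightarrow> complex" and K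
  proof -
    let ?f = "\<lambda>x. if x \<in> U then F (\<kappa> x) else 0"
    have f: "smooth_fun A ?f" by (rule smooth_fun_extend_zero[OF A c F K])
    have "T_field A act ?y ?f = frechet_derivative (\<lambda>p. ?f (inv_into U \<kappa> p)) (at ?p) e"
      using T U f by (simp add: coord_vec_def)
    also have "frechet_derivative (\<lambda>p. ?f (inv_into U \<kappa> p)) (at ?p) = frechet_derivative F (at ?p)"
      by (rule frechet_derivative_cong_open[OF oK]) (use U chart_inv_into[OF c(1)] in auto)
    finally have "((\<lambda>t. ?f (act (cis t) x)) has_vector_derivative frechet_derivative F (at ?p) e) (at \<theta>)"
      using T_field_orbit[OF A act f, of x \<theta>] by simp
    then have 1: "((\<lambda>t. F (\<kappa> (act (cis t) x))) has_vector_derivative frechet_derivative F (at ?p) e) (at \<theta>)"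
      by (rule has_vector_derivative_transform_within_open[OF _ open_orbit_times[OF act oU]]) (use U in auto)
    have Fd: "(F has_derivative frechet_derivative F (at ?p)) (at ?p)"
      using smooth_on_differentiable[OF F open_UNIV] frechet_derivative_works by blast
    have "((\<lambda>t. F (\<kappa> (act (cis t) x))) has_derivative (\<lambda>t. frechet_derivative F (at ?p) (t *\<^sub>R v))) (at \<theta>)"
      by (rule has_derivative_compose[OF v[unfolded has_vector_derivative_def] Fd])
    moreover have "frechet_derivative F (at ?p) (t *\<^sub>R v) = t *\<^sub>R frechet_derivative F (at ?p) v" for t
      using has_derivative_linear[OF Fd] by (simp add: linear_scale)
    ultimately have "((\<lambda>t. F (\<kappa> (act (cis t) x))) has_vector_derivative frechet_derivative F (at ?p) v) (at \<theta>)"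
      by (simp add: has_vector_derivative_def)
    then show ?thesis using 1 vector_derivative_unique_at by metis
  qed
  obtain F :: "'e \<Rightarrow> complex" and K where F: "smooth_on UNIV F" "compact K" "K \<subseteq> \<kappa> ` U"
      "\<And>p. p \<notin> K \<Longrightarrow> F p = 0" "F ?p \<noteq> 0"
    using bump[OF imageI[OF U]] by (elim exE conjE) simp
  have Fd: "(F has_derivative frechet_derivative F (at ?p)) (at ?p)"
    by (rule iffD1[OF frechet_derivative_works smooth_on_differentiable[OF F(1) open_UNIV UNIV_I]])
  \<comment> \<open>Test with \<open>F\<close> times a coordinate. As \<open>F\<close> itself has
    equal derivatives along \<open>v\<close> and \<open>e\<close>, the product rule leaves
    \<open>F ?p\<close> times the difference of the components; a nonzero value of \<open>F\<close>
    at the point is enough.\<close>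
  have vb: "v \<bullet> b = e \<bullet> b" for b
  proof -
    let ?l = "\<lambda>p. complex_of_real (p \<bullet> b)"
    have bl: "bounded_linear ?l"
      by (intro bounded_linear_compose[OF bounded_linear_of_real] bounded_linear_inner_left)
    have "smooth_on UNIV (\<lambda>p. F p * ?l p)"
      by (intro smooth_on_mult open_UNIV F(1) smooth_on_bounded_linear bl)
    then have "frechet_derivative (\<lambda>p. F p * ?l p) (at ?p) v = frechet_derivative (\<lambda>p. F p * ?l p) (at ?p) e"
      by (rule eq) (use F in auto)
    moreover have "((\<lambda>p. F p * ?l p) has_derivative
        (\<lambda>v. F ?p * ?l v + frechet_derivative F (at ?p) v * ?l ?p)) (at ?p)"
      by (rule has_derivative_mult[OF Fd bounded_linear_imp_has_derivative[OF bl]])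
    ultimately have "F ?p * ?l v + frechet_derivative F (at ?p) v * ?l ?p
        = F ?p * ?l e + frechet_derivative F (at ?p) e * ?l ?p"
      by (simp only: dderiv_eq)
    then show ?thesis using eq[OF F(1-4)] F(5) by simp
  qed
  have "v = e" by (rule euclidean_eqI) (rule vb)
  then show ?thesis using v by simp
qed

text \<open>The orbit and the vertical line over \<open>w\<close> agree at a set of heights that
  contains \<open>s\<^sub>0\<close>, is open because the velocity is vertical of unit speed, and is
  relatively closed because the space is Hausdorff. By connectedness of the interval they agree
  throughout, so the orbit cannot leave \<open>U\<close> on the way.\<close>

lemma orbit_vertical:
  fixes A :: "('x::t2_space, 'n::finite model) chart set"
  assumes act: "circle_action A act" and c: "is_chart (U, \<kappa>)" and im: "\<kappa> ` U = patch \<epsilon> \<delta>"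
    and vel: "\<And>t. act (cis t) x \<in> U \<Longrightarrow> ((\<lambda>t. \<kappa> (act (cis t) x)) has_vector_derivative (0, 1)) (at t)"
    and U: "act (cis \<theta>) x \<in> U" "\<kappa> (act (cis \<theta>) x) = (w, s\<^sub>0)" and s: "\<bar>s\<bar> < \<delta>"
  shows "act (cis (\<theta> + (s - s\<^sub>0))) x \<in> U \<and> \<kappa> (act (cis (\<theta> + (s - s\<^sub>0))) x) = (w, s)"
proof -
  have oU: "open U" using c by (simp add: is_chart_def)
  have ws: "norm w < \<epsilon>" "\<bar>s\<^sub>0\<bar> < \<delta>"
    using U im by (auto simp: patch_def dest!: equalityD1 image_subset_iff[THEN iffD1])
  then have inP: "(w, t) \<in> \<kappa> ` U" if "\<bar>t\<bar> < \<delta>" for t using that im by (simp add: patch_def)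
  let ?J = "{-\<delta><..<\<delta>}"
  define \<gamma> where "\<gamma> t = act (cis (\<theta> + (t - s\<^sub>0))) x" for t
  define q where "q t = inv_into U \<kappa> (w, t)" for t
  have c\<gamma>: "continuous_on UNIV \<gamma>"
    unfolding \<gamma>_def by (rule continuous_on_compose2[OF continuous_on_orbit[OF act]]) (auto intro!: continuous_intros)
  have cq: "continuous_on ?J q"
    unfolding q_def
  proof (rule continuous_on_compose2[of "\<kappa> ` U" "inv_into U \<kappa>"])
    show "continuous_on (\<kappa> ` U) (inv_into U \<kappa>)" using c by (auto simp: is_chart_def homeomorphism_def)
    show "continuous_on ?J (Pair w)" by (intro continuous_intros)
    show "Pair w ` ?J \<subseteq> \<kappa> ` U" using inP by auto
  qed
  define E where "E = {t \<in> ?J. \<gamma> t = q t}"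
  have "open E"
  proof (subst open_contains_ball, intro ballI)
    fix t assume t: "t \<in> E"
    then have tU: "\<gamma> t \<in> U" "\<kappa> (\<gamma> t) = (w, t)"
      using inP[of t] chart_inv_into(2,3)[OF c] by (auto simp: E_def q_def)
    have "open (?J \<inter> \<gamma> -` U)" using open_vimage[OF oU c\<gamma>] by (intro open_Int) auto
    moreover have "t \<in> ?J \<inter> \<gamma> -` U" using t tU by (simp add: E_def)
    ultimately obtain r where r: "r > 0" "ball t r \<subseteq> ?J \<inter> \<gamma> -` U" by (rule openE)
    \<comment> \<open>Without its vertical motion the curve has zero velocity, so it is constant on
      the ball.\<close>
    have "((\<lambda>t. \<kappa> (\<gamma> t) - (0, t)) has_vector_derivative 0) (at t' within ball t r)" if "t' \<in> ball t r" for t'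
    proof -
      have "\<gamma> t' \<in> U" using r that by auto
      then have "((\<lambda>t. \<kappa> (act (cis t) x)) has_vector_derivative (0, 1)) (at (\<theta> + (t' - s\<^sub>0)))"
        by (intro vel) (simp add: \<gamma>_def)
      moreover have "((\<lambda>t. \<theta> + (t - s\<^sub>0)) has_vector_derivative 1) (at t')"
        by (auto intro!: derivative_eq_intros)
      ultimately have "((\<lambda>t. \<kappa> (act (cis t) x)) \<circ> (\<lambda>t. \<theta> + (t - s\<^sub>0)) has_vector_derivative 1 *\<^sub>R (0, 1)) (at t')"
        by (intro vector_diff_chain_at)
      then have "((\<lambda>t. \<kappa> (\<gamma> t)) has_vector_derivative (0, 1)) (at t')"
        by (simp add: o_def \<gamma>_def)
      moreover have "((\<lambda>t. (0, t)) has_vector_derivative (0, 1)) (at t')"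
        by (intro has_vector_derivative_Pair has_vector_derivative_const has_vector_derivative_id)
      ultimately have "((\<lambda>t. \<kappa> (\<gamma> t) - (0, t)) has_vector_derivative (0, 1) - (0, 1)) (at t')"
        by (rule has_vector_derivative_diff)
      then show ?thesis by (simp add: zero_prod_def has_vector_derivative_at_within)
    qed
    then obtain k where k: "\<And>t'. t' \<in> ball t r \<Longrightarrow> \<kappa> (\<gamma> t') - (0, t') = k"
      using has_vector_derivative_zero_constant[of "ball t r" "\<lambda>t. \<kappa> (\<gamma> t) - (0, t)"] by auto
    have "k = (w, 0)" using k[of t] tU r by simp
    then have "\<kappa> (\<gamma> t') = (w, t')" if "t' \<in> ball t r" for t'
      using k[OF that] by (simp add: diff_eq_eq)
    then have "\<gamma> t' = q t'" if "t' \<in> ball t r" for t'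
      using chart_inv_into(1)[OF c, of "\<gamma> t'"] that r unfolding q_def by auto
    then have "ball t r \<subseteq> E" using r by (auto simp: E_def)
    then show "\<exists>e>0. ball t e \<subseteq> E" using r by blast
  qed
  moreover have "open (?J - E)"
  proof (subst open_contains_ball, intro ballI)
    fix t assume t: "t \<in> ?J - E"
    then have "\<gamma> t \<noteq> q t" by (auto simp: E_def)
    then obtain V W where VW: "open V" "open W" "\<gamma> t \<in> V" "q t \<in> W" "V \<inter> W = {}"
      using hausdorff by metis
    have "open (?J \<inter> q -` W)" using continuous_open_preimage[OF cq _ VW(2)] by simp
    then have "open (\<gamma> -` V \<inter> (?J \<inter> q -` W))" using open_vimage[OF VW(1) c\<gamma>] by blast
    moreover have "t \<in> \<gamma> -` V \<inter> (?J \<inter> q -` W)" using t VW by auto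
    moreover have "\<gamma> -` V \<inter> (?J \<inter> q -` W) \<subseteq> ?J - E" using VW(5) by (auto simp: E_def)
    ultimately show "\<exists>e>0. ball t e \<subseteq> ?J - E" unfolding open_contains_ball by (meson subset_trans)
  qed
  moreover have "s\<^sub>0 \<in> E"
    using ws U chart_inv_into(1)[OF c U(1)] by (auto simp: E_def q_def \<gamma>_def abs_less_iff)
  ultimately have "(?J - E) \<inter> ?J = {}"
    using connectedD[OF connected_Ioo, of E "?J - E" "-\<delta>" \<delta>] ws by (auto simp: E_def)
  moreover have "s \<in> ?J" using s by (auto simp: abs_less_iff)
  ultimately have "s \<in> E" by blast
  then have "\<gamma> s = inv_into U \<kappa> (w, s)" by (simp add: E_def q_def)
  then show ?thesis
    using inP[OF s] chart_inv_into(2,3)[OF c] unfolding \<gamma>_def by auto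
qed

text \<open>A closed curve which meets a box only in full vertical segments of unit speed. The segments are
  indexed by the times at which their midpoints are reached.\<close>

locale vertical_orbit =
  fixes \<gamma> :: "real \<Rightarrow> 'x" and U :: "'x set" and \<kappa> :: "'x \<Rightarrow> 'w::zero \<times> real" and \<delta> :: real
  assumes periodic: "\<gamma> (t + 2 * pi) = \<gamma> t"
    and range: "\<gamma> t \<in> U \<Longrightarrow> \<bar>snd (\<kappa> (\<gamma> t))\<bar> < \<delta>"
    and vertical: "\<gamma> t \<in> U \<Longrightarrow> \<bar>s\<bar> < \<delta> \<Longrightarrow>
      \<gamma> (t + (s - snd (\<kappa> (\<gamma> t)))) \<in> U \<and> \<kappa> (\<gamma> (t + (s - snd (\<kappa> (\<gamma> t))))) = (fst (\<kappa> (\<gamma> t)), s)"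
    and base: "\<gamma> 0 \<in> U" "snd (\<kappa> (\<gamma> 0)) = 0"
begin

definition center :: "real \<Rightarrow> bool" where
  "center \<tau> \<longleftrightarrow> \<gamma> \<tau> \<in> U \<and> snd (\<kappa> (\<gamma> \<tau>)) = 0"

definition centers :: "real set" where
  "centers = {\<tau> \<in> {0..<2 * pi}. center \<tau>}"

lemma \<delta>_pos: "\<delta> > 0"
  using range[OF base(1)] by linarith

lemma center_segment:
  assumes "center \<tau>" "\<bar>t\<bar> < \<delta>"
  shows "\<gamma> (\<tau> + t) \<in> U" "\<kappa> (\<gamma> (\<tau> + t)) = (fst (\<kappa> (\<gamma> \<tau>)), t)"
  using vertical[of \<tau> t] assms by (auto simp: center_def)

lemma center_of:
  assumes "\<gamma> t \<in> U"
  shows "center (t - snd (\<kappa> (\<gamma> t)))" "fst (\<kappa> (\<gamma> (t - snd (\<kappa> (\<gamma> t))))) = fst (\<kappa> (\<gamma> t))"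
  using vertical[OF assms, of 0] \<delta>_pos by (auto simp: center_def)

text \<open>Otherwise the time halfway between the centers would lie on both segments, at height
  \<open>?t\<close> on one and \<open>- ?t\<close> on the other.\<close>

lemma center_separated:
  assumes "center \<tau>" "center \<tau>'" "\<bar>\<tau> - \<tau>'\<bar> < 2 * \<delta>"
  shows "\<tau> = \<tau>'"
proof -
  let ?t = "(\<tau>' - \<tau>) / 2"
  have "\<bar>?t\<bar> < \<delta>" "\<bar>- ?t\<bar> < \<delta>" using assms(3) by auto
  then have "\<kappa> (\<gamma> (\<tau> + ?t)) = (fst (\<kappa> (\<gamma> \<tau>)), ?t)" "\<kappa> (\<gamma> (\<tau>' + - ?t)) = (fst (\<kappa> (\<gamma> \<tau>')), - ?t)"
    using center_segment assms by blast+
  moreover have "\<tau> + ?t = \<tau>' + - ?t" by (simp add: field_simps)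
  ultimately have "?t = - ?t" by (metis snd_conv)
  then show ?thesis by simp
qed

lemma center_0: "center 0" and center_2pi: "center (2 * pi)"
  using base periodic[of 0] by (auto simp: center_def)

text \<open>By periodicity 2\<pi> is a center besides 0, and distinct centers are at least
  \<open>2 * \<delta>\<close> apart.\<close>

lemma \<delta>_le_pi: "\<delta> \<le> pi"
  using center_separated[OF center_0 center_2pi] pi_gt_zero by fastforce

text \<open>By separation, a cell [j \<delta>, (j + 1) \<delta>) contains at most one center, and
  finitely many cells meet a period.\<close>

lemma finite_centers: "finite centers"
proof (rule finite_imageD)
  show "finite ((\<lambda>\<tau>. \<lfloor>\<tau> / \<delta>\<rfloor>) ` centers)"
  proof (rule finite_subset)
    show "(\<lambda>\<tau>. \<lfloor>\<tau> / \<delta>\<rfloor>) ` centers \<subseteq> {0..\<lfloor>2 * pi / \<delta>\<rfloor>}"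
      using \<delta>_pos by (auto simp: centers_def intro!: floor_mono divide_right_mono)
  qed simp
  show "inj_on (\<lambda>\<tau>. \<lfloor>\<tau> / \<delta>\<rfloor>) centers"
  proof (rule inj_onI)
    fix \<tau> \<tau>' assume C: "\<tau> \<in> centers" "\<tau>' \<in> centers" and "\<lfloor>\<tau> / \<delta>\<rfloor> = \<lfloor>\<tau>' / \<delta>\<rfloor>"
    then have "\<bar>\<tau> / \<delta> - \<tau>' / \<delta>\<bar> < 1" by linarith
    then have "\<bar>\<tau> - \<tau>'\<bar> < \<delta>"
      using \<delta>_pos by (simp add: abs_less_iff field_simps)
    then show "\<tau> = \<tau>'" using C center_separated \<delta>_pos by (force simp: centers_def)
  qed
qed

text \<open>The integrand along the orbit. With s the height of \<open>\<gamma> t\<close>, the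
  factor exp(- i m s) of the phase and the character exp(i m t) combine to a function
  \<open>e\<close> of t - s, the center of the segment through \<open>\<gamma> t\<close>. So only
  \<open>\<eta>\<close> varies within a segment.\<close>

definition weight :: "('w \<Rightarrow> complex) \<Rightarrow> (real \<Rightarrow> complex) \<Rightarrow> (real \<Rightarrow> complex) \<Rightarrow> real \<Rightarrow> complex" where
  "weight g e \<eta> t = (if \<gamma> t \<in> U
     then g (fst (\<kappa> (\<gamma> t))) * e (t - snd (\<kappa> (\<gamma> t))) * \<eta> (snd (\<kappa> (\<gamma> t))) else 0)"

text \<open>The window begins where the segment around 0 begins and ends where the one around 2\<pi>
  begins. By separation no segment is cut, and those inside have their centers in [0,
  2\<pi>).\<close>

lemma weight_eq_sum:
  assumes t: "t \<in> {- \<delta>..2 * pi - \<delta>}" and \<eta>0: "\<And>s. \<bar>s\<bar> \<ge> \<delta> \<Longrightarrow> \<eta> s = 0"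
  shows "weight g e \<eta> t = (\<Sum>\<tau>\<in>centers. g (fst (\<kappa> (\<gamma> \<tau>))) * e \<tau> * \<eta> (t - \<tau>))"
proof (cases "\<gamma> t \<in> U")
  case False
  have "\<eta> (t - \<tau>) = 0" if "\<tau> \<in> centers" for \<tau>
    using \<eta>0 center_segment(1)[of \<tau> "t - \<tau>"] that False by (force simp: centers_def)
  then show ?thesis using False by (simp add: weight_def)
next
  case True
  define \<tau>\<^sub>0 where "\<tau>\<^sub>0 = t - snd (\<kappa> (\<gamma> t))"
  have c0: "center \<tau>\<^sub>0" "fst (\<kappa> (\<gamma> \<tau>\<^sub>0)) = fst (\<kappa> (\<gamma> t))" using center_of[OF True] by (auto simp: \<tau>\<^sub>0_def)
  have d: "\<bar>t - \<tau>\<^sub>0\<bar> < \<delta>" using range[OF True] by (simp add: \<tau>\<^sub>0_def)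
  have "\<tau>\<^sub>0 = 0 \<or> \<bar>\<tau>\<^sub>0 - 0\<bar> \<ge> 2 * \<delta>" using center_separated[OF c0(1) center_0] by linarith
  moreover have "\<tau>\<^sub>0 = 2 * pi \<or> \<bar>\<tau>\<^sub>0 - 2 * pi\<bar> \<ge> 2 * \<delta>" using center_separated[OF c0(1) center_2pi] by linarith
  ultimately have "0 \<le> \<tau>\<^sub>0 \<and> \<tau>\<^sub>0 < 2 * pi" using d t pi_gt_zero by auto
  then have in0: "\<tau>\<^sub>0 \<in> centers" using c0 by (simp add: centers_def)
  have "\<eta> (t - \<tau>) = 0" if "\<tau> \<in> centers - {\<tau>\<^sub>0}" for \<tau>
  proof -
    have "\<bar>\<tau> - \<tau>\<^sub>0\<bar> \<ge> 2 * \<delta>" using center_separated[OF _ c0(1), of \<tau>] that by (force simp: centers_def)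
    then show ?thesis using d by (intro \<eta>0) linarith
  qed
  then have "(\<Sum>\<tau>\<in>centers. g (fst (\<kappa> (\<gamma> \<tau>))) * e \<tau> * \<eta> (t - \<tau>)) = g (fst (\<kappa> (\<gamma> \<tau>\<^sub>0))) * e \<tau>\<^sub>0 * \<eta> (t - \<tau>\<^sub>0)"
    using sum.remove[OF finite_centers in0, of "\<lambda>\<tau>. g (fst (\<kappa> (\<gamma> \<tau>))) * e \<tau> * \<eta> (t - \<tau>)"] by simp
  then show ?thesis using True c0(2) by (simp add: weight_def \<tau>\<^sub>0_def)
qed

text \<open>Over the uncut window each segment contributes its constant times the integral of
  \<open>\<eta>\<close>. The part of the window beyond \<pi> is then moved back by a period, which
  turns the window into [-\<pi>, \<pi>].\<close>

lemma integral_weight: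
  assumes \<eta>0: "\<And>s. \<bar>s\<bar> \<ge> \<delta> \<Longrightarrow> \<eta> s = 0" and \<eta>1: "(\<eta> has_integral 1) UNIV" and e: "\<And>t. e (t + 2 * pi) = e t"
  shows "integral {-pi..pi} (weight g e \<eta>) = (\<Sum>\<tau>\<in>centers. g (fst (\<kappa> (\<gamma> \<tau>))) * e \<tau>)"
proof -
  let ?I = "\<Sum>\<tau>\<in>centers. g (fst (\<kappa> (\<gamma> \<tau>))) * e \<tau>" and ?G = "weight g e \<eta>"
  have \<eta>i: "(\<eta> has_integral 1) (cbox (- \<delta>) \<delta>)"
  proof -
    have "(\<lambda>s. if s \<in> cbox (- \<delta>) \<delta> then \<eta> s else 0) = \<eta>"
      using \<eta>0 by (intro ext) (auto simp: not_le abs_le_iff abs_if)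
    then show ?thesis using \<eta>1 has_integral_restrict_UNIV[of "cbox (- \<delta>) \<delta>" \<eta> 1] by simp
  qed
  have sh: "((\<lambda>t. \<eta> (t - \<tau>)) has_integral 1) {- \<delta>..2 * pi - \<delta>}" if "\<tau> \<in> centers" for \<tau>
  proof -
    have "((\<lambda>t. \<eta> (1 *\<^sub>R t + - \<tau>)) has_integral (1 / \<bar>1\<bar> ^ DIM(real)) *\<^sub>R 1)
        ((\<lambda>t. (1 / 1) *\<^sub>R t + - ((1 / 1) *\<^sub>R - \<tau>)) ` cbox (- \<delta>) \<delta>)"
      by (rule has_integral_affinity[OF \<eta>i]) simp
    moreover have "(\<lambda>t. (1 / 1) *\<^sub>R t + - ((1 / 1) *\<^sub>R - \<tau>)) ` cbox (- \<delta>) \<delta> = {\<tau> - \<delta>..\<tau> + \<delta>}"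
      using image_add_atLeastAtMost[of \<tau> "- \<delta>" \<delta>] by (simp add: add.commute)
    ultimately have h: "((\<lambda>t. \<eta> (t - \<tau>)) has_integral 1) {\<tau> - \<delta>..\<tau> + \<delta>}"
      by (simp add: add.commute)
    \<comment> \<open>Separation from the center 2\<pi>: every segment with center in [0, 2\<pi>)
      ends no later than that of 2\<pi> begins, so the support of the translated
      \<open>\<eta>\<close> stays in the window.\<close>
    have "\<tau> + \<delta> \<le> 2 * pi - \<delta>"
      using center_separated[OF _ center_2pi, of \<tau>] that by (force simp: centers_def)
    then show ?thesis
      using that by (intro has_integral_on_superset[OF h] \<eta>0) (auto simp: centers_def)
  qed
  have "((\<lambda>t. \<Sum>\<tau>\<in>centers. g (fst (\<kappa> (\<gamma> \<tau>))) * e \<tau> * \<eta> (t - \<tau>)) has_integral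
      (\<Sum>\<tau>\<in>centers. g (fst (\<kappa> (\<gamma> \<tau>))) * e \<tau> * 1)) {- \<delta>..2 * pi - \<delta>}"
    by (intro has_integral_sum finite_centers has_integral_mult_right sh)
  then have I: "(?G has_integral ?I) {- \<delta>..2 * pi - \<delta>}"
    by (subst has_integral_cong[OF weight_eq_sum]) (auto simp: \<eta>0)
  have per: "?G (t + 2 * pi) = ?G t" for t
    using e[of "t - snd (\<kappa> (\<gamma> t))"] by (simp add: weight_def periodic diff_add_eq)
  have bounds: "- \<delta> \<le> pi" "pi \<le> 2 * pi - \<delta>" "- pi \<le> - \<delta>" using \<delta>_pos \<delta>_le_pi by auto
  have "?G integrable_on {- \<delta>..2 * pi - \<delta>}" using I by blast
  then have "?G integrable_on {- \<delta>..pi}" "?G integrable_on {pi..2 * pi - \<delta>}"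
    using bounds integrable_on_subinterval by (auto intro: integrable_on_subinterval)
  then obtain a b where a: "(?G has_integral a) {- \<delta>..pi}" and b: "(?G has_integral b) {pi..2 * pi - \<delta>}"
    by (auto simp: integrable_on_def)
  have "a + b = ?I"
    using has_integral_combine[OF bounds(1,2) a b] I has_integral_unique by blast
  have "((\<lambda>t. ?G (1 *\<^sub>R t + 2 * pi)) has_integral (1 / \<bar>1\<bar> ^ DIM(real)) *\<^sub>R b)
      ((\<lambda>t. (1 / 1) *\<^sub>R t + - ((1 / 1) *\<^sub>R (2 * pi))) ` cbox pi (2 * pi - \<delta>))"
    by (rule has_integral_affinity) (use b in auto)
  moreover have "(\<lambda>t. (1 / 1) *\<^sub>R t + - ((1 / 1) *\<^sub>R (2 * pi))) ` cbox pi (2 * pi - \<delta>) = {- pi..- \<delta>}"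
    using image_add_atLeastAtMost[of "- (2 * pi)" pi "2 * pi - \<delta>"] by (simp add: add.commute)
  ultimately have "(?G has_integral b) {- pi..- \<delta>}" by (simp add: per)
  then have "(?G has_integral (b + a)) {- pi..pi}"
    by (rule has_integral_combine[OF bounds(3,1) _ a])
  then show ?thesis using \<open>a + b = ?I\<close> by (simp add: integral_unique add.commute)
qed

end

section \<open>Equivariance along orbits and characters of the stabilizer\<close>

lemma H0b_orbit:
  fixes A :: "('x::topological_space, 'e::euclidean_space) chart set"
  assumes A: "smooth_atlas A" and act: "circle_action A act" and u: "u \<in> H0b A act T10 m"
  shows "u (act (cis t) x) = exp (\<i> * of_nat m * of_real t) * u x"
proof -
  have su: "smooth_fun A u" and Tu: "\<And>y. T_field A act y u = \<i> * of_nat m * u y"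
    using u by (auto simp: H0b_def)
  \<comment> \<open>Integrating factor: along the orbit \<open>u\<close> solves h' = i m h, so this
    product is constant.\<close>
  let ?h = "\<lambda>t. exp (of_real t * - (\<i> * of_nat m)) * u (act (cis t) x)"
  have "(?h has_vector_derivative 0) (at t within UNIV)" for t
  proof -
    have "((\<lambda>t. exp (of_real t * - (\<i> * of_nat m))) has_vector_derivative
        - (\<i> * of_nat m) * exp (of_real t * - (\<i> * of_nat m))) (at t)"
      using exp_scaleR_has_vector_derivative_left[of "- (\<i> * of_nat m)" t] by (simp add: scaleR_conv_of_real)
    moreover have "((\<lambda>t. u (act (cis t) x)) has_vector_derivative \<i> * of_nat m * u (act (cis t) x)) (at t)"
      using T_field_orbit[OF A act su, of x t] by (simp add: Tu)
    ultimately have "(?h has_vector_derivative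
        exp (of_real t * - (\<i> * of_nat m)) * (\<i> * of_nat m * u (act (cis t) x))
        + - (\<i> * of_nat m) * exp (of_real t * - (\<i> * of_nat m)) * u (act (cis t) x)) (at t)"
      by (rule has_vector_derivative_mult)
    then show ?thesis by (simp add: algebra_simps)
  qed
  then obtain c where c: "\<And>t. ?h t = c"
    using has_vector_derivative_zero_constant[OF convex_UNIV, of ?h] by (metis UNIV_I)
  have "act (cis 0) x = x" using act by (simp add: circle_action_def)
  then have h: "?h t = u x" using c[of 0] c[of t] by simp
  have "u (act (cis t) x) = exp (of_real t * (\<i> * of_nat m)) * ?h t" by (simp add: exp_minus)
  also have "\<dots> = exp (of_real t * (\<i> * of_nat m)) * u x" by (simp only: h)
  finally show ?thesis by (simp add: mult_ac)
qed

text \<open>Division with remainder: subtracting the largest multiple of 2\<pi>/k not exceeding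
  \<tau> leaves a stabilizing time in [0, 2\<pi>/k), which the definition of the stratum forces to
  be 0.\<close>

lemma stratum_stabilizer:
  assumes act: "circle_action A act" and k: "k \<ge> 1" and x: "x \<in> stratum act k"
  shows "{\<tau> \<in> {0..<2 * pi}. act (cis \<tau>) x = x} = (\<lambda>j. 2 * pi * real j / real k) ` {..<k}"
proof -
  have fix_j: "act (cis (2 * pi * real j / real k)) x = x" for j
  proof (induction j)
    case 0
    then show ?case using act by (simp add: circle_action_def)
  next
    case (Suc j)
    have "2 * pi * real (Suc j) / real k = 2 * pi / real k + 2 * pi * real j / real k"
      by (simp add: field_simps add_divide_distrib)
    then show ?case using Suc x act_cis_add[OF act] by (simp add: stratum_def)
  qed
  show ?thesis
  proof (intro equalityI subsetI)
    fix \<tau> assume "\<tau> \<in> {\<tau> \<in> {0..<2 * pi}. act (cis \<tau>) x = x}"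
    then have \<tau>: "0 \<le> \<tau>" "\<tau> < 2 * pi" "act (cis \<tau>) x = x" by auto
    define j where "j = nat \<lfloor>\<tau> * real k / (2 * pi)\<rfloor>"
    have "0 \<le> \<tau> * real k / (2 * pi)" using \<tau> by simp
    then have "real j \<le> \<tau> * real k / (2 * pi)" "\<tau> * real k / (2 * pi) < real j + 1"
      unfolding j_def by linarith+
    then have j: "2 * pi * real j / real k \<le> \<tau>" "\<tau> < 2 * pi * real j / real k + 2 * pi / real k"
      using k pi_gt_zero by (simp_all add: field_simps)
    define \<tau>' where "\<tau>' = \<tau> - 2 * pi * real j / real k"
    have "act (cis \<tau>') x = x"
      using act_cis_add[OF act, of \<tau>' "2 * pi * real j / real k" x] fix_j \<tau>(3) by (simp add: \<tau>'_def)
    then have "\<not> (0 < \<tau>' \<and> \<tau>' < 2 * pi / real k)" using x by (auto simp: stratum_def)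
    then have "\<tau> = 2 * pi * real j / real k" using j by (auto simp: \<tau>'_def)
    moreover have "j < k"
    proof -
      have "2 * pi * real j < 2 * pi * real k"
        using \<tau>(2) k unfolding \<open>\<tau> = _\<close> by (simp add: field_simps)
      then show ?thesis by simp
    qed
    ultimately show "\<tau> \<in> (\<lambda>j. 2 * pi * real j / real k) ` {..<k}" by auto
  next
    fix \<tau> assume "\<tau> \<in> (\<lambda>j. 2 * pi * real j / real k) ` {..<k}"
    then show "\<tau> \<in> {\<tau> \<in> {0..<2 * pi}. act (cis \<tau>) x = x}"
      using fix_j k by (auto simp: field_simps)
  qed
qed

text \<open>For m = k q the exponent at the j-th stabilizing time is 2\<pi>i q j, so each of the k
  characters equals 1.\<close>

lemma sum_stabilizer_characters:
  assumes "k \<ge> 1" "k dvd m"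
  shows "(\<Sum>\<tau>\<in>(\<lambda>j. 2 * pi * real j / real k) ` {..<k}. exp (\<i> * of_nat m * complex_of_real \<tau>)) = of_nat k"
proof -
  obtain q where q: "m = k * q" using assms(2) by auto
  have "exp (\<i> * of_nat m * complex_of_real (2 * pi * real j / real k)) = 1" for j
  proof -
    have "\<i> * of_nat m * complex_of_real (2 * pi * real j / real k) = 2 * of_nat (q * j) * of_real pi * \<i>"
      using assms(1) by (simp add: q field_simps)
    then show ?thesis by (metis exp_two_pi_i exp_of_nat_mult mult.assoc mult.commute mult.left_commute power_one)
  qed
  moreover have "inj_on (\<lambda>j. 2 * pi * real j / real k) {..<k}"
    using assms(1) by (auto simp: inj_on_def)
  ultimately show ?thesis by (simp add: sum.reindex)
qed

text \<open>The exponential is 1 only at integer multiples of 2\<pi>i, so m / k is an integer. It is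
  applied contraposed, to the generator of the stabilizer.\<close>

lemma character_not_one:
  assumes "k \<ge> 1" "exp (\<i> * of_nat m * complex_of_real (2 * pi / real k)) = 1"
  shows "k dvd m"
proof -
  obtain n :: int where "real m * (2 * pi / real k) = of_int (2 * n) * pi"
    using assms(2) by (auto simp: exp_eq_1)
  then have "real m = of_int n * real k" using assms(1) by (simp add: field_simps)
  then have "int m = n * int k" by (metis of_int_eq_iff of_int_mult of_int_of_nat_eq)
  then have "int k dvd int m" by simp
  then show ?thesis by simp
qed

text \<open>Freezing \<open>w\<close> is the linear map p to \<open>(fst p, 0)\<close> followed by a
  shift. It sends z-directions to basis vectors and the \<theta>-direction to 0, as
  \<open>moderate_affine\<close> demands.\<close>

lemma moderate_slice:
  fixes a :: "nat \<Rightarrow> (complex ^ 'n::finite) \<times> (complex ^ 'n) \<Rightarrow> complex"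
  assumes "open V" "open V'" "moderate (V \<times> V') a" "open W" "\<And>p. p \<in> W \<Longrightarrow> fst p \<in> V" "w \<in> V'"
  shows "moderate (W :: 'n model set) (\<lambda>m p. a m (fst p, w))"
proof -
  have "moderate W (\<lambda>m p. a m ((fst p, 0) + (0, w)))"
  proof (rule moderate_affine[OF _ assms(3,4)])
    show "open (V \<times> V')" using assms by (simp add: open_Times)
    show "bounded_linear (\<lambda>p :: 'n model. (fst p, 0 :: complex ^ 'n))"
      by (intro bounded_linear_Pair bounded_linear_fst bounded_linear_zero)
    show "(fst b, 0) \<in> insert 0 Basis" if "b \<in> Basis" for b :: "'n model"
      using that by (auto simp: Basis_prod_def zero_prod_def)
  qed (use assms in auto)
  then show ?thesis by simp
qed

lemma smooth_on_slice:
  fixes f :: "(complex ^ 'n::finite) \<times> (complex ^ 'n) \<Rightarrow> complex"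
  assumes "open V" "open V'" "smooth_on (V \<times> V') f" "open W" "\<And>p. p \<in> W \<Longrightarrow> fst p \<in> V" "w \<in> V'"
  shows "smooth_on (W :: 'n model set) (\<lambda>p. f (fst p, w))"
proof -
  have "smooth_on W (\<lambda>p. f ((fst p, 0) + (0, w)))"
  proof (rule smooth_on_affine[OF _ assms(3,4)])
    show "open (V \<times> V')" using assms by (simp add: open_Times)
    show "bounded_linear (\<lambda>p :: 'n model. (fst p, 0 :: complex ^ 'n))"
      by (intro bounded_linear_Pair bounded_linear_fst bounded_linear_zero)
  qed (use assms in auto)
  then show ?thesis by simp
qed

lemma open_patch: "open (patch \<epsilon> \<delta> :: 'n::finite model set)"
proof -
  have "(patch \<epsilon> \<delta> :: 'n model set) = ball 0 \<epsilon> \<times> {-\<delta><..<\<delta>}"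
    by (auto simp: patch_def abs_less_iff)
  then show ?thesis by (simp add: open_Times)
qed

text \<open>A segment of the orbit which leaves the small patch stays at positive distance from it, so its
  contribution is exponentially damped by the phase.\<close>

lemma negligible_on_distant_segment:
  fixes \<Phi> :: "complex ^ 'n::finite \<Rightarrow> complex ^ 'n \<Rightarrow> complex"
  assumes phase: "phase_function \<phi> \<epsilon>\<^sub>1 \<Phi>" and eps: "\<epsilon> \<le> norm w" "norm w < \<epsilon>\<^sub>1"
    and bh: "symbol_class {1..} real d (ball 0 \<epsilon> \<times> ball 0 \<epsilon>\<^sub>1) bh" "0 \<le> d"
    and c: "\<And>m. norm (c m) \<le> C"
  shows "negligible_on {1..} (patch \<epsilon> \<delta> :: 'n model set)
    (\<lambda>m p. exp (\<i> * of_nat m * (of_real (snd p) + \<Phi> (fst p) w)) * (c m * bh m (fst p, w)))"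
proof (rule negligible_on_oscillation[OF open_patch])
  let ?D = "patch \<epsilon> \<delta> :: 'n model set"
  have sub: "fst p \<in> ball 0 \<epsilon>" "fst p \<in> ball 0 \<epsilon>\<^sub>1" if "p \<in> ?D" for p
    using that eps by (auto simp: patch_def)
  have w: "w \<in> ball 0 \<epsilon>\<^sub>1" using eps by simp
  have "smooth_on (ball 0 \<epsilon>\<^sub>1 \<times> ball 0 \<epsilon>\<^sub>1) (\<lambda>(z, w). \<Phi> z w)" using phase by (simp add: phase_function_def)
  from smooth_on_slice[OF open_ball open_ball this open_patch _ w, of \<epsilon> \<delta>]
  have "smooth_on ?D (\<lambda>p. \<Phi> (fst p) w)" using sub by simp
  moreover have "smooth_on ?D (\<lambda>p. complex_of_real (snd p))"
    by (intro smooth_on_bounded_linear bounded_linear_compose[OF bounded_linear_of_real] bounded_linear_snd)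
  ultimately show "smooth_on ?D (\<lambda>p. of_real (snd p) + \<Phi> (fst p) w)"
    by (intro smooth_on_add open_patch)
  show "moderate ?D (\<lambda>m p. c m * bh m (fst p, w))"
  proof (rule moderate_mult[OF open_patch])
    show "moderate ?D (\<lambda>m p. c m)" by (rule moderate_scalar[where C = C and r = 0]) (simp add: c)
    show "moderate ?D (\<lambda>m p. bh m (fst p, w))"
      by (rule moderate_slice[OF open_ball open_ball symbol_class_moderate[OF bh] open_patch sub(1) w])
  qed
  obtain c\<^sub>0 where c0: "c\<^sub>0 > 0" "\<And>z w. z \<in> ball 0 \<epsilon>\<^sub>1 \<Longrightarrow> w \<in> ball 0 \<epsilon>\<^sub>1 \<Longrightarrow> c\<^sub>0 * (norm (z - w))\<^sup>2 \<le> Im (\<Phi> z w)"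
    using phase unfolding phase_function_def by metis
  fix K assume K: "compact K" "K \<subseteq> ?D"
  show "\<exists>c>0. \<forall>p\<in>K. c \<le> Im (of_real (snd p) + \<Phi> (fst p) w)"
  proof (cases "K = {}")
    case False
    have "continuous_on K (\<lambda>p. norm (fst p))" by (intro continuous_intros)
    then obtain q where q: "q \<in> K" "\<And>p. p \<in> K \<Longrightarrow> norm (fst p) \<le> norm (fst q)"
      using continuous_attains_sup[OF K(1) False] by metis
    \<comment> \<open>The gap between the compact set and the boundary of the ball. As
      \<open>w\<close> is not inside the ball, all points of \<open>K\<close> have z-part at
      distance at least \<open>\<rho>\<close> from \<open>w\<close>, even if |w| =
      \<epsilon>.\<close>
    define \<rho> where "\<rho> = \<epsilon> - norm (fst q)"
    have \<rho>: "\<rho> > 0" using q(1) K(2) by (auto simp: \<rho>_def patch_def)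
    have "c\<^sub>0 * \<rho>\<^sup>2 \<le> Im (of_real (snd p) + \<Phi> (fst p) w)" if p: "p \<in> K" for p
    proof -
      have "\<rho> \<le> norm (fst p - w)"
        using q(2)[OF p] eps(1) norm_triangle_ineq3[of "fst p" w] by (simp add: \<rho>_def)
      then have "c\<^sub>0 * \<rho>\<^sup>2 \<le> c\<^sub>0 * (norm (fst p - w))\<^sup>2"
        using c0(1) \<rho> by (intro mult_left_mono power_mono) auto
      also have "\<dots> \<le> Im (\<Phi> (fst p) w)" using c0(2) sub(2) w p K(2) by blast
      finally show ?thesis by simp
    qed
    then show ?thesis using c0(1) \<rho> by (intro exI[of _ "c\<^sub>0 * \<rho>\<^sup>2"]) auto
  qed (auto intro: exI[of _ 1])
qed

section \<open>Estimates at a single point\<close>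

lemma equiv_mod_Oinf_at:
  assumes "equiv_mod_Oinf I W F G" "p \<in> W"
  shows "\<exists>C. \<forall>m\<in>I. norm (F m p - G m p) \<le> C * real m powi (- int N)"
  using assms(1)[unfolded equiv_mod_Oinf_def, THEN conjunct2, THEN spec[of _ "{p}"], THEN spec[of _ "[]"],
    THEN spec[of _ N]] assms(2) by simp

lemma symbol_class_at:
  assumes "symbol_class I \<mu> d W a" "p \<in> W" "\<And>i. i \<in> I \<Longrightarrow> 0 \<le> \<mu> i"
  shows "\<exists>C>0. \<forall>i\<in>I. norm (a i p) \<le> C * \<mu> i powi d"
proof -
  obtain C where C: "\<forall>i\<in>I. norm (a i p) \<le> C * \<mu> i powi d"
    using assms(1)[unfolded symbol_class_def, THEN conjunct2, THEN spec[of _ "{p}"], THEN spec[of _ "[]"]] assms(2)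
    by auto
  \<comment> \<open>Enlarging the constant to \<open>\<bar>C\<bar> + 1\<close> makes it positive,
    and the powers are nonnegative.\<close>
  have "C * \<mu> i powi d \<le> (\<bar>C\<bar> + 1) * \<mu> i powi d" if "i \<in> I" for i
    using assms(3)[OF that] by (intro mult_right_mono zero_le_power_int) auto
  then have "\<forall>i\<in>I. norm (a i p) \<le> (\<bar>C\<bar> + 1) * \<mu> i powi d" using C by (meson order_trans)
  then show ?thesis by (intro exI[of _ "\<bar>C\<bar> + 1"]) auto
qed

theorem theorem2p7:
  fixes A :: "('x::{t2_space, second_countable_topology}, 'n::finite model) chart set"
    and n k :: nat
    and act :: "complex \<Rightarrow> 'x \<Rightarrow> 'x"
    and T10 :: "'x \<Rightarrow> 'x cvec set"
    and \<omega>\<^sub>0 :: "'x \<Rightarrow> 'x cvec \<Rightarrow> complex"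
    and g :: "'x \<Rightarrow> 'x cvec \<Rightarrow> 'x cvec \<Rightarrow> complex"
    and M :: "'x measure"
    and B :: "nat \<Rightarrow> ('x \<Rightarrow> complex) set"
    and x\<^sub>0 :: 'x and U :: "'x set" and \<kappa> :: "'x \<Rightarrow> 'n model"
    and \<phi> :: "complex ^ 'n \<Rightarrow> real"
    and \<epsilon> \<delta> \<epsilon>\<^sub>1 \<delta>\<^sub>1 :: real
    and \<Phi> :: "complex ^ 'n \<Rightarrow> complex ^ 'n \<Rightarrow> complex"
    and S :: "('x \<Rightarrow> complex) \<Rightarrow> ('x \<Rightarrow> complex)"
    and b :: "real \<Rightarrow> 'n model \<times> 'n model \<Rightarrow> complex"
    and bj :: "nat \<Rightarrow> 'n model \<times> 'n model \<Rightarrow> complex"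
    and \<chi>\<^sub>0 \<eta> :: "real \<Rightarrow> complex" and \<chi>\<^sub>1 :: "complex ^ 'n \<Rightarrow> complex"
    and \<Omega> :: "(('n model \<times> 'n model) \<times> ('n model \<times> 'n model)) set"
    and b0ext :: "('n model \<times> 'n model) \<times> ('n model \<times> 'n model) \<Rightarrow> complex"
    and bh :: "nat \<Rightarrow> (complex ^ 'n) \<times> (complex ^ 'n) \<Rightarrow> complex"
    and bhj :: "nat \<Rightarrow> (complex ^ 'n) \<times> (complex ^ 'n) \<Rightarrow> complex"
  defines "D \<equiv> (patch \<epsilon> \<delta> :: 'n model set)"
    and "D\<^sub>1 \<equiv> (patch \<epsilon>\<^sub>1 \<delta>\<^sub>1 :: 'n model set)"
    and "Dt \<equiv> (ball 0 \<epsilon> :: (complex ^ 'n) set)"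
    and "Dt\<^sub>1 \<equiv> (ball 0 \<epsilon>\<^sub>1 :: (complex ^ 'n) set)"
    and "pt \<equiv> inv_into U \<kappa>"
    and "Sm \<equiv> (\<lambda>m. projection_kernel (B m))"
  \<comment> \<open>the CR manifold\<close>
  assumes dim: "n \<ge> 2" "CARD('n) = n - 1"
    and mfd: "smooth_atlas A" "compact (UNIV :: 'x set)" "connected (UNIV :: 'x set)" "orientable A"
    and cr: "cr_structure A T10"
    and action: "circle_action A act" "locally_free act" "cr_action A act T10" "transversal A act T10"
    and reg: "stratum act 1 \<noteq> {}"
    and form: "characteristic_form A act T10 \<omega>\<^sub>0"
    and spc: "strongly_pseudoconvex A T10 \<omega>\<^sub>0"
  \<comment> \<open>metric and kernels\<close>
    and metric: "rigid_metric A act T10 g"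
    and vol: "volume_measure A g M"
    and onb: "\<And>m. m \<ge> 1 \<Longrightarrow> orthonormal_basis M (B m) (H0b A act T10 m)"
  \<comment> \<open>canonical coordinates\<close>
    and k: "k > 1" "x\<^sub>0 \<in> stratum act k"
    and coords: "canonical_coordinates A act T10 \<omega>\<^sub>0 g x\<^sub>0 U \<kappa> \<phi> \<epsilon>\<^sub>1 \<delta>\<^sub>1"
    and D_sub: "0 < \<epsilon>" "\<epsilon> < \<epsilon>\<^sub>1" "0 < \<delta>" "\<delta> < \<delta>\<^sub>1"
    and small: "\<And>\<theta> z \<theta>'. 0 \<le> \<theta> \<Longrightarrow> \<theta> < 2 * pi \<Longrightarrow> (z, \<theta>') \<in> D \<Longrightarrow> z \<noteq> 0
                  \<Longrightarrow> act (cis \<theta>) x\<^sub>0 \<noteq> pt (z, \<theta>')"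
  \<comment> \<open>phase function\<close>
    and phase: "phase_function \<phi> \<epsilon>\<^sub>1 \<Phi>"
    and szego: "szego_projection A T10 M S" "oscillatory_kernel A M S U \<kappa> \<Phi> b"
    and b_exp: "symbol_expansion {1..} (\<lambda>t. t) (int n - 1) (D\<^sub>1 \<times> D\<^sub>1) b bj"
    and b_diag: "\<And>p. p \<in> D\<^sub>1 \<Longrightarrow>
                   bj 0 (p, p) = of_real (1 / 2 / pi ^ n * \<bar>levi_det A T10 \<omega>\<^sub>0 g (pt p)\<bar>)"
  \<comment> \<open>the symbol \<open>bh\<close>\<close>
    and cutoffs: "test_function {-\<delta><..<\<delta>} \<chi>\<^sub>0" "integral UNIV \<chi>\<^sub>0 = 1"
                 "test_function {-\<delta>\<^sub>1<..<\<delta>\<^sub>1} \<eta>" "integral UNIV \<eta> = 1"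
                 "test_function Dt\<^sub>1 \<chi>\<^sub>1" "\<exists>V. open V \<and> closure Dt \<subseteq> V \<and> (\<forall>w\<in>V. \<chi>\<^sub>1 w = 1)"
    and bh_symbol: "symbol_class {1..} real (int n - 1) (Dt \<times> Dt\<^sub>1) bh"
    and bh_exp: "symbol_expansion {1..} real (int n - 1) (Dt \<times> Dt) bh bhj"
    and bh_kernel: "equiv_mod_Oinf {1..} (D \<times> D)
          (\<lambda>m (p, q). Sm m (pt p) (pt q))
          (\<lambda>m (p, q). 1 / (2 * of_real pi) *
             integral {-pi..pi} (\<lambda>\<theta>. S_hat U \<kappa> \<Phi> bh \<chi>\<^sub>1 \<eta> m p (act (cis \<theta>) (pt q)) *
                                      exp (\<i> * of_nat m * of_real \<theta>)))"
    and b0ext: "almost_analytic_extension (D\<^sub>1 \<times> D\<^sub>1) (bj 0) \<Omega> b0ext"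
               "\<And>z w s. z \<in> Dt \<Longrightarrow> w \<in> Dt \<Longrightarrow> s \<in> closure {s. \<chi>\<^sub>0 s \<noteq> 0} \<Longrightarrow> phase_point \<Phi> z w s \<in> \<Omega>"
    and bh0: "\<And>z w. z \<in> Dt \<Longrightarrow> w \<in> Dt \<Longrightarrow>
                bhj 0 (z, w) = 2 * of_real pi *
                  integral {-\<delta>..\<delta>} (\<lambda>s. b0ext (phase_point \<Phi> z w s) * \<chi>\<^sub>0 s)"
    and bh0_diag: "\<And>z. z \<in> Dt \<Longrightarrow>
                bhj 0 (z, z) = of_real (1 / pi ^ (n - 1) * \<bar>levi_det A T10 \<omega>\<^sub>0 g (pt (z, 0))\<bar>)"
  shows "(\<forall>m\<ge>1. \<not> k dvd m \<longrightarrow> (\<forall>p\<in>D. Sm m (pt p) x\<^sub>0 = 0)) \<and>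
    equiv_mod_Oinf {m. 1 \<le> m \<and> k dvd m} D
      (\<lambda>m p. Sm m (pt p) x\<^sub>0)
      (\<lambda>m (z, s). of_nat k / (2 * of_real pi) *
                   exp (\<i> * of_nat m * (of_real s + \<Phi> z 0)) * bh m (z, 0)) \<and>
    (\<forall>N::nat. \<exists>C. \<forall>m\<ge>1. k dvd m \<longrightarrow>
       norm (Sm m x\<^sub>0 x\<^sub>0 - of_nat k / (2 * of_real pi) * bh m (0, 0)) \<le> C * real m powi (- int N)) \<and>
    (\<forall>N::nat. \<exists>C>0. \<forall>m\<ge>1.
       norm (bh m (0, 0) - (\<Sum>j\<le>N. bhj j (0, 0) * of_real (real m powi (int n - 1 - int j))))
         \<le> C * real m powi (int n - 2 - int N))"
proof -
  have k1: "k \<ge> 1" using k by simp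
  note chart = coords[unfolded canonical_coordinates_def]
  have e1: "0 < \<epsilon>\<^sub>1" "0 < \<delta>\<^sub>1" and isU: "is_chart (U, \<kappa>)" and compU: "\<forall>c\<in>A. compatible (U, \<kappa>) c"
    and imU: "\<kappa> ` U = patch \<epsilon>\<^sub>1 \<delta>\<^sub>1" and x0U: "x\<^sub>0 \<in> U" "\<kappa> x\<^sub>0 = (0, 0)"
    and TU: "\<forall>x\<in>U. T_field A act x = coord_vec A (U, \<kappa>) (0, 1) x"
    using chart by blast+
  have pt0: "pt (0, 0) = x\<^sub>0" using chart_inv_into(1)[OF isU x0U(1)] x0U(2) by (simp add: pt_def)
  have D0: "(0, 0) \<in> D" using D_sub by (simp add: D_def patch_def)
  have oD: "open D" unfolding D_def by (rule open_patch)
  let ?\<gamma> = "\<lambda>t. act (cis t) x\<^sub>0"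

  have "0 \<in> closure Dt" using D_sub(1) closure_subset[of Dt] by (auto simp: Dt_def)
  then have chi1: "\<chi>\<^sub>1 0 = 1" using cutoffs(6) by blast
  \<comment> \<open>The integral of a non-integrable function is 0 by default, so the value 1
    already yields integrability.\<close>
  have "\<eta> integrable_on UNIV"
  proof (rule ccontr)
    assume "\<not> \<eta> integrable_on UNIV"
    then have "integral UNIV \<eta> = 0" by (rule not_integrable_integral)
    then show False using cutoffs(4) by simp
  qed
  then have eta_int: "(\<eta> has_integral 1) UNIV"
    using integrable_integral[of \<eta> UNIV] cutoffs(4) by simp
  have eta0: "\<eta> s = 0" if "\<bar>s\<bar> \<ge> \<delta>\<^sub>1" for s
  proof -
    obtain K where "K \<subseteq> {-\<delta>\<^sub>1<..<\<delta>\<^sub>1}" "\<And>p. p \<notin> K \<Longrightarrow> \<eta> p = 0"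
      using cutoffs(3) unfolding test_function_def by metis
    moreover have "s \<notin> {-\<delta>\<^sub>1<..<\<delta>\<^sub>1}" using that by (auto simp: abs_if split: if_splits)
    ultimately show ?thesis by blast
  qed
  \<comment> \<open>\<open>\<eta>\<close> at a point where it is nonzero and
    \<open>\<chi>\<^sub>1\<close> at 0 serve as profiles for the bumps in the patch.\<close>
  have "\<exists>s. \<eta> s \<noteq> 0"
  proof (rule ccontr)
    assume "\<nexists>s. \<eta> s \<noteq> 0"
    then have "\<eta> = (\<lambda>s. 0)" by auto
    then show False using cutoffs(4) by simp
  qed
  then obtain s\<^sub>0 where s0: "\<eta> s\<^sub>0 \<noteq> 0" by blast

  have vel: "((\<lambda>t. \<kappa> (?\<gamma> t)) has_vector_derivative (0, 1)) (at t)" if "?\<gamma> t \<in> U" for t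
  proof (rule orbit_chart_velocity[OF mfd(1) action(1) isU compU TU _ that])
    fix p assume "p \<in> \<kappa> ` U"
    moreover have "open (\<kappa> ` U)" using isU by (simp add: is_chart_def)
    ultimately show "\<exists>F K. smooth_on UNIV F \<and> compact K \<and> K \<subseteq> \<kappa> ` U \<and> (\<forall>p. p \<notin> K \<longrightarrow> F p = 0) \<and> F p \<noteq> (0::complex)"
      using exists_bump[OF cutoffs(5) _ cutoffs(3) s0] chi1 by (metis zero_neq_one)
  qed
  \<comment> \<open>The half-length is that of the large patch, so that each segment carries the
    whole support of \<open>\<eta>\<close>.\<close>
  interpret vertical_orbit ?\<gamma> U \<kappa> \<delta>\<^sub>1
  proof
    show "?\<gamma> (t + 2 * pi) = ?\<gamma> t" for t by (simp add: cis.ctr)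
    show "\<bar>snd (\<kappa> (?\<gamma> t))\<bar> < \<delta>\<^sub>1" if "?\<gamma> t \<in> U" for t
      using imageI[OF that, of \<kappa>] unfolding imU by (auto simp: patch_def)
    show "?\<gamma> (t + (s - snd (\<kappa> (?\<gamma> t)))) \<in> U \<and> \<kappa> (?\<gamma> (t + (s - snd (\<kappa> (?\<gamma> t))))) = (fst (\<kappa> (?\<gamma> t)), s)"
      if "?\<gamma> t \<in> U" "\<bar>s\<bar> < \<delta>\<^sub>1" for t s
      by (rule orbit_vertical[OF action(1) isU imU vel that(1) _ that(2)]) auto
    show "?\<gamma> 0 \<in> U" "snd (\<kappa> (?\<gamma> 0)) = 0"
      using action(1) x0U by (auto simp: circle_action_def)
  qed
  define w where "w \<tau> = fst (\<kappa> (?\<gamma> \<tau>))" for \<tau>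
  \<comment> \<open>A center with \<open>w \<tau> = 0\<close> has coordinates (0, 0), which only
    \<open>x\<^sub>0\<close> has; these centers are thus the times of return to
    \<open>x\<^sub>0\<close>.\<close>
  have stab: "{\<tau> \<in> centers. w \<tau> = 0} = (\<lambda>j. 2 * pi * real j / real k) ` {..<k}"
  proof -
    have "center \<tau> \<and> w \<tau> = 0 \<longleftrightarrow> ?\<gamma> \<tau> = x\<^sub>0" for \<tau>
    proof
      assume "center \<tau> \<and> w \<tau> = 0"
      then have "?\<gamma> \<tau> \<in> U" "\<kappa> (?\<gamma> \<tau>) = (0, 0)" by (simp_all add: center_def w_def prod_eq_iff)
      then show "?\<gamma> \<tau> = x\<^sub>0"
        using chart_inv_into(1)[OF isU, of "?\<gamma> \<tau>"] pt0 unfolding pt_def by (simp only:)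
    qed (use x0U in \<open>simp add: center_def w_def\<close>)
    then have "{\<tau> \<in> centers. w \<tau> = 0} = {\<tau> \<in> {0..<2 * pi}. ?\<gamma> \<tau> = x\<^sub>0}"
      by (auto simp: centers_def)
    then show ?thesis using stratum_stabilizer[OF action(1) k1 k(2)] by simp
  qed
  \<comment> \<open>The midpoint has coordinates \<open>(w \<tau>, 0)\<close>. If |w \<tau>| <
    \<epsilon>, it would be a point of D on the orbit with nonzero z-part, contrary to the choice of
    D.\<close>
  have far: "\<epsilon> \<le> norm (w \<tau>)" "norm (w \<tau>) < \<epsilon>\<^sub>1" if "\<tau> \<in> centers" "w \<tau> \<noteq> 0" for \<tau>
  proof -
    have \<tau>: "0 \<le> \<tau>" "\<tau> < 2 * pi" "?\<gamma> \<tau> \<in> U" "\<kappa> (?\<gamma> \<tau>) = (w \<tau>, 0)"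
      using that(1) by (auto simp: centers_def center_def w_def prod_eq_iff)
    show "norm (w \<tau>) < \<epsilon>\<^sub>1" using imageI[OF \<tau>(3), of \<kappa>] \<tau>(4) unfolding imU by (auto simp: patch_def)
    show "\<epsilon> \<le> norm (w \<tau>)"
    proof (rule ccontr)
      assume "\<not> \<epsilon> \<le> norm (w \<tau>)"
      then have "(w \<tau>, 0) \<in> D" using D_sub by (simp add: D_def patch_def)
      from small[OF \<tau>(1,2) this that(2)] show False
        using chart_inv_into(1)[OF isU \<tau>(3)] \<tau>(4) by (simp add: pt_def)
    qed
  qed

  \<comment> \<open>The kernel as a sum over the centers of the orbit\<close>
  let ?E = "\<lambda>m p w. exp (\<i> * of_nat m * (of_real (snd p) + \<Phi> (fst p) w))"
  \<comment> \<open>The cutoff is kept in the terms: \<open>\<chi>\<^sub>1 (w \<tau>)\<close> equals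
    1 if \<open>w \<tau> = 0\<close> and is just a constant on every other segment.\<close>
  have int_S_hat: "integral {-pi..pi} (\<lambda>\<theta>. S_hat U \<kappa> \<Phi> bh \<chi>\<^sub>1 \<eta> m p (?\<gamma> \<theta>) * exp (\<i> * of_nat m * of_real \<theta>))
      = (\<Sum>\<tau>\<in>centers. ?E m p (w \<tau>) * bh m (fst p, w \<tau>) * \<chi>\<^sub>1 (w \<tau>) * exp (\<i> * of_nat m * of_real \<tau>))" for m p
  proof -
    let ?g = "\<lambda>w. ?E m p w * bh m (fst p, w) * \<chi>\<^sub>1 w" and ?e = "\<lambda>t. exp (\<i> * of_nat m * complex_of_real t)"
    have "?e (t + 2 * pi) = ?e t" for t
    proof -
      have "\<i> * of_nat m * complex_of_real (t + 2 * pi) =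
          \<i> * of_nat m * complex_of_real t + of_nat m * (2 * of_real pi * \<i>)"
        by (simp add: algebra_simps)
      then show ?thesis by (simp only: exp_add exp_of_nat_mult exp_two_pi_i power_one mult_1_right)
    qed
    from integral_weight[where \<eta> = \<eta> and e = ?e and g = ?g, OF eta0 eta_int this]
    have I: "integral {-pi..pi} (weight ?g ?e \<eta>) = (\<Sum>\<tau>\<in>centers. ?g (w \<tau>) * ?e \<tau>)" by (simp add: w_def)
    have "weight ?g ?e \<eta> \<theta> = S_hat U \<kappa> \<Phi> bh \<chi>\<^sub>1 \<eta> m p (?\<gamma> \<theta>) * ?e \<theta>" for \<theta>
    proof -
      \<comment> \<open>The height s enters the phase with a minus sign; absorbed into the
        character, it moves the evaluation from \<theta> to the center \<theta> - s.\<close>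
      have "?E m p v * ?e (\<theta> - s) = exp (\<i> * of_nat m * (of_real (snd p - s) + \<Phi> (fst p) v)) * ?e \<theta>" for v s
        by (simp add: exp_add[symmetric] algebra_simps)
      then show ?thesis by (simp add: weight_def S_hat_def Psi_def mult_ac)
    qed
    then have "(\<lambda>\<theta>. S_hat U \<kappa> \<Phi> bh \<chi>\<^sub>1 \<eta> m p (?\<gamma> \<theta>) * ?e \<theta>) = weight ?g ?e \<eta>"
      by (intro ext) (rule sym)
    then show ?thesis by (simp only: I)
  qed

  have main: "equiv_mod_Oinf {m. 1 \<le> m \<and> k dvd m} D (\<lambda>m p. Sm m (pt p) x\<^sub>0)
      (\<lambda>m (z, s). of_nat k / (2 * of_real pi) * exp (\<i> * of_nat m * (of_real s + \<Phi> z 0)) * bh m (z, 0))"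
  proof -
    let ?I = "{m. 1 \<le> m \<and> k dvd m}"
    define R where "R = (\<lambda>m p. Sm m (pt p) x\<^sub>0 - 1 / (2 * of_real pi) *
       integral {-pi..pi} (\<lambda>\<theta>. S_hat U \<kappa> \<Phi> bh \<chi>\<^sub>1 \<eta> m p (?\<gamma> \<theta>) * exp (\<i> * of_nat m * of_real \<theta>)))"
    have R: "negligible_on {1..} D R"
      using negligible_on_section[OF oD oD D0 bh_kernel[unfolded equiv_mod_Oinf_iff_negligible]]
      by (simp add: pt0 R_def)
    \<comment> \<open>The part of a term that does not depend on \<open>p\<close>. It is bounded in
      \<open>m\<close> because the character has modulus 1.\<close>
    define c where "c \<tau> m = 1 / (2 * of_real pi) * (\<chi>\<^sub>1 (w \<tau>) * exp (\<i> * of_nat m * of_real \<tau>))" for \<tau> and m :: nat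
    let ?Q = "{\<tau> \<in> centers. w \<tau> \<noteq> 0}"
    have "negligible_on {1..} D (\<lambda>m p. \<Sum>\<tau>\<in>?Q. ?E m p (w \<tau>) * (c \<tau> m * bh m (fst p, w \<tau>)))"
    proof (rule negligible_on_sum[OF oD])
      show "finite ?Q" using finite_centers by simp
      fix \<tau> assume "\<tau> \<in> ?Q"
      then have \<tau>: "\<tau> \<in> centers" "w \<tau> \<noteq> 0" by auto
      have c: "norm (c \<tau> m) \<le> norm (\<chi>\<^sub>1 (w \<tau>)) / (2 * pi)" for m
        by (simp add: c_def norm_mult norm_divide norm_exp_eq_Re)
      show "negligible_on {1..} D (\<lambda>m p. ?E m p (w \<tau>) * (c \<tau> m * bh m (fst p, w \<tau>)))"
        unfolding D_def
        by (rule negligible_on_distant_segment[OF phase far[OF \<tau>] bh_symbol[unfolded Dt_def Dt\<^sub>1_def] _ c])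
          (use dim in auto)
    qed
    \<comment> \<open>Both errors are negligible for all m \<ge> 1; the restriction to multiples of
      \<open>k\<close> serves the sum of the stabilizer characters below.\<close>
    then have "negligible_on ?I D (\<lambda>m p. R m p + (\<Sum>\<tau>\<in>?Q. ?E m p (w \<tau>) * (c \<tau> m * bh m (fst p, w \<tau>))))"
      by (intro negligible_on_subset[OF negligible_on_add[OF oD R]]) auto
    then show ?thesis
      unfolding equiv_mod_Oinf_iff_negligible
    proof (rule negligible_on_cong[OF oD, rotated])
      fix m p assume "m \<in> ?I"
      then have m: "k dvd m" by simp
      let ?f = "\<lambda>\<tau>. ?E m p (w \<tau>) * bh m (fst p, w \<tau>) * \<chi>\<^sub>1 (w \<tau>) * exp (\<i> * of_nat m * of_real \<tau>)"
      have "(\<Sum>\<tau>\<in>centers. ?f \<tau>) = (\<Sum>\<tau>\<in>?Q. ?f \<tau>) + (\<Sum>\<tau>\<in>{\<tau> \<in> centers. w \<tau> = 0}. ?f \<tau>)"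
        by (subst sum.union_disjoint[symmetric]) (auto intro: sum.cong finite_subset[OF _ finite_centers])
      also have "(\<Sum>\<tau>\<in>{\<tau> \<in> centers. w \<tau> = 0}. ?f \<tau>)
          = (\<Sum>\<tau>\<in>{\<tau> \<in> centers. w \<tau> = 0}. ?E m p 0 * bh m (fst p, 0) * exp (\<i> * of_nat m * of_real \<tau>))"
        by (rule sum.cong) (auto simp: chi1)
      also have "\<dots> = ?E m p 0 * bh m (fst p, 0) * of_nat k"
        unfolding sum_distrib_left[symmetric] stab sum_stabilizer_characters[OF k1 m] ..
      finally have S: "(\<Sum>\<tau>\<in>centers. ?f \<tau>) = (\<Sum>\<tau>\<in>?Q. ?f \<tau>) + ?E m p 0 * bh m (fst p, 0) * of_nat k" .
      have Q: "(\<Sum>\<tau>\<in>?Q. ?E m p (w \<tau>) * (c \<tau> m * bh m (fst p, w \<tau>))) = 1 / (2 * of_real pi) * (\<Sum>\<tau>\<in>?Q. ?f \<tau>)"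
        unfolding sum_distrib_left by (intro sum.cong) (auto simp: c_def mult_ac)
      have alg: "a - q * (X + e * b * of_nat k) + q * X = a - of_nat k * q * e * b" for a q X e b :: complex
        by (simp add: algebra_simps)
      show "R m p + (\<Sum>\<tau>\<in>?Q. ?E m p (w \<tau>) * (c \<tau> m * bh m (fst p, w \<tau>))) =
          Sm m (pt p) x\<^sub>0 - (case p of (z, s) \<Rightarrow>
            of_nat k / (2 * of_real pi) * exp (\<i> * of_nat m * (of_real s + \<Phi> z 0)) * bh m (z, 0))"
        unfolding R_def int_S_hat S Q alg by (simp add: case_prod_beta)
    qed
  qed

  \<comment> \<open>Vanishing off the multiples of \<open>k\<close>, and the diagonal value\<close>
  have vanish: "Sm m (pt p) x\<^sub>0 = 0" if "m \<ge> 1" "\<not> k dvd m" for m p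
  proof -
    have "f x\<^sub>0 = 0" if "f \<in> B m" for f
    proof -
      have "f \<in> H0b A act T10 m" using onb[OF \<open>m \<ge> 1\<close>] that by (auto simp: orthonormal_basis_def)
      from H0b_orbit[OF mfd(1) action(1) this, of "2 * pi / real k" x\<^sub>0]
      have "f x\<^sub>0 = exp (\<i> * of_nat m * complex_of_real (2 * pi / real k)) * f x\<^sub>0"
        using k(2) by (simp add: stratum_def)
      then show ?thesis using character_not_one[OF k1, of m] \<open>\<not> k dvd m\<close> by auto
    qed
    then show ?thesis unfolding Sm_def projection_kernel_def by (intro sum.neutral) simp
  qed

  have diag: "\<exists>C. \<forall>m\<ge>1. k dvd m \<longrightarrow>
      norm (Sm m x\<^sub>0 x\<^sub>0 - of_nat k / (2 * of_real pi) * bh m (0, 0)) \<le> C * real m powi (- int N)" for N :: nat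
  proof -
    have "\<forall>z\<in>ball 0 \<epsilon>\<^sub>1. \<forall>w\<in>ball 0 \<epsilon>\<^sub>1. \<Phi> z w = 0 \<longleftrightarrow> z = w"
      using phase unfolding phase_function_def by (elim conjE)
    \<comment> \<open>This makes the exponential factor equal to 1 at the point (0, 0).\<close>
    then have "\<Phi> 0 0 = 0" using e1 by simp
    then show ?thesis using equiv_mod_Oinf_at[OF main D0, of N] by (simp add: pt0 imp_conjL)
  qed

  have expansion: "\<exists>C>0. \<forall>m\<ge>1. norm (bh m (0, 0) - (\<Sum>j\<le>N. bhj j (0, 0) * of_real (real m powi (int n - 1 - int j))))
      \<le> C * real m powi (int n - 2 - int N)" for N :: nat
  proof -
    have "symbol_class {1..} real (int n - 1 - int N - 1) (Dt \<times> Dt)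
        (\<lambda>i w. bh i w - (\<Sum>j\<le>N. bhj j w * of_real (real i powi (int n - 1 - int j))))"
      using bh_exp unfolding symbol_expansion_def by (elim conjE allE)
    \<comment> \<open>After the terms j \<le> N of an expansion of order n - 1, the remainder has
      order one less than the last term kept.\<close>
    moreover have "int n - 1 - int N - 1 = int n - 2 - int N" by simp
    ultimately have sc: "symbol_class {1..} real (int n - 2 - int N) (Dt \<times> Dt)
        (\<lambda>i w. bh i w - (\<Sum>j\<le>N. bhj j w * of_real (real i powi (int n - 1 - int j))))"
      by simp
    have "(0, 0) \<in> Dt \<times> Dt" using D_sub(1) by (simp add: Dt_def)
    from symbol_class_at[OF sc this] show ?thesis by (simp add: Ball_def)
  qed
  show ?thesis using vanish main diag expansion by simp
qed

end
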